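(* Let $n$ be a positive odd integer, and let $M=(n-1)/2$ or $M=n-1$. Then $$\sum_{k=0}^{M}[4k+1]\frac{(q;q^2)_k^3(q^2;q^4)_k}{(q^2;q^2)_k^3(q^4;q^4)_k}q^{-k^2}\equiv[n]q^{(1-n)/2}\left\{1+[n]^2\frac{(n^2-1)(1-q)^2}{24}\right\}\sum_{k=0}^{(n-1)/2}\frac{(q;q^2)_k^3}{(q^2;q^2)_k(q^4;q^4)_k}(-q)^{k}\pmod{[n]\Phi_n(q)^3}.$$
   Context: For a nonnegative integer $k$, $(x;q)_0=1$ and $(x;q)_k=(1-x)(1-xq)\cdots(1-xq^{k-1})$ for $k\ge 1$; the same notation is used with base $q$ replaced by $q^2$ or $q^4$. $[m]=(1-q^m)/(1-q)$, and $\Phi_n(q)$ is the $n$-th cyclotomic polynomial in $q$. For rational functions $A,B\in\mathbb{Q}(q)$ and a polynomial $P\in\mathbb{Q}[q]$, $A\equiv B\pmod P$ means that $A-B$, written in lowest terms, has numerator divisible by $P$. *)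

theory Defs
  imports "HOL-Computational_Algebra.Computational_Algebra" "HOL-Computational_Algebra.Field_as_Ring"
begin

section \<open>The field of rational functions in one variable over the rationals\<close>

type_synonym ratfun = "rat poly fract"

definition qvar :: ratfun where
  "qvar = to_fract [:0, 1:]"

text \<open>The component \<open>fst (quot_of_fract R)\<close> is the numerator of \<open>R\<close> in lowest terms
  (with monic denominator).\<close>

definition ratfun_cong :: "ratfun \<Rightarrow> ratfun \<Rightarrow> rat poly \<Rightarrow> bool" where
  "ratfun_cong A B P \<longleftrightarrow> P dvd fst (quot_of_fract (A - B))"

section \<open>q-shifted factorials and q-integers\<close>

definition qpoch :: "'a::comm_ring_1 \<Rightarrow> 'a \<Rightarrow> nat \<Rightarrow> 'a" where
  "qpoch x b k = (\<Prod>i<k. 1 - x * b ^ i)"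

definition qint :: "nat \<Rightarrow> ratfun" where
  "qint m = (1 - qvar ^ m) / (1 - qvar)"

text \<open>The same q-integer as an element of the polynomial ring, for use in moduli.\<close>

definition qint_poly :: "nat \<Rightarrow> rat poly" where
  "qint_poly m = (\<Sum>i<m. [:0, 1:] ^ i)"

lemma to_fract_power: "to_fract (x ^ k) = to_fract x ^ k"
  by (induction k) simp_all

lemma qvar_neq_1: "qvar \<noteq> 1"
proof -
  have "to_fract [:0, 1:] \<noteq> (to_fract 1 :: ratfun)"
    by (subst to_fract_eq_iff) (simp add: one_pCons)
  then show ?thesis
    by (simp add: qvar_def)
qed

lemma to_fract_qint_poly: "to_fract (qint_poly m) = qint m"
  using qvar_neq_1
  by (simp add: qint_poly_def qint_def to_fract_power sum_gp_strict flip: qvar_def)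

section \<open>Cyclotomic polynomials\<close>

definition primroots :: "nat \<Rightarrow> complex set" where
  "primroots n = {z. z ^ n = 1 \<and> (\<forall>m. 0 < m \<and> m < n \<longrightarrow> z ^ m \<noteq> 1)}"

definition cyclotomic :: "nat \<Rightarrow> rat poly" where
  "cyclotomic n = (THE p. map_poly of_rat p = (\<Prod>z\<in>primroots n. [:- z, 1:]))"

text \<open>For positive \<open>n\<close> the description above does determine a rational polynomial; see
  \<open>map_poly_cyclotomic\<close> below.\<close>

lemma map_poly_of_rat_add:
  "map_poly of_rat (p + q) = (map_poly of_rat p + map_poly of_rat q :: complex poly)"
  by (rule poly_eqI) (simp add: coeff_map_poly of_rat_add)

lemma map_poly_of_rat_mult:
  "map_poly of_rat (p * q) = (map_poly of_rat p * map_poly of_rat q :: complex poly)"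
  by (rule poly_eqI) (simp add: coeff_map_poly coeff_mult of_rat_sum of_rat_mult)

lemma map_poly_of_rat_prod:
  "map_poly of_rat (\<Prod>x\<in>A. f x) = (\<Prod>x\<in>A. map_poly of_rat (f x) :: complex poly)"
  by (induction A rule: infinite_finite_induct) (simp_all add: map_poly_of_rat_mult)

lemma map_poly_of_rat_inj:
  "map_poly of_rat p = (map_poly of_rat q :: complex poly) \<Longrightarrow> p = q"
  by (auto simp: poly_eq_iff coeff_map_poly)

lemma degree_map_poly_of_rat: "degree (map_poly of_rat p :: complex poly) = degree p"
  by (rule degree_map_poly) simp

lemma map_poly_of_rat_dvdD:
  assumes "(map_poly of_rat r :: complex poly) dvd map_poly of_rat p"
  shows   "r dvd p"
proof (cases "r = 0")
  case True
  with assms show ?thesis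
    using map_poly_of_rat_inj[of p 0] by simp
next
  case False
  let ?h = "map_poly of_rat :: rat poly \<Rightarrow> complex poly"
  have "?h p = ?h (p div r) * ?h r + ?h (p mod r)"
    by (metis div_mult_mod_eq map_poly_of_rat_add map_poly_of_rat_mult)
  with assms have "?h r dvd ?h (p mod r)"
    by (metis dvd_add_right_iff dvd_triv_right)
  moreover have "p mod r = 0 \<or> degree (?h (p mod r)) < degree (?h r)"
    using degree_mod_less[OF False, of p] by (simp add: degree_map_poly_of_rat)
  ultimately have "p mod r = 0"
    by (metis dvd_imp_degree_le leD map_poly_0 map_poly_of_rat_inj)
  then show ?thesis
    by (simp add: dvd_eq_mod_eq_0)
qed

lemma root_of_unity_primroots:
  assumes "n > 0"
  shows   "{z::complex. z ^ n = 1} = (\<Union>d\<in>{d. d dvd n}. primroots d)"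
proof (intro set_eqI iffI)
  fix z :: complex
  assume "z \<in> {z. z ^ n = 1}"
  then have z: "z ^ n = 1" by simp
  define d where "d = (LEAST d. d > 0 \<and> z ^ d = 1)"
  have d: "d > 0 \<and> z ^ d = 1"
    unfolding d_def by (rule LeastI[of _ n]) (use assms z in auto)
  have least: "z ^ m \<noteq> 1" if "0 < m" "m < d" for m
    using that not_less_Least[of m "\<lambda>d. d > 0 \<and> z ^ d = 1"] by (auto simp: d_def)
  have "z ^ n = (z ^ d) ^ (n div d) * z ^ (n mod d)"
    by (metis mult_div_mod_eq power_add power_mult)
  then have "z ^ (n mod d) = 1"
    using z d by simp
  then have "n mod d = 0"
    using least[of "n mod d"] d by (meson mod_less_divisor not_gr_zero)
  then show "z \<in> (\<Union>d\<in>{d. d dvd n}. primroots d)"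
    using d least by (auto simp: primroots_def)
next
  fix z :: complex
  assume "z \<in> (\<Union>d\<in>{d. d dvd n}. primroots d)"
  then show "z \<in> {z. z ^ n = 1}"
    by (auto simp: primroots_def power_mult elim!: dvdE)
qed

lemma prod_primroots:
  assumes "n > 0"
  shows   "(\<Prod>d | d dvd n. \<Prod>z\<in>primroots d. [:- z, 1:]) = monom 1 n - (1 :: complex poly)"
proof -
  let ?p = "monom 1 n - 1 :: complex poly"
  have fin: "finite {z::complex. z ^ n = 1}"
    using assms by (intro finite_roots_unity) simp
  have root: "poly ?p z = 0 \<longleftrightarrow> z ^ n = 1" for z
    by (simp add: poly_monom)
  have deg: "degree ?p = n"
    using assms by (intro antisym degree_le le_degree) (auto simp: coeff_1)
  have lead: "lead_coeff ?p = 1"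
    using assms by (simp only: deg) simp
  have "rsquarefree ?p"
    unfolding rsquarefree_roots
  proof safe
    fix z assume "poly ?p z = 0" "poly (pderiv ?p) z = 0"
    then have "z ^ n = 1" "z ^ (n - 1) = 0"
      using assms by (simp_all add: root pderiv_diff pderiv_monom poly_monom)
    then show False
      using assms by (auto simp: power_0_left)
  qed
  then have "?p = (\<Prod>z | z ^ n = 1. [:- z, 1:])"
    using complex_poly_decompose_rsquarefree[of ?p] by (simp only: lead root) simp
  also have "\<dots> = (\<Prod>d | d dvd n. \<Prod>z\<in>primroots d. [:- z, 1:])"
    unfolding root_of_unity_primroots[OF assms]
  proof (rule prod.UNION_disjoint)
    show "finite {d. d dvd n}"
      using assms by simp
    show "\<forall>d\<in>{d. d dvd n}. finite (primroots d)"
      using fin unfolding root_of_unity_primroots[OF assms] by (meson UN_upper finite_subset)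
    show "\<forall>d\<in>{d. d dvd n}. \<forall>e\<in>{d. d dvd n}. d \<noteq> e \<longrightarrow> primroots d \<inter> primroots e = {}"
      using assms by (auto simp: primroots_def) (metis dvd_pos_nat linorder_neqE_nat)
  qed
  finally show ?thesis ..
qed

lemma map_poly_cyclotomic:
  assumes "n > 0"
  shows   "map_poly of_rat (cyclotomic n) = (\<Prod>z\<in>primroots n. [:- z, 1:])"
  using assms
proof (induction n rule: less_induct)
  case (less n)
  let ?h = "map_poly of_rat :: rat poly \<Rightarrow> complex poly"
  let ?C = "\<lambda>d. \<Prod>z\<in>primroots d. [:- z, 1:]"
  define r where "r = (\<Prod>d\<in>{d. d dvd n} - {n}. cyclotomic d)"
  have "?h r = (\<Prod>d\<in>{d. d dvd n} - {n}. ?C d)"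
    unfolding r_def map_poly_of_rat_prod
    using less by (intro prod.cong less.IH) (auto dest: dvd_imp_le intro: Nat.gr0I)
  moreover have "(\<Prod>d | d dvd n. ?C d) = ?C n * (\<Prod>d\<in>{d. d dvd n} - {n}. ?C d)"
    using less.prems by (intro prod.remove) auto
  moreover have "?h (monom 1 n - 1) = monom 1 n - 1"
    by (rule poly_eqI) (simp add: coeff_map_poly of_rat_diff coeff_1)
  ultimately have eq: "?h (monom 1 n - 1) = ?C n * ?h r"
    using prod_primroots[OF less.prems] by simp
  then have "r dvd monom 1 n - 1"
    by (metis dvd_triv_right map_poly_of_rat_dvdD)
  then obtain s where s: "monom 1 n - 1 = s * r"
    by (metis dvd_def mult.commute)
  have "monom 1 n - (1 :: rat poly) \<noteq> 0"
  proof
    assume "monom 1 n - (1 :: rat poly) = 0"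
    then have "poly (monom 1 n - (1 :: rat poly)) 0 = 0"
      by simp
    then show False
      using less.prems by (simp add: poly_monom power_0_left)
  qed
  then have "r \<noteq> 0"
    using s by auto
  then have "?h r \<noteq> 0"
    using map_poly_of_rat_inj[of r 0] by auto
  then have "?h s = ?C n"
    using eq s by (simp add: map_poly_of_rat_mult)
  then show ?case
    unfolding cyclotomic_def by (rule theI) (metis \<open>?h s = ?C n\<close> map_poly_of_rat_inj)
qed

end

theory Submission
  imports Defs "HOL-Complex_Analysis.Complex_Analysis"
begin

text \<open>
  Divisibility by \<open>[n] \<Phi>\<^sub>n\<^sup>3\<close> means that the difference of the two sides vanishes to order four at the
  primitive \<open>n\<close>-th roots of unity and to order one at the other roots of \<open>[n]\<close>.

  At a primitive \<open>n\<close>-th root, deform the \<open>k\<close>-th summand on the left by two parameters, \<open>F(y, b)\<close>, where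
  \<open>y = a + 1/a - 2\<close> measures the replacement of \<open>(q; q\<^sup>2)\<^sub>k\<^sup>2\<close> by \<open>(aq; q\<^sup>2)\<^sub>k (q/a; q\<^sup>2)\<^sub>k\<close> (and likewise in the
  denominator). If \<open>a = q\<^sup>n\<close> or \<open>b = q\<^sup>n\<close> then the series terminates at
  \<open>k = (n - 1)/2\<close>, and Watson's \<open>8\<phi>7\<close> transformation, in the limit where one parameter tends to zero,
  turns it into a sum of the shape of the right-hand side. Now
  \<open>F(0,1) = F(y,1) + F(0,b) - F(y,b) + (mixed difference)\<close> with \<open>y = (1 - q\<^sup>n)\<^sup>2 / q\<^sup>n\<close> and \<open>b = q\<^sup>n\<close>.
  The mixed difference is \<open>y (1 - q\<^sup>n)\<close> times a quantity that tends to a sum which is antisymmetric under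
  \<open>k \<mapsto> (n - 1)/2 - k\<close>, so it is negligible; the three evaluated sums contribute the right-hand side, the
  factor \<open>(n\<^sup>2 - 1)/24\<close> being minus the sum of \<open>\<zeta>\<^sup>m / (1 - \<zeta>\<^sup>m)\<^sup>2\<close> over the even \<open>m\<close> with \<open>0 < m < n\<close>.

  At a primitive \<open>d\<close>-th root with \<open>d\<close> a proper divisor of \<open>n\<close>, the sum splits into blocks of length \<open>d\<close>,
  each of which tends to zero by the same antisymmetry.
\<close>

section \<open>Watson's transformation in a limiting case\<close>

lemma qpoch_0 [simp]: "qpoch x p 0 = 1"
  by (simp add: qpoch_def)

lemma qpoch_Suc: "qpoch x p (Suc k) = qpoch x p k * (1 - x * p ^ k)"
  by (simp add: qpoch_def)

lemma qpoch_Suc_left: "qpoch x p (Suc k) = (1 - x) * qpoch (x * p) p k"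
  unfolding qpoch_def by (subst prod.lessThan_Suc_shift) (simp add: mult.assoc)

lemma qpoch_add: "qpoch x p (k + m) = qpoch x p k * qpoch (x * p ^ k) p m"
  by (induction m) (simp_all add: qpoch_Suc power_add mult_ac)

lemma qpoch_eq_0_iff:
  fixes x :: "'a::field"
  shows "qpoch x p k = 0 \<longleftrightarrow> (\<exists>i<k. x * p ^ i = 1)"
  by (auto simp: qpoch_def)

lemma qpoch_nonzero_mono:
  fixes x :: "'a::field"
  assumes "qpoch x p k \<noteq> 0" "j \<le> k"
  shows "qpoch x p j \<noteq> 0"
  using assms by (auto simp: qpoch_eq_0_iff)

lemma qpoch_nonzeroD:
  fixes x :: "'a::field"
  assumes "qpoch x p k \<noteq> 0" "i < k"
  shows "1 - x * p ^ i \<noteq> 0"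
  using assms by (auto simp: qpoch_eq_0_iff)

section \<open>The q-Saalschuetz summation\<close>

context
  fixes p a b x :: "'a::field"
begin

text \<open>The summand of the terminating balanced 3-phi-2 series with lower parameter
  \<open>c = a * b * x\<close>. Reversing one factorial to length \<open>m - s\<close> avoids
  negative powers of \<open>p\<close>.\<close>

definition saalschuetz_term :: "nat \<Rightarrow> nat \<Rightarrow> 'a" where
  "saalschuetz_term m s = qpoch a p s * qpoch b p s * qpoch x p (m - s) * x ^ s
     / (qpoch p p s * qpoch p p (m - s) * qpoch (a * b * x) p s)"

text \<open>A certificate in the sense of Zeilberger for the first-order recurrence in
  \<open>m\<close>: this combination of summands is a difference in \<open>s\<close>, so its partial
  sums have a closed form that induction on \<open>S\<close> confirms.\<close>

lemma saalschuetz_telescope: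
  assumes "S \<le> m" and p: "qpoch p p (Suc m) \<noteq> 0" and abx: "qpoch (a * b * x) p (Suc m) \<noteq> 0"
  shows "(\<Sum>s\<le>S. (1 - p ^ Suc m) * (1 - a * b * x * p ^ m) * saalschuetz_term (Suc m) s
            - (1 - a * x * p ^ m) * (1 - b * x * p ^ m) * saalschuetz_term m s)
     = - (p ^ (m - S)) * qpoch a p (Suc S) * qpoch b p (Suc S) * qpoch x p (m - S) * x ^ Suc S
       / (qpoch p p S * qpoch p p (m - S) * qpoch (a * b * x) p S)"
  using assms(1)
proof (induction S)
  case 0
  have "qpoch p p m \<noteq> 0" "1 - p * p ^ m \<noteq> 0"
    using p by (auto simp: qpoch_Suc)
  then show ?case
    by (simp add: saalschuetz_term_def qpoch_Suc divide_simps) (simp add: algebra_simps)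
next
  case (Suc S)
  define j where "j = m - Suc S"
  have m: "m = Suc (S + j)" using Suc.prems by (simp add: j_def)
  define u v where "u = p ^ S" and "v = p ^ j"
  define A B X P J C where "A = qpoch a p (Suc S)" and "B = qpoch b p (Suc S)"
    and "X = qpoch x p j" and "P = qpoch p p S" and "J = qpoch p p j"
    and "C = qpoch (a * b * x) p S"
  have nz: "P \<noteq> 0" "J \<noteq> 0" "C \<noteq> 0" "1 - p * u \<noteq> 0" "1 - p * v \<noteq> 0" "1 - a * b * x * u \<noteq> 0"
    unfolding P_def J_def C_def u_def v_def
    by (rule qpoch_nonzero_mono[OF p] qpoch_nonzero_mono[OF abx]
        qpoch_nonzeroD[OF p] qpoch_nonzeroD[OF abx]; simp add: m)+
  \<comment> \<open>\<open>K\<close> is the common factor of the four quantities below. Once it is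
    split off, the induction step is a polynomial identity in \<open>a\<close>, \<open>b\<close>,
    \<open>x\<close>, \<open>p\<close>, \<open>u\<close>, \<open>v\<close>.\<close>
  define K where "K = A * B * X * x ^ Suc S / (P * (1 - p * u) * (J * (1 - p * v)) * (C * (1 - a * b * x * u)))"
  have 1: "saalschuetz_term (Suc m) (Suc S) = K * (1 - x * v)"
    using nz by (simp add: saalschuetz_term_def m Suc_diff_le qpoch_Suc[of x] qpoch_Suc[of p] qpoch_Suc[of "a*b*x"] K_def
        flip: u_def v_def A_def B_def X_def P_def J_def C_def)
  have 2: "saalschuetz_term m (Suc S) = K * (1 - p * v)"
    using nz by (simp add: saalschuetz_term_def m Suc_diff_le qpoch_Suc[of x] qpoch_Suc[of p] qpoch_Suc[of "a*b*x"] K_def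
        flip: u_def v_def A_def B_def X_def P_def J_def C_def) (simp add: mult_ac)
  have 3: "- (p ^ (m - S)) * qpoch a p (Suc S) * qpoch b p (Suc S) * qpoch x p (m - S) * x ^ Suc S
       / (qpoch p p S * qpoch p p (m - S) * qpoch (a * b * x) p S)
     = - K * (p * v * (1 - x * v) * (1 - p * u) * (1 - a * b * x * u))"
    using nz by (simp add: m Suc_diff_le qpoch_Suc[of x] qpoch_Suc[of p] K_def
        flip: u_def v_def A_def B_def X_def P_def J_def C_def) (simp add: mult_ac)
  have 4: "- (p ^ (m - Suc S)) * qpoch a p (Suc (Suc S)) * qpoch b p (Suc (Suc S)) * qpoch x p (m - Suc S) * x ^ Suc (Suc S)
       / (qpoch p p (Suc S) * qpoch p p (m - Suc S) * qpoch (a * b * x) p (Suc S))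
     = - K * (v * (1 - a * (u * p)) * (1 - b * (u * p)) * x * (1 - p * v))"
    using nz by (simp add: m qpoch_Suc[of a p "Suc S"] qpoch_Suc[of b p "Suc S"] qpoch_Suc[of p]
         qpoch_Suc[of "a*b*x"] K_def flip: u_def v_def A_def B_def X_def P_def J_def C_def)
      (simp add: mult_ac)
  have pm: "p ^ m = p * u * v" "p ^ Suc m = p * p * u * v"
    by (simp_all add: m u_def v_def power_add)
  have IH: "(\<Sum>s\<le>S. (1 - p ^ Suc m) * (1 - a * b * x * p ^ m) * saalschuetz_term (Suc m) s
            - (1 - a * x * p ^ m) * (1 - b * x * p ^ m) * saalschuetz_term m s)
    = - K * (p * v * (1 - x * v) * (1 - p * u) * (1 - a * b * x * u))"
    using Suc.IH Suc.prems unfolding 3 by simp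
  show ?case
    unfolding sum.atMost_Suc IH 4 unfolding 1 2 pm by algebra
qed

lemma q_saalschuetz:
  assumes "qpoch p p m \<noteq> 0" and "qpoch (a * b * x) p m \<noteq> 0"
  shows "(\<Sum>s\<le>m. saalschuetz_term m s) = qpoch (a * x) p m * qpoch (b * x) p m / (qpoch p p m * qpoch (a * b * x) p m)"
  using assms
proof (induction m)
  case 0
  then show ?case by (simp add: saalschuetz_term_def)
next
  case (Suc m)
  have nz: "qpoch p p m \<noteq> 0" "qpoch (a * b * x) p m \<noteq> 0" "1 - p * p ^ m \<noteq> 0" "1 - a * b * x * p ^ m \<noteq> 0"
    using Suc.prems by (auto simp: qpoch_Suc)
  \<comment> \<open>At \<open>S = m\<close> the closed form is minus the missing summand
    \<open>s = Suc m\<close>, which leaves a recurrence for the complete sums.\<close>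
  have "(\<Sum>s\<le>m. (1 - p ^ Suc m) * (1 - a * b * x * p ^ m) * saalschuetz_term (Suc m) s
            - (1 - a * x * p ^ m) * (1 - b * x * p ^ m) * saalschuetz_term m s)
     = - ((1 - p ^ Suc m) * (1 - a * b * x * p ^ m) * saalschuetz_term (Suc m) (Suc m))"
    using nz by (subst saalschuetz_telescope) (auto simp: Suc.prems saalschuetz_term_def qpoch_Suc[of p] qpoch_Suc[of "a*b*x"])
  then have "(1 - p ^ Suc m) * (1 - a * b * x * p ^ m) * (\<Sum>s\<le>Suc m. saalschuetz_term (Suc m) s)
     = (1 - a * x * p ^ m) * (1 - b * x * p ^ m) * (\<Sum>s\<le>m. saalschuetz_term m s)"
    by (simp add: sum_subtractf flip: sum_distrib_left) (simp add: algebra_simps)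
  then have "(\<Sum>s\<le>Suc m. saalschuetz_term (Suc m) s)
     = (1 - a * x * p ^ m) * (1 - b * x * p ^ m) * (\<Sum>s\<le>m. saalschuetz_term m s) / ((1 - p * p ^ m) * (1 - a * b * x * p ^ m))"
    using nz by (metis nonzero_mult_div_cancel_left no_zero_divisors power_Suc)
  then show ?case
    using Suc.IH nz by (simp add: qpoch_Suc mult_ac)
qed

end

section \<open>A terminating very-well-poised summation\<close>

context
  fixes p A b :: "'a::field"
begin

text \<open>Up to a factor free of \<open>r\<close>, the summand of the terminating 6-phi-5 series
  with one parameter sent to 0. The last two factors of the denominator are the kernel in the
  definition of a Bailey pair relative to \<open>A\<close>.\<close>

definition well_poised_term :: "nat \<Rightarrow> nat \<Rightarrow> 'a" where
  "well_poised_term L r = (1 - A * p ^ (2 * r)) / (1 - A) * qpoch A p r * qpoch b p r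
     / (b ^ r * qpoch p p r * qpoch (A * p / b) p r * qpoch p p (L - r) * qpoch (A * p) p (L + r))"

text \<open>Again a certificate, now for a first-order recurrence in \<open>L\<close>. At
  \<open>R = L\<close> its right-hand side is the contribution, with opposite sign, of the term
  \<open>r = Suc L\<close> that the sum lacks.\<close>

lemma well_poised_telescope:
  assumes "R \<le> L" and b: "b \<noteq> 0" and p: "qpoch p p (Suc L) \<noteq> 0"
    and A1: "A \<noteq> 1" and A: "qpoch (A * p) p (2 * Suc L) \<noteq> 0"
    and Ab: "qpoch (A * p / b) p (Suc L) \<noteq> 0"
  shows "(\<Sum>r\<le>R. (1 - p ^ Suc L) * (1 - A * p / b * p ^ L) * b * well_poised_term (Suc L) r - well_poised_term L r)
     = - (qpoch (A * p) p R * qpoch b p (Suc R)) / (b ^ R * qpoch p p R * qpoch (A * p / b) p R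
         * qpoch p p (L - R) * qpoch (A * p) p (Suc (L + R)))"
  using assms(1)
proof (induction R)
  case 0
  have nz: "qpoch p p L \<noteq> 0" "1 - p * p ^ L \<noteq> 0" "qpoch (A * p) p L \<noteq> 0" "1 - A * p * p ^ L \<noteq> 0"
    using p qpoch_nonzero_mono[OF A, of L] qpoch_nonzeroD[OF A, of L] by (auto simp: qpoch_Suc)
  show ?case
    using nz A1 b by (simp add: well_poised_term_def qpoch_Suc divide_simps)
next
  case (Suc R)
  define j where "j = L - Suc R"
  have L: "L = Suc (R + j)" using Suc.prems by (simp add: j_def)
  define u v where "u = p ^ R" and "v = p ^ j"
  define Y B D P J C where "Y = qpoch (A * p) p R" and "B = qpoch b p (Suc R)"
    and "D = qpoch (A * p / b) p R" and "P = qpoch p p R" and "J = qpoch p p j"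
    and "C = qpoch (A * p) p (L + Suc R)"
  define w where "w = p * p * u * u * v"
  have pw: "p ^ (L + Suc R) = w" "p ^ L = p * u * v" "p ^ (2 * Suc R) = p * p * u * u"
    by (simp_all add: L u_def v_def w_def power_add mult_2)
  have nz: "P \<noteq> 0" "J \<noteq> 0" "C \<noteq> 0" "D \<noteq> 0" "1 - p * u \<noteq> 0" "1 - p * v \<noteq> 0"
     "1 - A * p / b * u \<noteq> 0" "1 - A * p * w \<noteq> 0"
    unfolding P_def J_def C_def D_def u_def v_def pw(1)[symmetric]
    by (rule qpoch_nonzero_mono[OF p] qpoch_nonzero_mono[OF A] qpoch_nonzero_mono[OF Ab]
        qpoch_nonzeroD[OF p] qpoch_nonzeroD[OF A] qpoch_nonzeroD[OF Ab]; simp add: L)+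
  have qA: "qpoch A p (Suc R) = (1 - A) * Y"
    by (simp add: qpoch_Suc_left Y_def)
  have qC: "qpoch (A * p) p (Suc L + Suc R) = C * (1 - A * p * w)"
      "qpoch (A * p) p (Suc (L + Suc R)) = C * (1 - A * p * w)"
    by (simp_all add: C_def qpoch_Suc flip: pw(1))
  have qC': "qpoch (A * p) p (Suc (L + R)) = C" by (simp add: C_def)
  have qp: "qpoch p p (Suc L - Suc R) = J * (1 - p * v)" "qpoch p p (L - R) = J * (1 - p * v)"
     "qpoch p p (L - Suc R) = J" "qpoch p p (Suc R) = P * (1 - p * u)"
     "qpoch (A * p / b) p (Suc R) = D * (1 - A * p / b * u)"
     "qpoch b p (Suc (Suc R)) = B * (1 - b * (p * u))" "qpoch (A * p) p (Suc R) = Y * (1 - A * p * u)"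
    by (simp_all add: L J_def P_def v_def u_def qpoch_Suc D_def B_def Y_def)
  define K where "K = Y * B / (b ^ Suc R * P * (1 - p * u) * D * (1 - A * p / b * u) * J * (1 - p * v) * C * (1 - A * p * w))"
  have 1: "well_poised_term (Suc L) (Suc R) = K * (1 - A * (p * p * u * u))"
    using A1 nz unfolding well_poised_term_def qA pw qC qp K_def by (simp add: B_def mult_ac)
  have 2: "well_poised_term L (Suc R) = K * (1 - A * (p * p * u * u)) * (1 - p * v) * (1 - A * p * w)"
    using A1 nz unfolding well_poised_term_def qA pw qC qp K_def by (simp add: B_def C_def mult_ac)
  have 3: "- (qpoch (A * p) p R * qpoch b p (Suc R)) / (b ^ R * qpoch p p R * qpoch (A * p / b) p R
         * qpoch p p (L - R) * qpoch (A * p) p (Suc (L + R)))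
     = - K * (b * (1 - p * u) * (1 - A * p / b * u) * (1 - A * p * w))"
    using b nz unfolding qp qC' K_def Y_def[symmetric] B_def[symmetric] P_def[symmetric] D_def[symmetric]
    by (simp add: mult_ac)
  have 4: "- (qpoch (A * p) p (Suc R) * qpoch b p (Suc (Suc R))) / (b ^ Suc R * qpoch p p (Suc R) * qpoch (A * p / b) p (Suc R)
         * qpoch p p (L - Suc R) * qpoch (A * p) p (Suc (L + Suc R)))
     = - K * ((1 - A * p * u) * (1 - b * (p * u)) * (1 - p * v))"
    using b nz unfolding qp qC K_def
    by (simp add: mult_ac)
  have IH: "(\<Sum>r\<le>R. (1 - p ^ Suc L) * (1 - A * p / b * p ^ L) * b * well_poised_term (Suc L) r - well_poised_term L r)
     = - K * (b * (1 - p * u) * (1 - A * p / b * u) * (1 - A * p * w))"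
    using Suc.IH Suc.prems unfolding 3 by simp
  \<comment> \<open>Eliminating the quotient \<open>A * p / b\<close> makes the remaining identity
    polynomial in \<open>b\<close>, \<open>d\<close>, \<open>p\<close>, \<open>u\<close>,
    \<open>v\<close>.\<close>
  define d where "d = A * p / b"
  have Ap: "A * p = b * d" using b by (simp add: d_def)
  have App: "A * (p * p * u * u) = b * d * p * u * u" by (simp flip: Ap)
  show ?case
    unfolding sum.atMost_Suc IH 4 unfolding 1 2 App Ap d_def[symmetric] power_Suc pw w_def
    by (simp add: algebra_simps)
qed

lemma well_poised_sum:
  assumes b: "b \<noteq> 0" and "qpoch p p L \<noteq> 0" and A1: "A \<noteq> 1" and "qpoch (A * p) p (2 * L) \<noteq> 0"
    and "qpoch (A * p / b) p L \<noteq> 0"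
  shows "(\<Sum>r\<le>L. well_poised_term L r) = 1 / (b ^ L * qpoch p p L * qpoch (A * p / b) p L)"
  using assms(2,4,5)
proof (induction L)
  case 0
  then show ?case using A1 by (simp add: well_poised_term_def)
next
  case (Suc L)
  have nz: "qpoch p p L \<noteq> 0" "qpoch (A * p / b) p L \<noteq> 0" "1 - p ^ Suc L \<noteq> 0" "1 - A * p / b * p ^ L \<noteq> 0"
    using Suc.prems by (auto simp: qpoch_Suc)
  have nz2: "qpoch (A * p) p L \<noteq> 0" "qpoch (A * p) p (Suc (2 * L)) \<noteq> 0" "1 - A * p * p ^ Suc (2 * L) \<noteq> 0"
     "qpoch (A * p) p (2 * L) \<noteq> 0"
    by (rule qpoch_nonzero_mono[OF Suc.prems(2)] qpoch_nonzeroD[OF Suc.prems(2)]; simp)+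
  have qA: "qpoch A p (Suc L) = (1 - A) * qpoch (A * p) p L"
    by (simp add: qpoch_Suc_left)
  have qA2: "qpoch (A * p) p (Suc L + Suc L) = qpoch (A * p) p (Suc (2 * L)) * (1 - A * p * p ^ Suc (2 * L))"
    using qpoch_Suc[of "A * p" p "Suc (2 * L)"] by (simp add: mult_2)
  have qp: "qpoch p p (Suc L) = qpoch p p L * (1 - p ^ Suc L)"
     "qpoch (A * p / b) p (Suc L) = qpoch (A * p / b) p L * (1 - A * p / b * p ^ L)"
    by (simp_all add: qpoch_Suc)
  have p2: "A * p ^ (2 * Suc L) = A * p * p ^ Suc (2 * L)" by simp
  have V: "well_poised_term (Suc L) (Suc L) = qpoch (A * p) p L * qpoch b p (Suc L) / (b * b ^ L * (qpoch p p L * (1 - p ^ Suc L))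
      * (qpoch (A * p / b) p L * (1 - A * p / b * p ^ L)) * qpoch (A * p) p (Suc (2 * L)))"
    using nz2 A1 unfolding well_poised_term_def qA qA2 qp p2 by (simp add: mult_ac)
  have "(\<Sum>r\<le>L. (1 - p ^ Suc L) * (1 - A * p / b * p ^ L) * b * well_poised_term (Suc L) r - well_poised_term L r)
     = - ((1 - p ^ Suc L) * (1 - A * p / b * p ^ L) * b * well_poised_term (Suc L) (Suc L))"
    using nz b Suc.prems A1 by (subst well_poised_telescope) (simp_all add: V mult_2 del: power_Suc)
  moreover define c where "c = (1 - p ^ Suc L) * (1 - A * p / b * p ^ L) * b"
  ultimately have "c * (\<Sum>r\<le>L. well_poised_term (Suc L) r) - (\<Sum>r\<le>L. well_poised_term L r) = - (c * well_poised_term (Suc L) (Suc L))"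
    by (simp add: sum_subtractf flip: sum_distrib_left)
  then have "(1 - p ^ Suc L) * (1 - A * p / b * p ^ L) * b * (\<Sum>r\<le>Suc L. well_poised_term (Suc L) r) = (\<Sum>r\<le>L. well_poised_term L r)"
    unfolding c_def[symmetric] by (simp add: algebra_simps)
  then have "(\<Sum>r\<le>Suc L. well_poised_term (Suc L) r) = (\<Sum>r\<le>L. well_poised_term L r) / ((1 - p ^ Suc L) * (1 - A * p / b * p ^ L) * b)"
    using nz b by (metis nonzero_mult_div_cancel_left no_zero_divisors)
  then show ?case
    unfolding qp using Suc.IH nz nz2 by (simp add: mult_ac)
qed

end

text \<open>Bailey's lemma: the well-poised sums \<open>well_poised_sum\<close> give a Bailey pair, and exchanging the order of
  summation leaves inner sums of Saalschuetz type.\<close>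

lemma watson_limit:
  fixes p A b d e x :: "'a::field"
  assumes x: "A * p = d * e * x" and b: "b \<noteq> 0" and A1: "A \<noteq> 1"
    and p: "qpoch p p N \<noteq> 0" and A: "qpoch (A * p) p (2 * N) \<noteq> 0"
    and Ab: "qpoch (A * p / b) p N \<noteq> 0"
    and ex: "qpoch (e * x) p N \<noteq> 0" and dx: "qpoch (d * x) p N \<noteq> 0"
  shows "(\<Sum>r\<le>N. (1 - A * p ^ (2 * r)) / (1 - A) * qpoch A p r * qpoch b p r * qpoch d p r * qpoch e p r * x ^ r
       / (b ^ r * qpoch p p r * qpoch (A * p / b) p r * qpoch (e * x) p r * qpoch (d * x) p r
          * qpoch p p (N - r) * qpoch (A * p) p (N + r)))
    = (\<Sum>L\<le>N. qpoch d p L * qpoch e p L * qpoch x p (N - L) * x ^ L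
         / (qpoch p p (N - L) * b ^ L * qpoch p p L * qpoch (A * p / b) p L))
      / (qpoch (e * x) p N * qpoch (d * x) p N)"
proof -
  define \<kappa> where "\<kappa> r = (1 - A * p ^ (2 * r)) / (1 - A) * qpoch A p r * qpoch b p r
     / (b ^ r * qpoch p p r * qpoch (A * p / b) p r)" for r
  define \<delta> where "\<delta> L = qpoch d p L * qpoch e p L * qpoch x p (N - L) * x ^ L / qpoch p p (N - L)" for L
  define \<epsilon> where "\<epsilon> L r = 1 / (qpoch p p (L - r) * qpoch (A * p) p (L + r))" for L r
  have well_poised_term: "well_poised_term p A b L r = \<kappa> r * \<epsilon> L r" for L r
    by (simp add: well_poised_term_def \<kappa>_def \<epsilon>_def mult_ac)
  \<comment> \<open>Shifted by \<open>r\<close>, the inner sum is a Saalschuetz sum with parameters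
    \<open>d * p ^ r\<close> and \<open>e * p ^ r\<close>; the relation
    \<open>A * p = d * e * x\<close> is exactly what makes it balanced.\<close>
  have inner: "(\<Sum>L\<in>{r..N}. \<delta> L * \<epsilon> L r)
      = qpoch d p r * qpoch e p r * x ^ r / (qpoch (e * x) p r * qpoch (d * x) p r)
        * (qpoch (e * x) p N * qpoch (d * x) p N) * \<epsilon> N r" if "r \<le> N" for r
  proof -
    define m where "m = N - r"
    have N: "N = r + m" using that by (simp add: m_def)
    have "(\<Sum>L\<in>{r..N}. \<delta> L * \<epsilon> L r) = (\<Sum>s\<le>m. \<delta> (r + s) * \<epsilon> (r + s) r)"
      by (rule sum.reindex_bij_witness[of _ "\<lambda>s. r + s" "\<lambda>L. L - r"]) (auto simp: N)
    also have "\<dots> = (\<Sum>s\<le>m. qpoch d p r * qpoch e p r * x ^ r / qpoch (A * p) p (2 * r)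
        * saalschuetz_term p (d * p ^ r) (e * p ^ r) x m s)"
    proof (rule sum.cong)
      fix s assume "s \<in> {..m}"
      have "qpoch (A * p) p (r + s + r) = qpoch (A * p) p (2 * r) * qpoch (A * p * p ^ (2 * r)) p s"
        by (subst qpoch_add[symmetric]) (simp add: mult_2 add_ac)
      moreover have "A * p * p ^ (2 * r) = d * p ^ r * (e * p ^ r) * x"
        by (simp add: x mult_2 mult_2_right power_add mult_ac)
      ultimately show "\<delta> (r + s) * \<epsilon> (r + s) r = qpoch d p r * qpoch e p r * x ^ r / qpoch (A * p) p (2 * r)
        * saalschuetz_term p (d * p ^ r) (e * p ^ r) x m s"
        unfolding \<delta>_def \<epsilon>_def saalschuetz_term_def N
        by (simp add: qpoch_add[of d] qpoch_add[of e] power_add) (simp add: mult_ac)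
    qed simp
    also have "\<dots> = qpoch d p r * qpoch e p r * x ^ r / qpoch (A * p) p (2 * r)
        * (qpoch (d * p ^ r * x) p m * qpoch (e * p ^ r * x) p m
           / (qpoch p p m * qpoch (d * p ^ r * (e * p ^ r) * x) p m))"
    proof (subst sum_distrib_left[symmetric], subst q_saalschuetz)
      have "d * p ^ r * (e * p ^ r) * x = A * p * p ^ (2 * r)"
        by (simp add: x mult_2 mult_2_right power_add mult_ac)
      moreover have "qpoch (A * p) p (2 * r + m) \<noteq> 0"
        by (rule qpoch_nonzero_mono[OF A]) (simp add: N)
      ultimately show "qpoch (d * p ^ r * (e * p ^ r) * x) p m \<noteq> 0"
        by (simp add: qpoch_add)
      show "qpoch p p m \<noteq> 0" by (rule qpoch_nonzero_mono[OF p]) (simp add: N)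
    qed simp
    also have "\<dots> = qpoch d p r * qpoch e p r * x ^ r / (qpoch (e * x) p r * qpoch (d * x) p r)
        * (qpoch (e * x) p N * qpoch (d * x) p N) * \<epsilon> N r"
    proof -
      have 1: "d * p ^ r * (e * p ^ r) * x = A * p * p ^ (2 * r)"
        by (simp add: x mult_2 mult_2_right power_add mult_ac)
      have 2: "qpoch (A * p) p (N + r) = qpoch (A * p) p (2 * r) * qpoch (A * p * p ^ (2 * r)) p m"
        by (subst qpoch_add[symmetric]) (simp add: mult_2 add_ac N)
      have 3: "qpoch (d * x) p N = qpoch (d * x) p r * qpoch (d * p ^ r * x) p m"
         "qpoch (e * x) p N = qpoch (e * x) p r * qpoch (e * p ^ r * x) p m"
        unfolding N qpoch_add by (simp_all add: mult_ac)
      have 4: "qpoch (d * x) p r \<noteq> 0" "qpoch (e * x) p r \<noteq> 0"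
        using ex dx unfolding 3 by auto
      show ?thesis
        unfolding \<epsilon>_def 1 2 3 using 4 by (simp add: N) (simp add: mult_ac)
    qed
    finally show ?thesis .
  qed
  have nz: "b \<noteq> 0" "qpoch p p L \<noteq> 0" "qpoch (A * p) p (2 * L) \<noteq> 0" "qpoch (A * p / b) p L \<noteq> 0" if "L \<le> N" for L
    using that by (auto intro!: b qpoch_nonzero_mono[OF p] qpoch_nonzero_mono[OF A] qpoch_nonzero_mono[OF Ab] simp del: mult_Suc_right)
  \<comment> \<open>Here \<open>well_poised_sum\<close> is read from right to left: the closed form
    inside the sum over \<open>L\<close> is expanded into a sum over \<open>r\<close>.\<close>
  have "(\<Sum>L\<le>N. qpoch d p L * qpoch e p L * qpoch x p (N - L) * x ^ L
         / (qpoch p p (N - L) * b ^ L * qpoch p p L * qpoch (A * p / b) p L))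
     = (\<Sum>L\<le>N. \<delta> L * (\<Sum>r\<le>L. well_poised_term p A b L r))"
    using nz by (intro sum.cong refl) (simp add: well_poised_sum A1 \<delta>_def mult_ac)
  also have "\<dots> = (\<Sum>L\<le>N. \<Sum>r\<le>L. \<kappa> r * (\<delta> L * \<epsilon> L r))"
    by (simp add: well_poised_term sum_distrib_left mult_ac)
  also have "\<dots> = (\<Sum>r\<le>N. \<Sum>L\<in>{r..N}. \<kappa> r * (\<delta> L * \<epsilon> L r))"
    by (simp add: sum.Sigma) (rule sum.reindex_bij_witness[of _ "\<lambda>(r, L). (L, r)" "\<lambda>(L, r). (r, L)"]; auto)
  also have "\<dots> = (\<Sum>r\<le>N. \<kappa> r * (qpoch d p r * qpoch e p r * x ^ r / (qpoch (e * x) p r * qpoch (d * x) p r)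
        * (qpoch (e * x) p N * qpoch (d * x) p N) * \<epsilon> N r))"
    by (intro sum.cong refl) (simp add: inner flip: sum_distrib_left)
  also have "\<dots> = (\<Sum>r\<le>N. (1 - A * p ^ (2 * r)) / (1 - A) * qpoch A p r * qpoch b p r * qpoch d p r * qpoch e p r * x ^ r
       / (b ^ r * qpoch p p r * qpoch (A * p / b) p r * qpoch (e * x) p r * qpoch (d * x) p r
          * qpoch p p (N - r) * qpoch (A * p) p (N + r))) * (qpoch (e * x) p N * qpoch (d * x) p N)"
    unfolding sum_distrib_right by (intro sum.cong refl) (simp add: \<kappa>_def \<epsilon>_def mult_ac)
  finally show ?thesis using ex dx by simp
qed

lemma qpoch_rev:
  assumes "j \<le> N"
  shows "qpoch x p N = qpoch x p (N - j) * (\<Prod>i<j. 1 - x * p ^ (N - Suc i))"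
  using assms
proof (induction j)
  case (Suc j)
  have "qpoch x p (N - j) = qpoch x p (N - Suc j) * (1 - x * p ^ (N - Suc j))"
    using Suc.prems by (subst qpoch_Suc[symmetric]) (simp add: Suc_diff_Suc)
  with Suc show ?case by (simp add: mult_ac)
qed simp

text \<open>After multiplication by \<open>qpoch p p N * qpoch (A * p) p N\<close>, and division by
  \<open>qpoch x p N\<close> on the right, the factorials of length \<open>N - k\<close> and
  \<open>N + k\<close> become products over \<open>i < k\<close>. Both sides are then sums of
  products of term ratios, the form in which the deformations are compared.\<close>

lemma watson_limit_prod:
  fixes p A b d e x :: "'a::field"
  assumes x: "A * p = d * e * x" and b: "b \<noteq> 0" and A1: "A \<noteq> 1"
    and p: "qpoch p p N \<noteq> 0" and A: "qpoch (A * p) p (2 * N) \<noteq> 0"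
    and Ab: "qpoch (A * p / b) p N \<noteq> 0"
    and ex: "qpoch (e * x) p N \<noteq> 0" and dx: "qpoch (d * x) p N \<noteq> 0" and xN: "qpoch x p N \<noteq> 0"
  shows "(\<Sum>k\<le>N. (1 - A * p ^ (2 * k)) / (1 - A) * (\<Prod>i<k.
       (1 - A * p ^ i) * (1 - b * p ^ i) * (1 - d * p ^ i) * (1 - e * p ^ i) * (1 - p ^ (N - i)) * x
       / (b * (1 - p * p ^ i) * (1 - A * p / b * p ^ i) * (1 - e * x * p ^ i) * (1 - d * x * p ^ i)
          * (1 - A * p ^ Suc (N + i)))))
    = qpoch (A * p) p N * qpoch x p N / (qpoch (e * x) p N * qpoch (d * x) p N)
      * (\<Sum>k\<le>N. \<Prod>i<k. (1 - d * p ^ i) * (1 - e * p ^ i) * (1 - p ^ (N - i)) * x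
          / (b * (1 - x * p ^ (N - Suc i)) * (1 - p * p ^ i) * (1 - A * p / b * p ^ i)))"
    (is "?L = ?C * (\<Sum>k\<le>N. ?R k)")
proof -
  have pN: "qpoch p p (N - k) \<noteq> 0" "qpoch p p (N - k) * (\<Prod>i<k. 1 - p ^ (N - i)) = qpoch p p N" if "k \<le> N" for k
  proof -
    have "p * p ^ (N - Suc i) = p ^ (N - i)" if "i < k" for i
      using that \<open>k \<le> N\<close> by (simp flip: power_Suc add: Suc_diff_Suc)
    then show "qpoch p p (N - k) * (\<Prod>i<k. 1 - p ^ (N - i)) = qpoch p p N"
      using qpoch_rev[OF that, of p p] by simp
    then show "qpoch p p (N - k) \<noteq> 0" using p by auto
  qed
  have "?L = (\<Sum>k\<le>N. (1 - A * p ^ (2 * k)) / (1 - A) * qpoch A p k * qpoch b p k * qpoch d p k * qpoch e p k * x ^ k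
       / (b ^ k * qpoch p p k * qpoch (A * p / b) p k * qpoch (e * x) p k * qpoch (d * x) p k
          * qpoch p p (N - k) * qpoch (A * p) p (N + k))) * (qpoch p p N * qpoch (A * p) p N)"
    unfolding sum_distrib_right
  proof (intro sum.cong refl)
    fix k assume "k \<in> {..N}"
    then have k: "k \<le> N" by simp
    have AN: "qpoch (A * p) p (N + k) = qpoch (A * p) p N * (\<Prod>i<k. 1 - A * p ^ Suc (N + i))"
      by (subst qpoch_add) (simp add: qpoch_def power_add mult_ac)
    have AN0: "qpoch (A * p) p N \<noteq> 0"
      by (rule qpoch_nonzero_mono[OF A]) simp
    show "(1 - A * p ^ (2 * k)) / (1 - A) * (\<Prod>i<k.
       (1 - A * p ^ i) * (1 - b * p ^ i) * (1 - d * p ^ i) * (1 - e * p ^ i) * (1 - p ^ (N - i)) * x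
       / (b * (1 - p * p ^ i) * (1 - A * p / b * p ^ i) * (1 - e * x * p ^ i) * (1 - d * x * p ^ i)
          * (1 - A * p ^ Suc (N + i)))) =
      (1 - A * p ^ (2 * k)) / (1 - A) * qpoch A p k * qpoch b p k * qpoch d p k * qpoch e p k * x ^ k
       / (b ^ k * qpoch p p k * qpoch (A * p / b) p k * qpoch (e * x) p k * qpoch (d * x) p k
          * qpoch p p (N - k) * qpoch (A * p) p (N + k)) * (qpoch p p N * qpoch (A * p) p N)"
      unfolding AN pN(2)[OF k, symmetric] prod_dividef prod.distrib using AN0 pN(1)[OF k]
      by (simp add: qpoch_def) (simp add: mult_ac)
  qed
  also have "\<dots> = (\<Sum>L\<le>N. qpoch d p L * qpoch e p L * qpoch x p (N - L) * x ^ L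
         / (qpoch p p (N - L) * b ^ L * qpoch p p L * qpoch (A * p / b) p L))
      / (qpoch (e * x) p N * qpoch (d * x) p N) * (qpoch p p N * qpoch (A * p) p N)"
    by (subst watson_limit[OF assms(1-8)]) simp
  also have "\<dots> = (\<Sum>L\<le>N. qpoch d p L * qpoch e p L * qpoch x p (N - L) * x ^ L
         / (qpoch p p (N - L) * b ^ L * qpoch p p L * qpoch (A * p / b) p L) * (qpoch p p N / qpoch x p N)) * ?C"
    using xN by (subst sum_distrib_right[symmetric]) simp
  also have "\<dots> = (\<Sum>k\<le>N. ?R k) * ?C"
  proof (rule arg_cong[where f = "\<lambda>z. z * ?C"], intro sum.cong refl)
    fix k assume "k \<in> {..N}"
    then have k: "k \<le> N" by simp
    have xk: "qpoch x p N = qpoch x p (N - k) * (\<Prod>i<k. 1 - x * p ^ (N - Suc i))"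
      by (rule qpoch_rev[OF k])
    have x0: "qpoch x p (N - k) \<noteq> 0" using xN xk by auto
    show "qpoch d p k * qpoch e p k * qpoch x p (N - k) * x ^ k
         / (qpoch p p (N - k) * b ^ k * qpoch p p k * qpoch (A * p / b) p k) * (qpoch p p N / qpoch x p N) = ?R k"
      unfolding xk pN(2)[OF k, symmetric] prod_dividef prod.distrib using x0 pN(1)[OF k]
      by (simp add: qpoch_def) (simp add: mult_ac)
  qed
  finally show ?thesis by (simp add: mult_ac)
qed

text \<open>Each summand is a product of ratios of consecutive terms, and \<open>cstep\<close>, \<open>hstep\<close> are these ratios (without
  \<open>[4k+1]\<close>) for the two sides of the congruence. The deformation in \<open>a\<close> multiplies them by \<open>fstep\<close> and the
  numerator of \<open>fstep\<close>, that in \<open>b\<close> by \<open>gstep\<close> and \<open>gostep\<close>.\<close>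

definition cstep :: "'a::field \<Rightarrow> nat \<Rightarrow> 'a" where
  "cstep q i = (1 - q ^ (2 * i + 1)) ^ 4 * (1 + q ^ (2 * i + 1))
     / ((1 - q ^ (2 * i + 2)) ^ 4 * (1 + q ^ (2 * i + 2)) * q ^ (2 * i + 1))"

definition hstep :: "'a::field \<Rightarrow> nat \<Rightarrow> 'a" where
  "hstep q i = - q * (1 - q ^ (2 * i + 1)) ^ 3 / ((1 - q ^ (2 * i + 2)) ^ 2 * (1 + q ^ (2 * i + 2)))"

text \<open>With \<open>y = a + 1/a - 2\<close> the quantity \<open>1 - y * phi q m\<close> is (1 -
  a q^m)(1 - q^m / a) / (1 - q^m)^2. The symmetric deformation in \<open>a\<close> therefore depends
  on \<open>y\<close> alone and is affine in \<open>y\<close> factor by factor.\<close>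

definition phi :: "'a::field \<Rightarrow> nat \<Rightarrow> 'a" where
  "phi q m = q ^ m / (1 - q ^ m) ^ 2"

definition fstep :: "'a::field \<Rightarrow> 'a \<Rightarrow> nat \<Rightarrow> 'a" where
  "fstep q y i = (1 - y * phi q (2 * i + 1)) / (1 - y * phi q (2 * i + 2))"

definition gstep :: "'a::field \<Rightarrow> 'a \<Rightarrow> nat \<Rightarrow> 'a" where
  "gstep q z i = (z - q ^ (2 * i + 1)) * (1 - q ^ (2 * i + 2)) / ((1 - q ^ (2 * i + 1)) * (1 - z * q ^ (2 * i + 2)))"

definition gostep :: "'a::field \<Rightarrow> 'a \<Rightarrow> nat \<Rightarrow> 'a" where
  "gostep q z i = (q ^ (2 * i + 1) - z) * (1 - q ^ (2 * i + 2)) / ((q ^ (2 * i + 2) - z) * (1 - q ^ (2 * i + 1)))"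

text \<open>Its products are the quotients (q; q^2)_k / (q^2; q^2)_k, the part of
  \<open>cstep\<close> and \<open>hstep\<close> that can have poles at roots of unity of odd
  order.\<close>

definition rstep :: "'a::field \<Rightarrow> nat \<Rightarrow> 'a" where
  "rstep q i = (1 - q ^ (2 * i + 1)) / (1 - q ^ (2 * i + 2))"

lemma one_minus_phi:
  fixes q z :: "'a::field"
  assumes "z \<noteq> 0" "q ^ m \<noteq> 1"
  shows "1 - (1 - z)\<^sup>2 / z * phi q m = (z - q ^ m) * (1 - z * q ^ m) / (z * (1 - q ^ m)\<^sup>2)"
  using assms unfolding phi_def by (simp add: divide_simps) (simp add: algebra_simps power2_eq_square)

section \<open>The deformed series at \<open>z = q ^ n\<close>\<close>

context
  fixes q z :: "'a::field" and n N :: nat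
  assumes n: "n = 2 * N + 1" and z: "z = q ^ n"
    and q0: "q \<noteq> 0" and q: "\<And>m. 0 < m \<Longrightarrow> m \<le> 8 * n \<Longrightarrow> q ^ m \<noteq> 1"
begin

lemma z_nonzero: "z \<noteq> 0" using q0 by (simp add: z)

lemma one_plus_nonzero: "1 + q ^ m \<noteq> 0" if "0 < m" "m \<le> 4 * n" for m
proof
  assume "1 + q ^ m = 0"
  then have "q ^ m = - 1" by (metis add_eq_0_iff)
  then have "q ^ (2 * m) = 1" by (simp add: power_mult mult.commute[of 2])
  with q[of "2 * m"] that show False by simp
qed

lemma z_minus_nonzero: "z - q ^ m \<noteq> 0" if "m \<noteq> n" "m \<le> 8 * n" for m
proof
  assume "z - q ^ m = 0"
  then have eq: "q ^ n = q ^ m" by (simp add: z)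
  show False
  proof (cases "m < n")
    case True
    then have "q ^ n = q ^ m * q ^ (n - m)" by (simp flip: power_add)
    with eq q0 have "q ^ (n - m) = 1" by simp
    with True q[of "n - m"] show False by linarith
  next
    case False
    then have "q ^ m = q ^ n * q ^ (m - n)" by (simp flip: power_add)
    with eq q0 have "q ^ (m - n) = 1" by simp
    with False that q[of "m - n"] show False by linarith
  qed
qed

lemma one_minus_z_nonzero: "1 - z * q ^ m \<noteq> 0" if "m \<le> 7 * n" for m
  using q[of "n + m"] that n by (simp only: z flip: power_add) auto

text \<open>The base is \<open>q^2\<close>, with \<open>A = q\<close> and \<open>b = - q\<close>, so
  that \<open>A * p / b = - q^2\<close> supplies the factors \<open>1 + q ^ (2 * i + 2)\<close>.
  Since \<open>n = 2 * N + 1\<close>, the power \<open>(q^2) ^ (N - i)\<close> equals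
  \<open>z / q ^ (2 * i + 1)\<close>, and \<open>N\<close> enters the summands only through
  \<open>z\<close>.\<close>

lemma watson_specialised:
  assumes dex: "d * e * x = q ^ 3"
    and ex: "qpoch (e * x) (q\<^sup>2) N \<noteq> 0" and dx: "qpoch (d * x) (q\<^sup>2) N \<noteq> 0" and xN: "qpoch x (q\<^sup>2) N \<noteq> 0"
  shows "(\<Sum>k\<le>N. (1 - q ^ (4 * k + 1)) / (1 - q) * (\<Prod>i<k.
       (1 - q ^ (2 * i + 1)) * (1 + q ^ (2 * i + 1)) * (1 - d * q ^ (2 * i)) * (1 - e * q ^ (2 * i)) * (1 - z / q ^ (2 * i + 1)) * x
       / (- q * (1 - q ^ (2 * i + 2)) * (1 + q ^ (2 * i + 2)) * (1 - e * x * q ^ (2 * i)) * (1 - d * x * q ^ (2 * i))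
          * (1 - z * q ^ (2 * i + 2)))))
    = (1 - z) / (1 - q) * qpoch q (q\<^sup>2) N * qpoch x (q\<^sup>2) N / (qpoch (e * x) (q\<^sup>2) N * qpoch (d * x) (q\<^sup>2) N)
      * (\<Sum>k\<le>N. \<Prod>i<k. (1 - d * q ^ (2 * i)) * (1 - e * q ^ (2 * i)) * (1 - z / q ^ (2 * i + 1)) * x
          / (- q * (1 - x * (z / q ^ (2 * i + 3))) * (1 - q ^ (2 * i + 2)) * (1 + q ^ (2 * i + 2))))"
proof -
  have q1: "q \<noteq> 1" using q[of 1] n by auto
  have qpow4: "(q\<^sup>2) ^ i = q ^ (2 * i)" for i
    by (simp add: power_mult)
  have qpow: "q * q ^ (2 * i) = q ^ (2 * i + 1)" "q\<^sup>2 * q ^ (2 * i) = q ^ (2 * i + 2)"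
     "q * q\<^sup>2 * q ^ (2 * i) = q ^ (2 * i + 3)" "(q\<^sup>2) ^ i = q ^ (2 * i)" for i
    unfolding qpow4 by (simp_all add: power_add power3_eq_cube power2_eq_square)
  have "q ^ (2 * i + 2) \<noteq> 1" if "i < N" for i
    by (rule q) (use that n in auto)
  then have nz1: "qpoch (q\<^sup>2) (q\<^sup>2) N \<noteq> 0"
    by (auto simp only: qpoch_eq_0_iff qpow)
  have "q ^ (2 * i + 3) \<noteq> 1" if "i < 2 * N" for i
    by (rule q) (use that n in auto)
  then have nz2: "qpoch (q * q\<^sup>2) (q\<^sup>2) (2 * N) \<noteq> 0"
    by (auto simp only: qpoch_eq_0_iff qpow)
  have mq: "q * q\<^sup>2 / - q = - q\<^sup>2" using q0 by (simp add: power2_eq_square)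
  have nz3: "qpoch (- q\<^sup>2) (q\<^sup>2) N \<noteq> 0"
  proof -
    have "1 + q\<^sup>2 * (q\<^sup>2) ^ i \<noteq> 0" if "i < N" for i
      unfolding qpow using one_plus_nonzero[of "2 * i + 2"] n that by simp
    then show ?thesis by (auto simp: qpoch_eq_0_iff minus_equation_iff[of _ 1] add_eq_0_iff2)
  qed
  have nz3': "qpoch (q * q\<^sup>2 / - q) (q\<^sup>2) N \<noteq> 0" unfolding mq by (rule nz3)
  have dex': "q * q\<^sup>2 = d * e * x" unfolding dex by (simp add: power2_eq_square power3_eq_cube)
  have mq0: "- q \<noteq> 0" using q0 by simp
  \<comment> \<open>Both sides come from (q; q^2)_(N+1), by removing its first or its last
    factor.\<close>
  have qq: "qpoch (q * q\<^sup>2) (q\<^sup>2) N = (1 - z) / (1 - q) * qpoch q (q\<^sup>2) N"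
  proof -
    have "q * (q\<^sup>2) ^ N = z" by (simp add: z n power_mult)
    then show ?thesis
      using q1 qpoch_Suc_left[of q "q\<^sup>2" N] qpoch_Suc[of q "q\<^sup>2" N] by (simp add: divide_simps mult_ac)
  qed
  have sub: "(q\<^sup>2) ^ (N - i) = z / q ^ (2 * i + 1)" if "i \<le> N" for i
  proof -
    have "q ^ (2 * (N - i)) * q ^ (2 * i + 1) = z"
      unfolding power_add[symmetric] z by (rule arg_cong[where f = "power q"]) (use that n in simp)
    then have "(q\<^sup>2) ^ (N - i) * q ^ (2 * i + 1) = z" by (simp only: power_mult)
    then show ?thesis using q0 by (simp add: eq_divide_eq)
  qed
  have sub2: "(q\<^sup>2) ^ (N - Suc i) = z / q ^ (2 * i + 3)" if "i < N" for i
    using sub[of "Suc i"] that by (simp add: eval_nat_numeral)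
  have zz: "q * (q\<^sup>2) ^ Suc (N + i) = z * q ^ (2 * i + 2)" for i
    unfolding z n qpow4 power_Suc[symmetric] power_add[symmetric] by (rule arg_cong[where f = "power q"]) simp
  have main: "(\<Sum>k\<le>N. (1 - q * (q\<^sup>2) ^ (2 * k)) / (1 - q) * (\<Prod>i<k.
       (1 - q * (q\<^sup>2) ^ i) * (1 - (- q) * (q\<^sup>2) ^ i) * (1 - d * (q\<^sup>2) ^ i) * (1 - e * (q\<^sup>2) ^ i) * (1 - (q\<^sup>2) ^ (N - i)) * x
       / (- q * (1 - q\<^sup>2 * (q\<^sup>2) ^ i) * (1 - q * q\<^sup>2 / (- q) * (q\<^sup>2) ^ i) * (1 - e * x * (q\<^sup>2) ^ i) * (1 - d * x * (q\<^sup>2) ^ i)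
          * (1 - q * (q\<^sup>2) ^ Suc (N + i)))))
    = qpoch (q * q\<^sup>2) (q\<^sup>2) N * qpoch x (q\<^sup>2) N / (qpoch (e * x) (q\<^sup>2) N * qpoch (d * x) (q\<^sup>2) N)
      * (\<Sum>k\<le>N. \<Prod>i<k. (1 - d * (q\<^sup>2) ^ i) * (1 - e * (q\<^sup>2) ^ i) * (1 - (q\<^sup>2) ^ (N - i)) * x
          / (- q * (1 - x * (q\<^sup>2) ^ (N - Suc i)) * (1 - q\<^sup>2 * (q\<^sup>2) ^ i) * (1 - q * q\<^sup>2 / (- q) * (q\<^sup>2) ^ i)))"
    by (rule watson_limit_prod[OF dex' mq0 q1 nz1 nz2 nz3' ex dx xN])
  have lhs: "(\<Sum>k\<le>N. (1 - q * (q\<^sup>2) ^ (2 * k)) / (1 - q) * (\<Prod>i<k.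
       (1 - q * (q\<^sup>2) ^ i) * (1 - (- q) * (q\<^sup>2) ^ i) * (1 - d * (q\<^sup>2) ^ i) * (1 - e * (q\<^sup>2) ^ i) * (1 - (q\<^sup>2) ^ (N - i)) * x
       / (- q * (1 - q\<^sup>2 * (q\<^sup>2) ^ i) * (1 - q * q\<^sup>2 / (- q) * (q\<^sup>2) ^ i) * (1 - e * x * (q\<^sup>2) ^ i) * (1 - d * x * (q\<^sup>2) ^ i)
          * (1 - q * (q\<^sup>2) ^ Suc (N + i)))))
    = (\<Sum>k\<le>N. (1 - q ^ (4 * k + 1)) / (1 - q) * (\<Prod>i<k.
       (1 - q ^ (2 * i + 1)) * (1 + q ^ (2 * i + 1)) * (1 - d * q ^ (2 * i)) * (1 - e * q ^ (2 * i)) * (1 - z / q ^ (2 * i + 1)) * x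
       / (- q * (1 - q ^ (2 * i + 2)) * (1 + q ^ (2 * i + 2)) * (1 - e * x * q ^ (2 * i)) * (1 - d * x * q ^ (2 * i))
          * (1 - z * q ^ (2 * i + 2)))))"
    by (intro sum.cong prod.cong arg_cong2[where f = "(*)"] refl)
      (simp_all add: sub zz mq del: power_Suc, simp_all only: qpow qpow4, simp_all)
  have rhs: "(\<Sum>k\<le>N. \<Prod>i<k. (1 - d * (q\<^sup>2) ^ i) * (1 - e * (q\<^sup>2) ^ i) * (1 - (q\<^sup>2) ^ (N - i)) * x
          / (- q * (1 - x * (q\<^sup>2) ^ (N - Suc i)) * (1 - q\<^sup>2 * (q\<^sup>2) ^ i) * (1 - q * q\<^sup>2 / (- q) * (q\<^sup>2) ^ i)))
    = (\<Sum>k\<le>N. \<Prod>i<k. (1 - d * q ^ (2 * i)) * (1 - e * q ^ (2 * i)) * (1 - z / q ^ (2 * i + 1)) * x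
          / (- q * (1 - x * (z / q ^ (2 * i + 3))) * (1 - q ^ (2 * i + 2)) * (1 + q ^ (2 * i + 2))))"
    by (intro sum.cong prod.cong refl)
      (simp_all add: sub sub2 mq del: power_Suc, simp_all only: qpow qpow4, simp_all add: numeral_3_eq_3)
  from main show ?thesis unfolding lhs rhs qq .
qed

lemma step_nonzero:
  assumes "i < N"
  shows "1 - q ^ (2 * i + 1) \<noteq> 0" "1 - q ^ (2 * i + 2) \<noteq> 0" "1 + q ^ (2 * i + 2) \<noteq> 0"
    "z - q ^ (2 * i + 1) \<noteq> 0" "z - q ^ (2 * i + 2) \<noteq> 0"
    "1 - z * q ^ (2 * i + 2) \<noteq> 0" "q ^ (2 * i + 1) \<noteq> 0"
proof -
  show "1 - q ^ (2 * i + 1) \<noteq> 0" "1 - q ^ (2 * i + 2) \<noteq> 0"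
    using q[of "2 * i + 1"] q[of "2 * i + 2"] assms n by (simp_all del: power_Suc)
  show "1 + q ^ (2 * i + 2) \<noteq> 0" by (rule one_plus_nonzero) (use assms n in auto)
  show "z - q ^ (2 * i + 1) \<noteq> 0" by (rule z_minus_nonzero) (use assms n in auto)
  show "z - q ^ (2 * i + 2) \<noteq> 0" by (rule z_minus_nonzero) (use assms n in presburger)+
  show "1 - z * q ^ (2 * i + 2) \<noteq> 0" by (rule one_minus_z_nonzero) (use assms n in auto)
  show "q ^ (2 * i + 1) \<noteq> 0" using q0 by simp
qed

lemma fstep_eq:
  assumes "i < N"
  shows "1 - (1 - z)\<^sup>2 / z * phi q (2 * i + 1) = (z - q ^ (2 * i + 1)) * (1 - z * q ^ (2 * i + 1)) / (z * (1 - q ^ (2 * i + 1))\<^sup>2)"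
    "1 - (1 - z)\<^sup>2 / z * phi q (2 * i + 2) = (z - q ^ (2 * i + 2)) * (1 - z * q ^ (2 * i + 2)) / (z * (1 - q ^ (2 * i + 2))\<^sup>2)"
    "fstep q ((1 - z)\<^sup>2 / z) i = ((z - q ^ (2 * i + 1)) * (1 - z * q ^ (2 * i + 1)) * (1 - q ^ (2 * i + 2))\<^sup>2)
       / ((z - q ^ (2 * i + 2)) * (1 - z * q ^ (2 * i + 2)) * (1 - q ^ (2 * i + 1))\<^sup>2)"
proof -
  show 1: "1 - (1 - z)\<^sup>2 / z * phi q (2 * i + 1) = (z - q ^ (2 * i + 1)) * (1 - z * q ^ (2 * i + 1)) / (z * (1 - q ^ (2 * i + 1))\<^sup>2)"
    by (rule one_minus_phi[OF z_nonzero]) (use step_nonzero[OF assms] in simp)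
  show 2: "1 - (1 - z)\<^sup>2 / z * phi q (2 * i + 2) = (z - q ^ (2 * i + 2)) * (1 - z * q ^ (2 * i + 2)) / (z * (1 - q ^ (2 * i + 2))\<^sup>2)"
    by (rule one_minus_phi[OF z_nonzero]) (use step_nonzero[OF assms] in simp)
  show "fstep q ((1 - z)\<^sup>2 / z) i = ((z - q ^ (2 * i + 1)) * (1 - z * q ^ (2 * i + 1)) * (1 - q ^ (2 * i + 2))\<^sup>2)
       / ((z - q ^ (2 * i + 2)) * (1 - z * q ^ (2 * i + 2)) * (1 - q ^ (2 * i + 1))\<^sup>2)"
    unfolding fstep_def 1 2 using z_nonzero step_nonzero[OF assms] by simp (simp add: mult_ac)
qed

lemma qpoch_q: "qpoch q (q\<^sup>2) N = (\<Prod>i<N. 1 - q ^ (2 * i + 1))"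
  by (simp add: qpoch_def power_mult)

lemma qpoch_qq: "qpoch (q\<^sup>2) (q\<^sup>2) N = (\<Prod>i<N. 1 - q ^ (2 * i + 2))"
  by (simp add: qpoch_def power2_eq_square power_mult power_mult_distrib mult_ac)

text \<open>Reversing the order of the factors turns the \<open>i\<close>-th argument into a
  negative power of \<open>q\<close>, because \<open>z\<close> has exponent
  \<open>2 * N + 1\<close>; odd and even exponents change places.\<close>

lemma qpoch_z:
  "qpoch (q / z) (q\<^sup>2) N = (\<Prod>i<N. - (1 - q ^ (2 * i + 2)) / q ^ (2 * i + 2))"
  "qpoch (q\<^sup>2 / z) (q\<^sup>2) N = (\<Prod>i<N. - (1 - q ^ (2 * i + 1)) / q ^ (2 * i + 1))"
proof -
  have aux: "a / z * w = 1 / u" if "a * w * u = z" "u \<noteq> 0" for a w u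
    using that z_nonzero by (simp add: divide_simps)
  have *: "q / z * (q\<^sup>2) ^ (N - Suc i) = 1 / q ^ (2 * i + 2)"
    "q\<^sup>2 / z * (q\<^sup>2) ^ (N - Suc i) = 1 / q ^ (2 * i + 1)" if "i < N" for i
  proof -
    have "q * (q\<^sup>2) ^ (N - Suc i) * q ^ (2 * i + 2) = q ^ (1 + 2 * (N - Suc i) + (2 * i + 2))"
      by (simp only: power_add power_mult power_one_right mult_ac)
    also have "1 + 2 * (N - Suc i) + (2 * i + 2) = n" using that n by simp
    finally show "q / z * (q\<^sup>2) ^ (N - Suc i) = 1 / q ^ (2 * i + 2)"
      using q0 by (intro aux) (simp_all add: z)
    have "q\<^sup>2 * (q\<^sup>2) ^ (N - Suc i) * q ^ (2 * i + 1) = q ^ (2 + 2 * (N - Suc i) + (2 * i + 1))"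
      by (simp only: power_add power_mult power_one_right mult_ac)
    also have "2 + 2 * (N - Suc i) + (2 * i + 1) = n" using that n by simp
    finally show "q\<^sup>2 / z * (q\<^sup>2) ^ (N - Suc i) = 1 / q ^ (2 * i + 1)"
      using q0 by (intro aux) (simp_all add: z)
  qed
  show "qpoch (q / z) (q\<^sup>2) N = (\<Prod>i<N. - (1 - q ^ (2 * i + 2)) / q ^ (2 * i + 2))"
    unfolding qpoch_def using q0
    by (subst prod.nat_diff_reindex[symmetric]) (rule prod.cong, simp, simp only: lessThan_iff *, simp add: diff_divide_distrib)
  show "qpoch (q\<^sup>2 / z) (q\<^sup>2) N = (\<Prod>i<N. - (1 - q ^ (2 * i + 1)) / q ^ (2 * i + 1))"
    unfolding qpoch_def using q0
    by (subst prod.nat_diff_reindex[symmetric]) (rule prod.cong, simp, simp only: lessThan_iff *, simp add: diff_divide_distrib)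
qed

lemma qpoch_zq: "qpoch (z * q\<^sup>2) (q\<^sup>2) N = (\<Prod>i<N. 1 - z * q ^ (2 * i + 2))"
  by (simp add: qpoch_def power2_eq_square power_mult power_mult_distrib mult_ac)

lemma qpoch_nonzeros:
  "qpoch q (q\<^sup>2) N \<noteq> 0" "qpoch (q\<^sup>2) (q\<^sup>2) N \<noteq> 0" "qpoch (q / z) (q\<^sup>2) N \<noteq> 0"
  "qpoch (q\<^sup>2 / z) (q\<^sup>2) N \<noteq> 0" "qpoch (z * q\<^sup>2) (q\<^sup>2) N \<noteq> 0"
  unfolding qpoch_z qpoch_qq qpoch_q qpoch_zq prod_zero_iff[OF finite_lessThan]
  using step_nonzero q0 by auto

text \<open>The choice \<open>d = z * q\<close>, \<open>e = q\<close>, \<open>x = q / z\<close> is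
  the deformation in \<open>a\<close> alone, at \<open>a = q ^ n\<close>.\<close>

lemma watson_f:
  "(\<Sum>k\<le>N. (1 - q ^ (4 * k + 1)) / (1 - q) * (\<Prod>i<k. cstep q i * fstep q ((1 - z)\<^sup>2 / z) i))
   = (1 - z) / (1 - q) / q ^ N * (\<Sum>k\<le>N. \<Prod>i<k. hstep q i * (1 - (1 - z)\<^sup>2 / z * phi q (2 * i + 1)))"
proof -
  have ex: "q * (q / z) = q\<^sup>2 / z" and dx: "z * q * (q / z) = q\<^sup>2"
    using z_nonzero by (simp_all add: power2_eq_square)
  have "z * q * q * (q / z) = q ^ 3"
    using z_nonzero by (simp add: power3_eq_cube)
  note W = watson_specialised[OF this, unfolded ex dx, OF qpoch_nonzeros(4,2,3)]
  \<comment> \<open>After the reversal in \<open>qpoch_z\<close> the prefactor can be compared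
    factor by factor, and each of the \<open>N\<close> quotients is \<open>1 / q\<close>.\<close>
  have C: "(1 - z) / (1 - q) * qpoch q (q\<^sup>2) N * qpoch (q / z) (q\<^sup>2) N / (qpoch (q\<^sup>2 / z) (q\<^sup>2) N * qpoch (q\<^sup>2) (q\<^sup>2) N)
     = (1 - z) / (1 - q) / q ^ N"
  proof -
    have "qpoch q (q\<^sup>2) N * qpoch (q / z) (q\<^sup>2) N / (qpoch (q\<^sup>2 / z) (q\<^sup>2) N * qpoch (q\<^sup>2) (q\<^sup>2) N) = (\<Prod>i<N. 1 / q)"
      unfolding qpoch_z qpoch_q qpoch_qq prod.distrib[symmetric] prod_dividef[symmetric]
    proof (intro prod.cong refl)
      fix i assume "i \<in> {..<N}"
      then show "(1 - q ^ (2 * i + 1)) * (- (1 - q ^ (2 * i + 2)) / q ^ (2 * i + 2))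
        / (- (1 - q ^ (2 * i + 1)) / q ^ (2 * i + 1) * (1 - q ^ (2 * i + 2))) = 1 / q"
        using step_nonzero[of i] q0 by (simp add: divide_simps) (simp add: algebra_simps)
    qed
    from arg_cong[OF this, of "\<lambda>c. (1 - z) / (1 - q) * c"] show ?thesis
      by (simp add: power_one_over mult.assoc)
  qed
  have L: "(1 - q ^ (2 * i + 1)) * (1 + q ^ (2 * i + 1)) * (1 - z * q * q ^ (2 * i)) * (1 - q * q ^ (2 * i)) * (1 - z / q ^ (2 * i + 1)) * (q / z)
       / (- q * (1 - q ^ (2 * i + 2)) * (1 + q ^ (2 * i + 2)) * (1 - q\<^sup>2 / z * q ^ (2 * i)) * (1 - q\<^sup>2 * q ^ (2 * i))
          * (1 - z * q ^ (2 * i + 2))) = cstep q i * fstep q ((1 - z)\<^sup>2 / z) i" (is ?L)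
    and R: "(1 - z * q * q ^ (2 * i)) * (1 - q * q ^ (2 * i)) * (1 - z / q ^ (2 * i + 1)) * (q / z)
          / (- q * (1 - q / z * (z / q ^ (2 * i + 3))) * (1 - q ^ (2 * i + 2)) * (1 + q ^ (2 * i + 2)))
        = hstep q i * (1 - (1 - z)\<^sup>2 / z * phi q (2 * i + 1))" (is ?R) if "i < N" for i
  proof -
    define u v where "u = q ^ (2 * i + 1)" and "v = q ^ (2 * i + 2)"
    have vq: "v = q * u" by (simp add: u_def v_def)
    \<comment> \<open>With all these differences named, both claims reduce to identities between
      monomials.\<close>
    define a b c d e f where "a = 1 - u" and "b = 1 - v" and "c = 1 + v" and "d = z - u" and "e = z - v" and "f = 1 - z * v"
    define g h where "g = 1 + u" and "h = 1 - z * u"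
    have nz: "a \<noteq> 0" "b \<noteq> 0" "c \<noteq> 0" "d \<noteq> 0" "e \<noteq> 0" "f \<noteq> 0" "u \<noteq> 0"
      using step_nonzero[OF that] unfolding a_def b_def c_def d_def e_def f_def u_def v_def by simp_all
    have eqs: "z * q * q ^ (2 * i) = z * u" "q * q ^ (2 * i) = u" "q\<^sup>2 / z * q ^ (2 * i) = v / z" "q\<^sup>2 * q ^ (2 * i) = v"
       "q / z * (z / q ^ (2 * i + 3)) = 1 / v"
      using q0 z_nonzero by (simp_all add: u_def v_def power2_eq_square divide_simps mult_ac eval_nat_numeral)
    have eqs2: "1 - z / u = - d / u" "1 - v / z = e / z" "1 - 1 / v = - b / v"
      using nz z_nonzero q0 by (simp_all add: d_def e_def b_def divide_simps vq)
    show ?L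
      unfolding fstep_eq[OF that] cstep_def u_def[symmetric] v_def[symmetric] eqs eqs2
      unfolding a_def[symmetric] b_def[symmetric] c_def[symmetric] d_def[symmetric] e_def[symmetric] f_def[symmetric] g_def[symmetric] h_def[symmetric]
      using nz z_nonzero q0 by (simp add: divide_simps eval_nat_numeral)
    show ?R
      unfolding fstep_eq[OF that] hstep_def u_def[symmetric] v_def[symmetric] eqs eqs2
      unfolding a_def[symmetric] b_def[symmetric] c_def[symmetric] d_def[symmetric] e_def[symmetric] f_def[symmetric] g_def[symmetric] h_def[symmetric]
      using nz z_nonzero q0 by (simp add: divide_simps eval_nat_numeral vq)
  qed
  have "(\<Sum>k\<le>N. (1 - q ^ (4 * k + 1)) / (1 - q) * (\<Prod>i<k. cstep q i * fstep q ((1 - z)\<^sup>2 / z) i))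
    = (\<Sum>k\<le>N. (1 - q ^ (4 * k + 1)) / (1 - q) * (\<Prod>i<k.
       (1 - q ^ (2 * i + 1)) * (1 + q ^ (2 * i + 1)) * (1 - z * q * q ^ (2 * i)) * (1 - q * q ^ (2 * i)) * (1 - z / q ^ (2 * i + 1)) * (q / z)
       / (- q * (1 - q ^ (2 * i + 2)) * (1 + q ^ (2 * i + 2)) * (1 - q\<^sup>2 / z * q ^ (2 * i)) * (1 - q\<^sup>2 * q ^ (2 * i))
          * (1 - z * q ^ (2 * i + 2)))))"
    by (intro sum.cong prod.cong arg_cong2[where f = "(*)"] refl L[symmetric]) simp
  also have "\<dots> = (1 - z) / (1 - q) / q ^ N * (\<Sum>k\<le>N. \<Prod>i<k. hstep q i * (1 - (1 - z)\<^sup>2 / z * phi q (2 * i + 1)))"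
    unfolding W C by (intro sum.cong prod.cong arg_cong2[where f = "(*)"] refl R) simp
  finally show ?thesis .
qed

lemma qpoch_q3: "(1 - z) / (1 - q) * qpoch q (q\<^sup>2) N * qpoch q (q\<^sup>2) N / (qpoch (q\<^sup>2) (q\<^sup>2) N * qpoch (q\<^sup>2) (q\<^sup>2) N)
   = (1 - z) / (1 - q) * (\<Prod>i<N. rstep q i)\<^sup>2"
proof -
  have "(1 - z) / (1 - q) * a * a / (b * b) = (1 - z) / (1 - q) * (a / b)\<^sup>2" for a b
    by (simp add: power2_eq_square)
  then show ?thesis
    unfolding qpoch_q qpoch_qq rstep_def prod_dividef by blast
qed

text \<open>The choice \<open>d = e = x = q\<close> is the deformation in \<open>b\<close> alone, at
  \<open>b = q ^ n\<close>: one quotient (q; q^2)_k / (q^2; q^2)_k is replaced by b^k (q/b; q^2)_k /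
  (b q^2; q^2)_k.\<close>

lemma watson_g:
  "(\<Sum>k\<le>N. (1 - q ^ (4 * k + 1)) / (1 - q) * (\<Prod>i<k. cstep q i * gstep q z i))
   = (1 - z) / (1 - q) * (\<Prod>i<N. rstep q i)\<^sup>2 * (\<Sum>k\<le>N. \<Prod>i<k. hstep q i * gostep q z i)"
proof -
  have ex: "q * q = q\<^sup>2"
    by (simp_all add: power2_eq_square)
  have "q * q * q = q ^ 3"
    by (simp add: power3_eq_cube)
  note W = watson_specialised[OF this, unfolded ex, OF qpoch_nonzeros(2,2,1)]
  have L: "(1 - q ^ (2 * i + 1)) * (1 + q ^ (2 * i + 1)) * (1 - q * q ^ (2 * i)) * (1 - q * q ^ (2 * i)) * (1 - z / q ^ (2 * i + 1)) * q
       / (- q * (1 - q ^ (2 * i + 2)) * (1 + q ^ (2 * i + 2)) * (1 - q\<^sup>2 * q ^ (2 * i)) * (1 - q\<^sup>2 * q ^ (2 * i))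
          * (1 - z * q ^ (2 * i + 2))) = cstep q i * gstep q z i" (is ?L)
    and R: "(1 - q * q ^ (2 * i)) * (1 - q * q ^ (2 * i)) * (1 - z / q ^ (2 * i + 1)) * q
          / (- q * (1 - q * (z / q ^ (2 * i + 3))) * (1 - q ^ (2 * i + 2)) * (1 + q ^ (2 * i + 2)))
        = hstep q i * gostep q z i" (is ?R) if "i < N" for i
  proof -
    define u v where "u = q ^ (2 * i + 1)" and "v = q ^ (2 * i + 2)"
    have vq: "v = q * u" by (simp add: u_def v_def)
    define a b c d e f where "a = 1 - u" and "b = 1 - v" and "c = 1 + v" and "d = z - u" and "e = z - v" and "f = 1 - z * v"
    define g where "g = 1 + u"
    have nz: "a \<noteq> 0" "b \<noteq> 0" "c \<noteq> 0" "d \<noteq> 0" "e \<noteq> 0" "f \<noteq> 0" "u \<noteq> 0"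
      using step_nonzero[OF that] unfolding a_def b_def c_def d_def e_def f_def u_def v_def by simp_all
    have eqs: "q * q ^ (2 * i) = u" "q\<^sup>2 * q ^ (2 * i) = v" "q * (z / q ^ (2 * i + 3)) = z / v"
       using q0 z_nonzero by (simp_all add: u_def v_def power2_eq_square divide_simps mult_ac eval_nat_numeral)
    have eqs2: "1 - z / u = - d / u" "1 - z / v = - e / v" "u - z = - d" "v - z = - e"
      using nz z_nonzero q0 by (simp_all add: d_def e_def b_def divide_simps vq)
    show ?L
      unfolding gstep_def cstep_def u_def[symmetric] v_def[symmetric] eqs eqs2
      unfolding a_def[symmetric] b_def[symmetric] c_def[symmetric] d_def[symmetric] e_def[symmetric] f_def[symmetric] g_def[symmetric]
      using nz z_nonzero q0 by (simp add: divide_simps eval_nat_numeral)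
    show ?R
      unfolding gostep_def hstep_def u_def[symmetric] v_def[symmetric] eqs eqs2
      unfolding a_def[symmetric] b_def[symmetric] c_def[symmetric] d_def[symmetric] e_def[symmetric] f_def[symmetric] g_def[symmetric]
      using nz z_nonzero q0 by (simp add: divide_simps eval_nat_numeral vq)
  qed
  have "(\<Sum>k\<le>N. (1 - q ^ (4 * k + 1)) / (1 - q) * (\<Prod>i<k. cstep q i * gstep q z i))
    = (\<Sum>k\<le>N. (1 - q ^ (4 * k + 1)) / (1 - q) * (\<Prod>i<k.
       (1 - q ^ (2 * i + 1)) * (1 + q ^ (2 * i + 1)) * (1 - q * q ^ (2 * i)) * (1 - q * q ^ (2 * i)) * (1 - z / q ^ (2 * i + 1)) * q
       / (- q * (1 - q ^ (2 * i + 2)) * (1 + q ^ (2 * i + 2)) * (1 - q\<^sup>2 * q ^ (2 * i)) * (1 - q\<^sup>2 * q ^ (2 * i))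
          * (1 - z * q ^ (2 * i + 2)))))"
    by (intro sum.cong prod.cong arg_cong2[where f = "(*)"] refl L[symmetric]) simp
  also have "\<dots> = (1 - z) / (1 - q) * (\<Prod>i<N. rstep q i)\<^sup>2 * (\<Sum>k\<le>N. \<Prod>i<k. hstep q i * gostep q z i)"
    unfolding W qpoch_q3 by (intro sum.cong prod.cong arg_cong2[where f = "(*)"] refl R) simp
  finally show ?thesis .
qed

text \<open>The choice \<open>d = z * q\<close>, \<open>e = q / z\<close>, \<open>x = q\<close>
  makes both deformations at once, with \<open>a = b = q ^ n\<close>. Compared with
  \<open>watson_g\<close>, the prefactor acquires the even factors
  \<open>1 - y * phi q (2 * i + 2)\<close> in the denominator and the summands the odd ones.\<close>

lemma watson_fg:
  "(\<Sum>k\<le>N. (1 - q ^ (4 * k + 1)) / (1 - q) * (\<Prod>i<k. cstep q i * fstep q ((1 - z)\<^sup>2 / z) i * gstep q z i))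
   = (1 - z) / (1 - q) * (\<Prod>i<N. rstep q i)\<^sup>2 / (\<Prod>i<N. 1 - (1 - z)\<^sup>2 / z * phi q (2 * i + 2))
     * (\<Sum>k\<le>N. \<Prod>i<k. hstep q i * (1 - (1 - z)\<^sup>2 / z * phi q (2 * i + 1)) * gostep q z i)"
proof -
  have ex: "q / z * q = q\<^sup>2 / z" and dx: "z * q * q = z * q\<^sup>2"
    by (simp_all add: power2_eq_square)
  have "z * q * (q / z) * q = q ^ 3"
    using z_nonzero by (simp add: power3_eq_cube)
  note W = watson_specialised[OF this, unfolded ex dx, OF qpoch_nonzeros(4,5,1)]
  have C: "(1 - z) / (1 - q) * qpoch q (q\<^sup>2) N * qpoch q (q\<^sup>2) N / (qpoch (q\<^sup>2 / z) (q\<^sup>2) N * qpoch (z * q\<^sup>2) (q\<^sup>2) N)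
     = (1 - z) / (1 - q) * (\<Prod>i<N. rstep q i)\<^sup>2 / (\<Prod>i<N. 1 - (1 - z)\<^sup>2 / z * phi q (2 * i + 2))"
  proof -
    have z2: "qpoch (q\<^sup>2 / z) (q\<^sup>2) N = (\<Prod>i<N. (z - q ^ (2 * i + 2)) / z)"
      using z_nonzero by (simp add: qpoch_def diff_divide_distrib power2_eq_square power_mult power_mult_distrib mult_ac)
    have "qpoch q (q\<^sup>2) N * qpoch q (q\<^sup>2) N / (qpoch (q\<^sup>2 / z) (q\<^sup>2) N * qpoch (z * q\<^sup>2) (q\<^sup>2) N)
     = (\<Prod>i<N. rstep q i * rstep q i / (1 - (1 - z)\<^sup>2 / z * phi q (2 * i + 2)))"
      unfolding z2 qpoch_q qpoch_qq qpoch_zq prod.distrib[symmetric] prod_dividef[symmetric]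
    proof (intro prod.cong refl)
      fix i assume "i \<in> {..<N}"
      then have i: "i < N" by simp
      show "(1 - q ^ (2 * i + 1)) * (1 - q ^ (2 * i + 1)) / ((z - q ^ (2 * i + 2)) / z * (1 - z * q ^ (2 * i + 2)))
         = rstep q i * rstep q i / (1 - (1 - z)\<^sup>2 / z * phi q (2 * i + 2))"
        unfolding fstep_eq[OF i] rstep_def using step_nonzero[OF i] z_nonzero
        by (simp add: power2_eq_square)
    qed
    from arg_cong[OF this, of "\<lambda>c. (1 - z) / (1 - q) * c"] show ?thesis
      unfolding prod.distrib prod_dividef power2_eq_square[of "prod f A" for f A]
      by (simp add: mult.assoc)
  qed
  have L: "(1 - q ^ (2 * i + 1)) * (1 + q ^ (2 * i + 1)) * (1 - z * q * q ^ (2 * i)) * (1 - q / z * q ^ (2 * i)) * (1 - z / q ^ (2 * i + 1)) * q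
       / (- q * (1 - q ^ (2 * i + 2)) * (1 + q ^ (2 * i + 2)) * (1 - q\<^sup>2 / z * q ^ (2 * i)) * (1 - z * q\<^sup>2 * q ^ (2 * i))
          * (1 - z * q ^ (2 * i + 2))) = cstep q i * fstep q ((1 - z)\<^sup>2 / z) i * gstep q z i" (is ?L)
    and R: "(1 - z * q * q ^ (2 * i)) * (1 - q / z * q ^ (2 * i)) * (1 - z / q ^ (2 * i + 1)) * q
          / (- q * (1 - q * (z / q ^ (2 * i + 3))) * (1 - q ^ (2 * i + 2)) * (1 + q ^ (2 * i + 2)))
        = hstep q i * (1 - (1 - z)\<^sup>2 / z * phi q (2 * i + 1)) * gostep q z i" (is ?R) if "i < N" for i
  proof -
    define u v where "u = q ^ (2 * i + 1)" and "v = q ^ (2 * i + 2)"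
    have vq: "v = q * u" by (simp add: u_def v_def)
    define a b c d e f where "a = 1 - u" and "b = 1 - v" and "c = 1 + v" and "d = z - u" and "e = z - v" and "f = 1 - z * v"
    define g h where "g = 1 + u" and "h = 1 - z * u"
    have nz: "a \<noteq> 0" "b \<noteq> 0" "c \<noteq> 0" "d \<noteq> 0" "e \<noteq> 0" "f \<noteq> 0" "u \<noteq> 0"
      using step_nonzero[OF that] unfolding a_def b_def c_def d_def e_def f_def u_def v_def by simp_all
    have eqs: "z * q * q ^ (2 * i) = z * u" "q / z * q ^ (2 * i) = u / z" "q\<^sup>2 / z * q ^ (2 * i) = v / z" "z * q\<^sup>2 * q ^ (2 * i) = z * v"
       "q * (z / q ^ (2 * i + 3)) = z / v"
      using q0 z_nonzero by (simp_all add: u_def v_def power2_eq_square divide_simps mult_ac eval_nat_numeral)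
    have eqs2: "1 - z / u = - d / u" "1 - u / z = d / z" "1 - v / z = e / z" "1 - z / v = - e / v" "u - z = - d" "v - z = - e"
      using nz z_nonzero q0 by (simp_all add: d_def e_def b_def divide_simps vq)
    show ?L
      unfolding fstep_eq[OF that] cstep_def gstep_def u_def[symmetric] v_def[symmetric] eqs eqs2
      unfolding a_def[symmetric] b_def[symmetric] c_def[symmetric] d_def[symmetric] e_def[symmetric] f_def[symmetric] g_def[symmetric] h_def[symmetric]
      using nz z_nonzero q0 by (simp add: divide_simps eval_nat_numeral)
    show ?R
      unfolding fstep_eq[OF that] hstep_def gostep_def u_def[symmetric] v_def[symmetric] eqs eqs2
      unfolding a_def[symmetric] b_def[symmetric] c_def[symmetric] d_def[symmetric] e_def[symmetric] f_def[symmetric] g_def[symmetric] h_def[symmetric]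
      using nz z_nonzero q0 by (simp add: divide_simps eval_nat_numeral vq)
  qed
  have "(\<Sum>k\<le>N. (1 - q ^ (4 * k + 1)) / (1 - q) * (\<Prod>i<k. cstep q i * fstep q ((1 - z)\<^sup>2 / z) i * gstep q z i))
    = (\<Sum>k\<le>N. (1 - q ^ (4 * k + 1)) / (1 - q) * (\<Prod>i<k.
       (1 - q ^ (2 * i + 1)) * (1 + q ^ (2 * i + 1)) * (1 - z * q * q ^ (2 * i)) * (1 - q / z * q ^ (2 * i)) * (1 - z / q ^ (2 * i + 1)) * q
       / (- q * (1 - q ^ (2 * i + 2)) * (1 + q ^ (2 * i + 2)) * (1 - q\<^sup>2 / z * q ^ (2 * i)) * (1 - z * q\<^sup>2 * q ^ (2 * i))
          * (1 - z * q ^ (2 * i + 2)))))"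
    by (intro sum.cong prod.cong arg_cong2[where f = "(*)"] refl L[symmetric]) simp
  also have "\<dots> = (1 - z) / (1 - q) * (\<Prod>i<N. rstep q i)\<^sup>2 / (\<Prod>i<N. 1 - (1 - z)\<^sup>2 / z * phi q (2 * i + 2))
     * (\<Sum>k\<le>N. \<Prod>i<k. hstep q i * (1 - (1 - z)\<^sup>2 / z * phi q (2 * i + 1)) * gostep q z i)"
    unfolding W C by (intro sum.cong prod.cong arg_cong2[where f = "(*)"] refl R) simp
  finally show ?thesis .
qed

end

section \<open>Divisibility over the complex numbers and evaluation of rational functions\<close>

text \<open>Dividing \<open>p\<close> by its power of the linear factor at \<open>a\<close> does not
  change the order of vanishing at any other point.\<close>

lemma prod_linear_powers_dvd:
  fixes p :: "complex poly"
  assumes "finite A" and "\<And>z. z \<in> A \<Longrightarrow> [:- z, 1:] ^ e z dvd p"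
  shows "(\<Prod>z\<in>A. [:- z, 1:] ^ e z) dvd p"
  using assms
proof (induction A arbitrary: p)
  case (insert a A)
  show ?case
  proof (cases "p = 0")
    case False
    from insert.prems obtain r where r: "p = [:- a, 1:] ^ e a * r" by (auto elim: dvdE)
    have "[:- z, 1:] ^ e z dvd r" if "z \<in> A" for z
    proof -
      have "e z \<le> order z p"
        using insert.prems that False by (auto simp: order_divides)
      also have "order z p = order z ([:- a, 1:] ^ e a) + order z r"
        using False unfolding r by (rule order_mult)
      also have "order z ([:- a, 1:] ^ e a) = 0"
        using insert.hyps that by (intro order_0I) auto
      finally show ?thesis by (simp add: order_divides)
    qed
    then have "(\<Prod>z\<in>A. [:- z, 1:] ^ e z) dvd r" by (rule insert.IH)
    then show ?thesis using insert.hyps r by simp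
  qed simp
qed simp

section \<open>The modulus over the complex numbers\<close>

lemma map_poly_of_rat_1: "map_poly of_rat 1 = (1 :: complex poly)"
  by (rule poly_eqI) (auto simp: coeff_map_poly coeff_1)

lemma map_poly_of_rat_diff:
  "map_poly of_rat (p - q) = (map_poly of_rat p - map_poly of_rat q :: complex poly)"
  by (rule poly_eqI) (simp add: coeff_map_poly of_rat_diff)

lemma map_poly_of_rat_power:
  "map_poly of_rat (p ^ k) = (map_poly of_rat p ^ k :: complex poly)"
  by (induction k) (simp_all add: map_poly_of_rat_1 map_poly_of_rat_mult)

text \<open>Multiplied by \<open>q - 1\<close>, both sides become \<open>q^n - 1\<close>, whose
  roots are simple; the factor belonging to the root 1 is cancelled.\<close>

lemma map_poly_qint_poly:
  assumes "n > 0"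
  shows "map_poly of_rat (qint_poly n) = (\<Prod>z\<in>{z::complex. z ^ n = 1} - {1}. [:- z, 1:])"
proof -
  let ?T = "{z::complex. z ^ n = 1}"
  have fin: "finite ?T"
    using assms by (intro finite_roots_unity) simp
  have "(\<Prod>z\<in>?T. [:- z, 1:]) = (\<Prod>d | d dvd n. \<Prod>z\<in>primroots d. [:- z, 1:])"
    unfolding root_of_unity_primroots[OF assms]
  proof (rule prod.UNION_disjoint)
    show "finite {d. d dvd n}" using assms by simp
    show "\<forall>d\<in>{d. d dvd n}. finite (primroots d)"
      using fin unfolding root_of_unity_primroots[OF assms] by (meson UN_upper finite_subset)
    have "d = e" if "z \<in> primroots d" "z \<in> primroots e" "d dvd n" "e dvd n" for z d e
      using that assms unfolding primroots_def by (auto dest: dvd_pos_nat intro: linorder_cases[of d e])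
    then show "\<forall>d\<in>{d. d dvd n}. \<forall>e\<in>{d. d dvd n}. d \<noteq> e \<longrightarrow> primroots d \<inter> primroots e = {}"
      by blast
  qed
  also have "\<dots> = monom 1 n - 1" by (rule prod_primroots[OF assms])
  finally have 1: "(\<Prod>z\<in>?T. [:- z, 1:]) = monom 1 n - (1 :: complex poly)" .
  have "[:- 1, 1:] * qint_poly n = [:0, 1:] ^ n - (1 :: rat poly)"
    unfolding qint_poly_def using power_diff_1_eq[of "[:0, 1:] :: rat poly" n] by (simp add: one_pCons)
  then have "map_poly of_rat ([:- 1, 1:] * qint_poly n) = map_poly of_rat ([:0, 1:] ^ n - (1 :: rat poly))"
    by (rule arg_cong)
  also have "\<dots> = (monom 1 n - 1 :: complex poly)"
    unfolding map_poly_of_rat_diff map_poly_of_rat_power map_poly_of_rat_1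
    by (simp add: map_poly_pCons monom_altdef)
  also have "\<dots> = (\<Prod>z\<in>insert 1 (?T - {1}). [:- z, 1:])"
    unfolding 1[symmetric] by (intro prod.cong) auto
  also have "\<dots> = [:- 1, 1:] * (\<Prod>z\<in>?T - {1}. [:- z, 1:])"
    using fin by (subst prod.insert) auto
  also have "map_poly of_rat ([:- 1, 1:] * qint_poly n) = ([:- 1, 1:] * map_poly of_rat (qint_poly n) :: complex poly)"
    unfolding map_poly_of_rat_mult by (simp add: map_poly_pCons)
  finally show ?thesis
    by (simp only: mult_cancel_left) auto
qed

text \<open>Over the complex numbers [n] contributes multiplicity 1 at each nontrivial
  \<open>n\<close>-th root of unity, and the cube of the cyclotomic polynomial adds 3 at the
  primitive ones. Divisibility then descends to the rationals by
  \<open>map_poly_of_rat_dvdD\<close>.\<close>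

lemma modulus_dvdI:
  assumes "n > 1"
    and "\<And>z. z ^ n = 1 \<Longrightarrow> z \<noteq> 1 \<Longrightarrow> [:- z, 1:] dvd (map_poly of_rat p :: complex poly)"
    and "\<And>z. z \<in> primroots n \<Longrightarrow> [:- z, 1:] ^ 4 dvd (map_poly of_rat p :: complex poly)"
  shows "qint_poly n * cyclotomic n ^ 3 dvd p"
proof (rule map_poly_of_rat_dvdD)
  let ?U = "{z::complex. z ^ n = 1} - {1}"
  define e where "e z = (if z \<in> primroots n then 4 else 1 :: nat)" for z
  have fin: "finite ?U"
    using assms by (intro finite_Diff finite_roots_unity) simp
  have sub: "primroots n \<subseteq> ?U"
    using assms by (auto simp: primroots_def)
  have "map_poly of_rat (qint_poly n * cyclotomic n ^ 3)
      = (\<Prod>z\<in>?U. [:- z, 1:]) * (\<Prod>z\<in>primroots n. [:- z, 1:] ^ 3)"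
    using assms by (simp add: map_poly_of_rat_mult map_poly_of_rat_power map_poly_qint_poly
        map_poly_cyclotomic prod_power_distrib)
  also have "(\<Prod>z\<in>primroots n. [:- z, 1:] ^ 3) = (\<Prod>z\<in>?U. [:- z, 1:] ^ (e z - 1))"
    by (rule prod.mono_neutral_cong_left[OF fin sub]) (auto simp: e_def)
  also have "(\<Prod>z\<in>?U. [:- z, 1:]) * \<dots> = (\<Prod>z\<in>?U. [:- z, 1:] ^ e z)"
    unfolding prod.distrib[symmetric] by (intro prod.cong) (auto simp: e_def simp flip: power_Suc)
  also have "\<dots> dvd map_poly of_rat p"
    using assms(2,3) by (intro prod_linear_powers_dvd fin) (auto simp: e_def)
  finally show "(map_poly of_rat (qint_poly n * cyclotomic n ^ 3) :: complex poly) dvd map_poly of_rat p" .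
qed

text \<open>The fraction \<open>P / D\<close> need not be in lowest terms, so closure under the field operations is immediate.\<close>

definition evals :: "complex \<Rightarrow> ratfun \<Rightarrow> complex \<Rightarrow> bool" where
  "evals w R v \<longleftrightarrow> (\<exists>P D. R = to_fract P / to_fract D \<and> poly (map_poly of_rat D) w \<noteq> 0
     \<and> v = poly (map_poly of_rat P) w / poly (map_poly of_rat D) w)"

lemma evalsE:
  assumes "evals w R v"
  obtains P D where "R = to_fract P / to_fract D" "D \<noteq> 0" "poly (map_poly of_rat D) w \<noteq> 0"
    "v = poly (map_poly of_rat P) w / poly (map_poly of_rat D) w"
  using assms unfolding evals_def by force

lemma evals_to_fract: "evals w (to_fract P) (poly (map_poly of_rat P) w)"
  unfolding evals_def by (rule exI[of _ P], rule exI[of _ 1]) (simp add: map_poly_of_rat_1)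

lemma evals_add: "evals w R v \<Longrightarrow> evals w S u \<Longrightarrow> evals w (R + S) (v + u)"
  apply (elim evalsE)
  subgoal for P D P' D'
    unfolding evals_def
    by (rule exI[of _ "P * D' + P' * D"], rule exI[of _ "D * D'"])
      (simp add: map_poly_of_rat_add map_poly_of_rat_mult add_frac_eq)
  done

lemma evals_mult: "evals w R v \<Longrightarrow> evals w S u \<Longrightarrow> evals w (R * S) (v * u)"
  apply (elim evalsE)
  subgoal for P D P' D'
    unfolding evals_def
    by (rule exI[of _ "P * P'"], rule exI[of _ "D * D'"])
      (simp add: map_poly_of_rat_mult)
  done

lemma evals_inverse: "evals w R v \<Longrightarrow> v \<noteq> 0 \<Longrightarrow> evals w (inverse R) (inverse v)"
  apply (elim evalsE)
  subgoal for P D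
    unfolding evals_def by (rule exI[of _ D], rule exI[of _ P]) simp
  done

lemma evals_0: "evals w 0 0" and evals_1: "evals w 1 1"
  using evals_to_fract[of w 0] evals_to_fract[of w 1] by (simp_all add: map_poly_of_rat_1)

lemma evals_of_nat: "evals w (of_nat m) (of_nat m)"
  by (induction m) (simp_all add: evals_0 evals_1 evals_add)

lemma evals_numeral: "evals w (numeral c) (numeral c)"
  using evals_of_nat[of w "numeral c"] by simp

lemma evals_qvar: "evals w qvar w"
  using evals_to_fract[of w "[:0, 1:]"] by (simp add: map_poly_pCons qvar_def)

lemma evals_minus: "evals w R v \<Longrightarrow> evals w (- R) (- v)"
  using evals_mult[OF evals_to_fract[of w "- 1"], of R v]
    map_poly_of_rat_diff[of 0 1] by (simp add: map_poly_of_rat_1)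

lemma evals_diff: "evals w R v \<Longrightarrow> evals w S u \<Longrightarrow> evals w (R - S) (v - u)"
  using evals_add[OF _ evals_minus] by fastforce

lemma evals_divide: "evals w R v \<Longrightarrow> evals w S u \<Longrightarrow> u \<noteq> 0 \<Longrightarrow> evals w (R / S) (v / u)"
  unfolding divide_inverse by (intro evals_mult evals_inverse)

lemma evals_power: "evals w R v \<Longrightarrow> evals w (R ^ k) (v ^ k)"
  by (induction k) (simp_all add: evals_1 evals_mult)

lemma evals_powi: "evals w R v \<Longrightarrow> v \<noteq> 0 \<Longrightarrow> evals w (R powi k) (v powi k)"
  by (cases "k \<ge> 0") (simp_all add: power_int_def evals_power evals_inverse)

lemma evals_sum: "(\<And>x. x \<in> A \<Longrightarrow> evals w (f x) (g x)) \<Longrightarrow> evals w (\<Sum>x\<in>A. f x) (\<Sum>x\<in>A. g x)"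
  by (induction A rule: infinite_finite_induct) (simp_all add: evals_0 evals_add)

lemma evals_prod: "(\<And>x. x \<in> A \<Longrightarrow> evals w (f x) (g x)) \<Longrightarrow> evals w (\<Prod>x\<in>A. f x) (\<Prod>x\<in>A. g x)"
  by (induction A rule: infinite_finite_induct) (simp_all add: evals_1 evals_mult)

lemma evals_qpoch: "evals w R v \<Longrightarrow> evals w S u \<Longrightarrow> evals w (qpoch R S k) (qpoch v u k)"
  unfolding qpoch_def by (intro evals_prod evals_diff evals_1 evals_mult evals_power)

text \<open>Cross-multiplying \<open>P / D\<close> with the representation in lowest terms and
  cancelling only \<open>D\<close> gives the value of the numerator; no information about the
  lowest-terms denominator at \<open>w\<close> enters.\<close>

lemma evals_numerator:
  assumes "evals w R v"
  shows "poly (map_poly of_rat (fst (quot_of_fract R))) w = v * poly (map_poly of_rat (snd (quot_of_fract R))) w"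
proof -
  obtain P D where R: "R = to_fract P / to_fract D" "D \<noteq> 0" and D: "poly (map_poly of_rat D) w \<noteq> (0::complex)"
    and v: "v = poly (map_poly of_rat P) w / poly (map_poly of_rat D) w"
    using assms by (elim evalsE)
  define a b where "a = fst (quot_of_fract R)" and "b = snd (quot_of_fract R)"
  have "R = to_fract a / to_fract b" and "b \<noteq> 0"
    by (simp_all add: a_def b_def flip: Fract_conv_to_fract)
  with R have "to_fract (a * D) = to_fract (P * b)"
    by (simp add: frac_eq_eq)
  then have "a * D = P * b" by (simp only: to_fract_eq_iff)
  then have "map_poly of_rat (a * D) = (map_poly of_rat (P * b) :: complex poly)" by simp
  from arg_cong[OF this, of "\<lambda>p. poly p w"] show ?thesis
    using D unfolding v a_def[symmetric] b_def[symmetric] by (simp add: map_poly_of_rat_mult divide_simps)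
qed

text \<open>If the order \<open>m\<close> at \<open>z\<close> were at most \<open>j\<close>,
  multiplying by \<open>(w - z) ^ (j - m)\<close> would force the cofactor \<open>r\<close> to
  vanish at \<open>z\<close>, against the maximality of \<open>m\<close>.\<close>

lemma linear_power_dvdI:
  fixes p :: "complex poly"
  assumes "((\<lambda>w. poly p w / (w - z) ^ j) \<longlongrightarrow> 0) (at z)"
  shows "[:- z, 1:] ^ Suc j dvd p"
proof (cases "p = 0")
  case False
  define m where "m = order z p"
  obtain r where r: "p = [:- z, 1:] ^ m * r" "\<not> [:- z, 1:] dvd r"
    using order_decomp[OF False] unfolding m_def by blast
  have "\<not> m \<le> j"
  proof
    assume "m \<le> j"
    have "((\<lambda>w. poly p w / (w - z) ^ j * (w - z) ^ (j - m)) \<longlongrightarrow> 0 * (z - z) ^ (j - m)) (at z)"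
      by (intro tendsto_intros assms)
    moreover have "\<forall>\<^sub>F w in at z. poly p w / (w - z) ^ j * (w - z) ^ (j - m) = poly r w"
      unfolding eventually_at_filter
      by (rule always_eventually) (use \<open>m \<le> j\<close> in \<open>auto simp: r power_diff\<close>)
    ultimately have "(poly r \<longlongrightarrow> 0) (at z)"
      by (simp add: tendsto_cong)
    moreover have "(poly r \<longlongrightarrow> poly r z) (at z)"
      by (intro tendsto_intros)
    ultimately have "poly r z = 0"
      by (meson LIM_unique)
    then show False using r(2) by (simp add: poly_eq_0_iff_dvd)
  qed
  then show ?thesis
    unfolding order_divides m_def by simp
qed simp

text \<open>Values are required only in a punctured neighbourhood, so single summands of
  \<open>R\<close> may have poles at \<open>z\<close>. Passing from \<open>E\<close> to the
  numerator costs a polynomial factor, which is harmless in the limit.\<close>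

lemma numerator_dvdI:
  assumes ev: "\<forall>\<^sub>F w in at z. evals w R (E w)" and "((\<lambda>w. E w / (w - z) ^ j) \<longlongrightarrow> 0) (at z)"
  shows "[:- z, 1:] ^ Suc j dvd (map_poly of_rat (fst (quot_of_fract R)) :: complex poly)"
proof (rule linear_power_dvdI)
  let ?d = "map_poly of_rat (snd (quot_of_fract R)) :: complex poly"
  have t: "((\<lambda>w. E w / (w - z) ^ j * poly ?d w) \<longlongrightarrow> 0) (at z)"
    using tendsto_mult[OF assms(2) tendsto_poly[OF tendsto_ident_at, of ?d]] by simp
  have e: "\<forall>\<^sub>F w in at z. E w / (w - z) ^ j * poly ?d w
      = poly (map_poly of_rat (fst (quot_of_fract R))) w / (w - z) ^ j"
    using ev by eventually_elim (simp add: evals_numerator)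
  show "((\<lambda>w. poly (map_poly of_rat (fst (quot_of_fract R))) w / (w - z) ^ j) \<longlongrightarrow> 0) (at z)"
    by (rule Lim_transform_eventually[OF t e])
qed

section \<open>Behaviour at roots of unity\<close>

text \<open>The total vanishes and the top \<open>k\<close> terms sum to minus the bottom
  \<open>k\<close>. The partial sums of an antisymmetric sequence are thus symmetric, which applies
  to the first-order coefficients of both deformations.\<close>

lemma sum_lessThan_antisym:
  fixes l :: "nat \<Rightarrow> 'a::field_char_0"
  assumes anti: "\<And>i. i < D \<Longrightarrow> l (D - Suc i) = - l i" and "k \<le> D"
  shows "(\<Sum>i<D - k. l i) = (\<Sum>i<k. l i)"
proof -
  have total: "(\<Sum>i<D. l i) = 0"
  proof -
    have "(\<Sum>i<D. l i) = (\<Sum>i<D. l (D - Suc i))"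
      by (rule sum.nat_diff_reindex[symmetric])
    also have "\<dots> = - (\<Sum>i<D. l i)"
      by (simp add: anti sum_negf)
    finally show ?thesis by (simp add: equation_minus_iff)
  qed
  show ?thesis
    using \<open>k \<le> D\<close>
  proof (induction k)
    case (Suc k)
    have "(\<Sum>i<D - k. l i) = (\<Sum>i<D - Suc k. l i) + l (D - Suc k)"
      using Suc.prems by (subst sum.lessThan_Suc[symmetric]) (simp add: Suc_diff_Suc)
    with Suc anti[of k] show ?case by (simp add: diff_eq_eq)
  qed (simp add: total)
qed

lemma sum_atMost_antisym:
  fixes t :: "nat \<Rightarrow> 'a::field_char_0"
  assumes "\<And>k. k \<le> D \<Longrightarrow> t (D - k) = - t k"
  shows "(\<Sum>k\<le>D. t k) = 0"
proof -
  have "(\<Sum>k\<le>D. t k) = (\<Sum>k\<le>D. t (D - k))"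
    by (rule sum.nat_diff_reindex[of _ "Suc D", symmetric, unfolded lessThan_Suc_atMost diff_Suc_Suc])
  also have "\<dots> = - (\<Sum>k\<le>D. t k)"
    by (simp add: assms sum_negf)
  finally show ?thesis by (simp add: equation_minus_iff)
qed

text \<open>The first-order expansion of a product of factors \<open>1 + s * \<beta>\<close>:
  appending a factor multiplies the difference quotient by \<open>1 + s * \<beta>\<close> and adds
  \<beta>.\<close>

lemma tendsto_prod_perturbation:
  fixes s :: "'b \<Rightarrow> complex" and k :: nat
  assumes s: "(s \<longlongrightarrow> 0) F" and s0: "\<forall>\<^sub>F w in F. s w \<noteq> 0"
    and b: "\<And>i. i < k \<Longrightarrow> ((\<lambda>w. \<beta> w i) \<longlongrightarrow> b i) F"
  shows "((\<lambda>w. ((\<Prod>i<k. 1 + s w * \<beta> w i) - 1) / s w) \<longlongrightarrow> (\<Sum>i<k. b i)) F"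
  using b
proof (induction k)
  case (Suc k)
  have "((\<lambda>w. ((\<Prod>i<k. 1 + s w * \<beta> w i) - 1) / s w * (1 + s w * \<beta> w k) + \<beta> w k)
      \<longlongrightarrow> (\<Sum>i<k. b i) * (1 + 0 * b k) + b k) F"
    by (intro tendsto_intros Suc.IH Suc.prems s) auto
  then have "((\<lambda>w. ((\<Prod>i<k. 1 + s w * \<beta> w i) - 1) / s w * (1 + s w * \<beta> w k) + \<beta> w k)
      \<longlongrightarrow> (\<Sum>i<Suc k. b i)) F" by simp
  then show ?case
    by (rule Lim_transform_eventually) (use s0 in eventually_elim, simp add: field_simps)
qed simp

text \<open>Only finitely many points are excluded, and \<open>z\<close> may be one of them, since
  the neighbourhood is punctured.\<close>

lemma eventually_generic:
  "\<forall>\<^sub>F w in at (z::complex). w \<noteq> 0 \<and> (\<forall>m. 0 < m \<and> m \<le> K \<longrightarrow> w ^ m \<noteq> 1)"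
proof -
  let ?B = "insert 0 (\<Union>m\<in>{1..K}. {w::complex. w ^ m = 1})"
  have "finite ?B"
    by (auto intro!: finite_roots_unity)
  then have "open (- (?B - {z}))"
    by (intro open_Compl finite_imp_closed) auto
  then have "\<forall>\<^sub>F w in at z. w \<notin> ?B"
    unfolding eventually_at_topological by (intro exI[of _ "- (?B - {z})"]) auto
  then show ?thesis
    by eventually_elim auto
qed

text \<open>This separates the possibly singular fourth power from factors that are continuous and
  nonzero at roots of unity of odd order.\<close>

lemma prod_cstep_eq:
  "(\<Prod>i<k. cstep w i) = (\<Prod>i<k. rstep w i) ^ 4 * (\<Prod>i<k. (1 + w ^ (2 * i + 1)) / ((1 + w ^ (2 * i + 2)) * w ^ (2 * i + 1)))"
  unfolding prod_power_distrib prod.distrib[symmetric]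
  by (intro prod.cong refl) (simp add: cstep_def rstep_def power_divide)

lemma prod_hstep_eq:
  "(\<Prod>i<k. hstep w i) = (\<Prod>i<k. rstep w i)\<^sup>2 * (\<Prod>i<k. - w * (1 - w ^ (2 * i + 1)) / (1 + w ^ (2 * i + 2)))"
  unfolding prod_power_distrib prod.distrib[symmetric]
  by (intro prod.cong refl) (simp add: hstep_def rstep_def power_divide power3_eq_cube power2_eq_square)

text \<open>The coefficient of \<open>1 - b\<close> in the expansion of \<open>gstep\<close> about
  \<open>b = 1\<close>.\<close>

definition gslope :: "complex \<Rightarrow> nat \<Rightarrow> complex" where
  "gslope \<zeta> i = - (1 - \<zeta> ^ (2 * i + 1) * \<zeta> ^ (2 * i + 2)) / ((1 - \<zeta> ^ (2 * i + 1)) * (1 - \<zeta> ^ (2 * i + 2)))"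

text \<open>\<open>1 - w\<^sup>m\<close> with its possible zero at the primitive \<open>d\<close>-th roots of unity divided out.\<close>

definition reduced_factor :: "nat \<Rightarrow> complex \<Rightarrow> nat \<Rightarrow> complex" where
  "reduced_factor d w m = (if d dvd m then \<Sum>i<m div d. w ^ (d * i) else 1 - w ^ m)"

lemma one_minus_reduced_factor: "1 - w ^ m = reduced_factor d w m * (if d dvd m then 1 - w ^ d else 1)"
proof (cases "d dvd m")
  case True
  then have 1: "w ^ m = (w ^ d) ^ (m div d)" by (simp flip: power_mult)
  have 2: "reduced_factor d w m = (\<Sum>i<m div d. (w ^ d) ^ i)"
    using True by (simp add: reduced_factor_def power_mult)
  show ?thesis
    unfolding 1 2 one_diff_power_eq[of "w ^ d" "m div d"] using True by (simp only: if_True mult.commute)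
qed (simp add: reduced_factor_def)

text \<open>The limit of the product of \<open>rstep\<close> after the factors
  \<open>1 - w ^ d\<close> have been taken out of numerators and denominators.\<close>

definition rprod_limit :: "complex \<Rightarrow> nat \<Rightarrow> nat \<Rightarrow> complex" where
  "rprod_limit \<zeta> d k = (\<Prod>i<k. reduced_factor d \<zeta> (2 * i + 1) / reduced_factor d \<zeta> (2 * i + 2))"

section \<open>Reflection identities at a primitive root of odd order \<open>d\<close>\<close>

context
  fixes \<zeta> :: complex and d D :: nat
  assumes d: "d = 2 * D + 1" and prim: "\<zeta> \<in> primroots d"
begin

lemma zeta_d: "\<zeta> ^ d = 1"
  using prim by (simp add: primroots_def)

lemma zeta0: "\<zeta> \<noteq> 0"
  using zeta_d d by auto

lemma zeta_neq: "0 < m \<Longrightarrow> m < d \<Longrightarrow> \<zeta> ^ m \<noteq> 1"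
  using prim by (simp add: primroots_def)

lemma zeta_mod: "\<zeta> ^ (m mod d) = \<zeta> ^ m"
proof -
  have "\<zeta> ^ m = (\<zeta> ^ d) ^ (m div d) * \<zeta> ^ (m mod d)"
    by (simp flip: power_mult power_add)
  then show ?thesis by (simp add: zeta_d)
qed

lemma zeta_eq_1_iff: "\<zeta> ^ m = 1 \<longleftrightarrow> d dvd m"
  using zeta_mod[of m] zeta_neq[of "m mod d"] d by (auto simp: dvd_eq_mod_eq_0)

text \<open>The order \<open>d\<close> is odd, so -1 is not a power of \<zeta>.\<close>

lemma zeta_plus: "1 + \<zeta> ^ m \<noteq> 0"
proof
  assume "1 + \<zeta> ^ m = 0"
  then have "\<zeta> ^ m = - 1" by (metis add_eq_0_iff)
  then have "(\<zeta> ^ m) ^ d = - 1" using d by simp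
  moreover have "(\<zeta> ^ m) ^ d = 1"
    by (metis power_one power_mult mult.commute zeta_d)
  ultimately show False by simp
qed

text \<open>The paired exponents add up to \<open>d\<close>. The reflection exchanges odd and even
  exponents and inverts the powers.\<close>

lemma zeta_reflect:
  assumes "i < D"
  shows "\<zeta> ^ (2 * (D - Suc i) + 1) = 1 / \<zeta> ^ (2 * i + 2)" "\<zeta> ^ (2 * (D - Suc i) + 2) = 1 / \<zeta> ^ (2 * i + 1)"
proof -
  have *: "x = 1 / y" if "x * y = 1" for x y :: complex
    using that by (metis mult_eq_0_iff nonzero_eq_divide_eq zero_neq_one)
  have e: "2 * (D - Suc i) + 1 + (2 * i + 2) = d" "2 * (D - Suc i) + 2 + (2 * i + 1) = d"
    using assms d by auto
  show "\<zeta> ^ (2 * (D - Suc i) + 1) = 1 / \<zeta> ^ (2 * i + 2)" "\<zeta> ^ (2 * (D - Suc i) + 2) = 1 / \<zeta> ^ (2 * i + 1)"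
    by (rule *, simp only: e zeta_d flip: power_add)+
qed

lemma zeta_step:
  assumes "i < D"
  shows "1 - \<zeta> ^ (2 * i + 1) \<noteq> 0" "1 - \<zeta> ^ (2 * i + 2) \<noteq> 0"
  using zeta_neq[of "2 * i + 1"] zeta_neq[of "2 * i + 2"] assms d by (simp_all del: power_Suc)

lemma prod_zeta_even: "(\<Prod>i<k. \<zeta> ^ (2 * i + 2)) = \<zeta> ^ (k * (k + 1))"
proof -
  have "(\<Sum>i<k. 2 * i + 2) = k * (k + 1)" by (induction k) auto
  then show ?thesis by (simp only: power_sum[symmetric])
qed

text \<open>The fourth powers absorb the signs arising from
  \<open>1 - 1 / v = - (1 - v) / v\<close>; what survives is \<open>(u / v) ^ 4\<close> with
  \<open>v = \<zeta> * u\<close>.\<close>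

lemma cstep_reflect:
  assumes "i < D"
  shows "cstep \<zeta> (D - Suc i) * cstep \<zeta> i = 1 / \<zeta> ^ 4"
proof -
  define u v where "u = \<zeta> ^ (2 * i + 1)" and "v = \<zeta> ^ (2 * i + 2)"
  have v: "v = \<zeta> * u" by (simp add: u_def v_def)
  have nz: "1 - u \<noteq> 0" "1 - v \<noteq> 0" "1 + u \<noteq> 0" "1 + v \<noteq> 0" "u \<noteq> 0" "v \<noteq> 0"
    unfolding u_def v_def using zeta_step[OF assms] zeta_plus zeta0 by (auto simp del: power_Suc)
  define a b e f where "a = 1 - u" and "b = 1 - v" and "e = 1 + u" and "f = 1 + v"
  have eqs: "1 - 1 / v = - b / v" "1 - 1 / u = - a / u" "1 + 1 / v = f / v" "1 + 1 / u = e / u"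
    using nz by (simp_all add: a_def b_def e_def f_def divide_simps)
  show ?thesis
    unfolding cstep_def zeta_reflect[OF assms] u_def[symmetric] v_def[symmetric] eqs
    unfolding a_def[symmetric] b_def[symmetric] e_def[symmetric] f_def[symmetric]
    using nz[folded a_def b_def e_def f_def] zeta0
    by (simp add: divide_simps power_mult_distrib) (simp add: v power_mult_distrib eval_nat_numeral)
qed

lemma prod_cstep_total: "(\<Prod>i<D. cstep \<zeta> i) = \<zeta>"
proof -
  define p where "p u = (1 - u) ^ 4 * (1 + u) / u" for u :: complex
  have "(\<Prod>i<D. cstep \<zeta> i) = (\<Prod>i<D. p (\<zeta> ^ (2 * i + 1))) / (\<Prod>i<D. (1 - \<zeta> ^ (2 * i + 2)) ^ 4 * (1 + \<zeta> ^ (2 * i + 2)))"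
    by (simp add: cstep_def p_def mult_ac flip: prod_dividef)
  also have "(\<Prod>i<D. p (\<zeta> ^ (2 * i + 1))) = (\<Prod>i<D. p (\<zeta> ^ (2 * (D - Suc i) + 1)))"
    by (rule prod.nat_diff_reindex[symmetric])
  also have "\<dots> = (\<Prod>i<D. (1 - \<zeta> ^ (2 * i + 2)) ^ 4 * (1 + \<zeta> ^ (2 * i + 2)) * (1 / \<zeta> ^ (2 * i + 2)) ^ 4)"
  proof (intro prod.cong refl)
    fix i assume "i \<in> {..<D}"
    then have i: "i < D" by simp
    have "p (1 / v) = (1 - v) ^ 4 * (1 + v) * (1 / v) ^ 4" if "v \<noteq> 0" for v
    proof -
      have 1: "1 - 1 / v = - ((1 - v) * (1 / v))" "1 + 1 / v = (1 + v) * (1 / v)"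
        using that by (simp_all add: field_simps)
      show ?thesis unfolding p_def 1 power_minus_Bit0 using that by (simp add: power_divide)
    qed
    then show "p (\<zeta> ^ (2 * (D - Suc i) + 1)) = (1 - \<zeta> ^ (2 * i + 2)) ^ 4 * (1 + \<zeta> ^ (2 * i + 2)) * (1 / \<zeta> ^ (2 * i + 2)) ^ 4"
      unfolding zeta_reflect[OF i] using zeta0 by simp
  qed
  also have "\<dots> / (\<Prod>i<D. (1 - \<zeta> ^ (2 * i + 2)) ^ 4 * (1 + \<zeta> ^ (2 * i + 2))) = (\<Prod>i<D. (1 / \<zeta> ^ (2 * i + 2)) ^ 4)"
  proof -
    have "(\<Prod>i<D. (1 - \<zeta> ^ (2 * i + 2)) ^ 4 * (1 + \<zeta> ^ (2 * i + 2))) \<noteq> 0"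
      using zeta_step zeta_plus by (auto simp del: power_Suc)
    then show ?thesis unfolding prod.distrib by simp
  qed
  also have "\<dots> = 1 / \<zeta> ^ (4 * (D * (D + 1)))"
    unfolding power_one_over prod_dividef prod_zeta_even prod_power_distrib[symmetric]
    by (simp add: power_one_over mult.commute[of 4] flip: power_mult)
  also have "\<dots> = \<zeta>"
  proof -
    \<comment> \<open>Here \<open>4 * D * (D + 1) + 1\<close> is the square of
      \<open>d = 2 * D + 1\<close>.\<close>
    have "\<zeta> * \<zeta> ^ (4 * (D * (D + 1))) = (\<zeta> ^ d) ^ d"
      by (simp add: d algebra_simps flip: power_mult power_Suc power_add)
    then show ?thesis using zeta0 by (simp add: zeta_d divide_simps)
  qed
  finally show ?thesis .
qed

text \<open>Peeling off reflected pairs from the full product shows that the product up to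
  \<open>D - k\<close> is \<open>\<zeta> ^ (4 * k + 1)\<close> times the product up to
  \<open>k\<close>. The exponents \<open>4 * (D - k) + 1\<close> and \<open>4 * k + 1\<close> add up
  to \<open>2 * d\<close>, so the factor in front turns this into a change of sign.\<close>

lemma prod_cstep_antisym:
  assumes "k \<le> D"
  shows "(1 - \<zeta> ^ (4 * (D - k) + 1)) * (\<Prod>i<D - k. cstep \<zeta> i) = - ((1 - \<zeta> ^ (4 * k + 1)) * (\<Prod>i<k. cstep \<zeta> i))"
proof -
  have "(\<Prod>i<D - k. cstep \<zeta> i) = \<zeta> ^ (4 * k + 1) * (\<Prod>i<k. cstep \<zeta> i)"
    using assms
  proof (induction k)
    case (Suc k)
    then have k: "k < D" by simp
    have "(\<Prod>i<D - k. cstep \<zeta> i) = (\<Prod>i<D - Suc k. cstep \<zeta> i) * cstep \<zeta> (D - Suc k)"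
      using Suc.prems by (subst prod.lessThan_Suc[symmetric]) (simp add: Suc_diff_Suc)
    then have "(\<Prod>i<D - Suc k. cstep \<zeta> i) * (cstep \<zeta> (D - Suc k) * cstep \<zeta> k) = \<zeta> ^ (4 * k + 1) * (\<Prod>i<Suc k. cstep \<zeta> i)"
      using Suc by (simp add: mult_ac)
    then show ?case
      unfolding cstep_reflect[OF k] using zeta0 by (simp add: field_simps eval_nat_numeral)
  qed (simp add: prod_cstep_total)
  moreover have "\<zeta> ^ (4 * (D - k) + 1) * \<zeta> ^ (4 * k + 1) = 1"
  proof -
    have e: "4 * (D - k) + 1 + (4 * k + 1) = d * 2" using assms d by auto
    show ?thesis by (simp only: e zeta_d power_mult power_one flip: power_add)
  qed
  ultimately show ?thesis by (simp add: algebra_simps)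
qed

text \<open>Reversing the numerator leaves a sign, which the square removes, and an even power of
  \<zeta>, reduced by \<open>2 * D * (D + 1) = d * D + D\<close>. In the limit this makes the
  prefactors of \<open>watson_g\<close> and \<open>watson_fg\<close> agree with that of
  \<open>watson_f\<close>.\<close>

lemma prod_rstep_sq: "(\<Prod>i<D. rstep \<zeta> i)\<^sup>2 = 1 / \<zeta> ^ D"
proof -
  have "(\<Prod>i<D. rstep \<zeta> i) = (\<Prod>i<D. 1 - \<zeta> ^ (2 * i + 1)) / (\<Prod>i<D. 1 - \<zeta> ^ (2 * i + 2))"
    by (simp add: rstep_def prod_dividef)
  also have "(\<Prod>i<D. 1 - \<zeta> ^ (2 * i + 1)) = (\<Prod>i<D. 1 - \<zeta> ^ (2 * (D - Suc i) + 1))"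
    by (rule prod.nat_diff_reindex[symmetric])
  also have "\<dots> = (\<Prod>i<D. (1 - \<zeta> ^ (2 * i + 2)) * (- 1 / \<zeta> ^ (2 * i + 2)))"
  proof (intro prod.cong refl)
    fix i assume "i \<in> {..<D}"
    then have i: "i < D" by simp
    show "1 - \<zeta> ^ (2 * (D - Suc i) + 1) = (1 - \<zeta> ^ (2 * i + 2)) * (- 1 / \<zeta> ^ (2 * i + 2))"
      unfolding zeta_reflect[OF i] using zeta0 by (simp add: field_simps)
  qed
  also have "\<dots> / (\<Prod>i<D. 1 - \<zeta> ^ (2 * i + 2)) = (\<Prod>i<D. (- 1 / \<zeta> ^ (2 * i + 2)))"
  proof -
    have "(\<Prod>i<D. 1 - \<zeta> ^ (2 * i + 2)) \<noteq> 0"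
      using zeta_step by (auto simp del: power_Suc)
    then show ?thesis unfolding prod.distrib by simp
  qed
  also have "\<dots> = (-1) ^ D / \<zeta> ^ (D * (D + 1))"
    unfolding prod_dividef prod_zeta_even by simp
  finally have "(\<Prod>i<D. rstep \<zeta> i)\<^sup>2 = 1 / (\<zeta> ^ (D * (D + 1)))\<^sup>2"
    by (simp add: power_divide flip: power_mult)
  also have "(\<zeta> ^ (D * (D + 1)))\<^sup>2 = (\<zeta> ^ d) ^ D * \<zeta> ^ D"
  proof -
    have e: "D * (D + 1) * 2 = d * D + D" by (simp add: d algebra_simps)
    show ?thesis by (simp only: e flip: power_mult power_add)
  qed
  finally show ?thesis by (simp add: zeta_d)
qed

lemmas zeta_facts = zeta_d zeta0 zeta_neq zeta_eq_1_iff zeta_plus zeta_step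

text \<open>The function x / (1 - x)^2 is invariant under x -> 1/x, while the reflection exchanges
  the odd and the even exponent.\<close>

lemma phi_reflect:
  assumes "i < D"
  shows "phi \<zeta> (2 * (D - Suc i) + 2) - phi \<zeta> (2 * (D - Suc i) + 1) = - (phi \<zeta> (2 * i + 2) - phi \<zeta> (2 * i + 1))"
proof -
  have "1 / x / (1 - 1 / x)\<^sup>2 = x / (1 - x)\<^sup>2" if "x \<noteq> 0" for x :: complex
  proof -
    have "1 - 1 / x = - ((1 - x) / x)" using that by (simp add: field_simps)
    then show ?thesis using that by (simp add: power_divide power2_eq_square[of x] del: minus_divide_left)
  qed
  then show ?thesis
    unfolding phi_def zeta_reflect[OF assms] using zeta_facts by simp
qed

lemma gslope_reflect:
  assumes "i < D"
  shows "gslope \<zeta> (D - Suc i) = - gslope \<zeta> i"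
proof -
  have "- (1 - 1 / v * (1 / u)) / ((1 - 1 / v) * (1 - 1 / u)) = - (- (1 - u * v) / ((1 - u) * (1 - v)))"
    if "u \<noteq> 0" "v \<noteq> 0" "1 - u \<noteq> 0" "1 - v \<noteq> 0" for u v :: complex
  proof -
    have 1: "1 - 1 / v * (1 / u) = - ((1 - u * v) / (u * v))" "1 - 1 / v = - ((1 - v) / v)" "1 - 1 / u = - ((1 - u) / u)"
      using that by (simp_all add: field_simps)
    define a b c where "a = 1 - u" and "b = 1 - v" and "c = 1 - u * v"
    show ?thesis
      unfolding 1 unfolding a_def[symmetric] b_def[symmetric] c_def[symmetric]
      using that[folded a_def b_def] by simp
  qed
  then show ?thesis
    unfolding gslope_def zeta_reflect[OF assms] using zeta_facts assms by (simp del: power_Suc)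
qed

lemma zeta_geometric: "\<not> d dvd r \<Longrightarrow> (\<Sum>m<d. \<zeta> ^ (m * r)) = 0"
proof -
  assume "\<not> d dvd r"
  then have "\<zeta> ^ r \<noteq> 1" by (simp add: zeta_facts)
  then have "(\<Sum>m<d. (\<zeta> ^ r) ^ m) = 0"
    by (subst sum_gp_strict) (simp_all add: zeta_facts power_mult[symmetric] mult.commute[of r] power_mult[of _ d])
  then show ?thesis by (simp add: mult.commute flip: power_mult)
qed

text \<open>The sums \<open>T r\<close> and \<open>S r\<close>, with first and second powers of
  \<open>1 - \<zeta> ^ m\<close> below, obey difference equations in \<open>r\<close>, since
  multiplying by \<open>1 - \<zeta> ^ m\<close> lowers the power. The initial values follow because
  the sum over a full period of \<open>r\<close> vanishes. Finally \<open>S 1\<close> covers all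
  exponents, and reflection shows that the even ones make up half of it.\<close>

lemma sum_phi: "(\<Sum>i<D. phi \<zeta> (2 * i + 2)) = - (of_nat d ^ 2 - 1) / 24"
proof -
  define T where "T r = (\<Sum>m\<in>{1..<d}. \<zeta> ^ (m * r) / (1 - \<zeta> ^ m))" for r
  define S where "S r = (\<Sum>m\<in>{1..<d}. \<zeta> ^ (m * r) / (1 - \<zeta> ^ m)\<^sup>2)" for r
  have d0: "d > 0" using d by simp
  have nz: "1 - \<zeta> ^ m \<noteq> 0" if "m \<in> {1..<d}" for m
    using zeta_facts(3)[of m] that by simp
  have cyc: "(\<Sum>r<d. \<zeta> ^ (m * (1 + r))) = 0" if "m \<in> {1..<d}" for m
  proof -
    have "\<not> d dvd m" using that by (auto dest: dvd_imp_le)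
    from zeta_geometric[OF this] have "\<zeta> ^ m * (\<Sum>r<d. \<zeta> ^ (r * m)) = 0" by simp
    then show ?thesis by (simp add: sum_distrib_left mult.commute power_add[symmetric])
  qed
  have T0: "(\<Sum>r<d. T (1 + r)) = 0" and S0: "(\<Sum>r<d. S (1 + r)) = 0"
    unfolding T_def S_def by (subst sum.swap; simp only: cyc sum_divide_distrib[symmetric] cong: sum.cong; simp)+
  have Tstep: "T (1 + Suc r) = T (1 + r) + 1" if "Suc r < d" for r
  proof -
    have "T (1 + r) - T (1 + Suc r) = (\<Sum>m\<in>{1..<d}. \<zeta> ^ (m * (1 + r)))"
      unfolding T_def sum_subtractf[symmetric]
    proof (intro sum.cong refl)
      fix m assume "m \<in> {1..<d}"
      define x where "x = 1 - \<zeta> ^ m"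
      have "x \<noteq> 0" using nz[OF \<open>m \<in> {1..<d}\<close>] by (simp add: x_def)
      have "\<zeta> ^ (m * (1 + Suc r)) = \<zeta> ^ (m * (1 + r)) * (1 - x)"
        by (simp add: x_def add_ac flip: power_add)
      then show "\<zeta> ^ (m * (1 + r)) / (1 - \<zeta> ^ m) - \<zeta> ^ (m * (1 + Suc r)) / (1 - \<zeta> ^ m) = \<zeta> ^ (m * (1 + r))"
        unfolding x_def[symmetric] using \<open>x \<noteq> 0\<close> by (simp add: divide_simps) (simp add: algebra_simps)
    qed
    also have "\<dots> = (\<Sum>m<d. \<zeta> ^ (m * (1 + r))) - 1"
      using d0 by (simp add: sum.atLeast_Suc_lessThan[of 0 d] lessThan_atLeast0)
    also have "(\<Sum>m<d. \<zeta> ^ (m * (1 + r))) = 0"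
      by (rule zeta_geometric) (use that in \<open>auto dest: dvd_imp_le\<close>)
    finally show ?thesis by (simp add: algebra_simps)
  qed
  have T: "T (1 + r) = T 1 + of_nat r" if "r < d" for r
    using that
  proof (induction r)
    case (Suc r)
    then show ?case unfolding Tstep[OF Suc.prems] by simp
  qed simp
  have Sstep: "S (1 + Suc r) = S (1 + r) - T (1 + r)" for r
  proof -
    have "S (1 + r) - S (1 + Suc r) = T (1 + r)"
      unfolding T_def S_def sum_subtractf[symmetric]
    proof (intro sum.cong refl)
      fix m assume "m \<in> {1..<d}"
      define x where "x = 1 - \<zeta> ^ m"
      have "x \<noteq> 0" using nz[OF \<open>m \<in> {1..<d}\<close>] by (simp add: x_def)
      have "\<zeta> ^ (m * (1 + Suc r)) = \<zeta> ^ (m * (1 + r)) * (1 - x)"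
        by (simp add: x_def add_ac flip: power_add)
      then show "\<zeta> ^ (m * (1 + r)) / (1 - \<zeta> ^ m)\<^sup>2 - \<zeta> ^ (m * (1 + Suc r)) / (1 - \<zeta> ^ m)\<^sup>2 = \<zeta> ^ (m * (1 + r)) / (1 - \<zeta> ^ m)"
        unfolding x_def[symmetric] using \<open>x \<noteq> 0\<close> by (simp add: divide_simps power2_eq_square) (simp add: algebra_simps)
    qed
    then show ?thesis by (simp add: algebra_simps)
  qed
  have S: "S (1 + r) = S 1 - of_nat r * T 1 - of_nat r * (of_nat r - 1) / 2" if "r < d" for r
    using that
  proof (induction r)
    case (Suc r)
    then have "S (1 + Suc r) = S 1 - of_nat r * T 1 - of_nat r * (of_nat r - 1) / 2 - (T 1 + of_nat r)"
      unfolding Sstep by (subst T) simp_all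
    then show ?case by (simp add: field_simps)
  qed simp
  have Tsum: "(\<Sum>r<d. T (1 + r)) = (\<Sum>r<d. T 1 + of_nat r)"
    and Ssum: "(\<Sum>r<d. S (1 + r)) = (\<Sum>r<d. S 1 - of_nat r * T 1 - of_nat r * (of_nat r - 1) / 2)"
    by (rule sum.cong[OF refl], rule T S, simp)+
  have "(\<Sum>r<k. T 1 + of_nat r) = of_nat k * T 1 + of_nat k * (of_nat k - 1) / 2" for k
    by (induction k) (simp_all add: field_simps)
  then have "of_nat d * (T 1 + (of_nat d - 1) / 2) = 0"
    using T0 unfolding Tsum by (simp add: distrib_left)
  then have "T 1 + (of_nat d - 1) / 2 = 0"
    using d0 by simp
  then have T1: "T 1 = - ((of_nat d - 1) / 2)"
    by (simp only: eq_neg_iff_add_eq_0)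
  have Sclosed: "(\<Sum>r<k. S 1 - of_nat r * T 1 - of_nat r * (of_nat r - 1) / 2)
     = of_nat k * S 1 - of_nat k * (of_nat k - 1) / 2 * T 1 - of_nat k * (of_nat k - 1) * (of_nat k - 2) / 6" for k
  proof (induction k)
    case (Suc k)
    show ?case unfolding sum.lessThan_Suc Suc.IH by (simp add: field_simps)
  qed simp
  have "of_nat d * (S 1 - (of_nat d - 1) / 2 * T 1 - (of_nat d - 1) * (of_nat d - 2) / 6) = 0"
    using S0 unfolding Ssum Sclosed by (simp add: algebra_simps)
  then have "S 1 = (of_nat d - 1) / 2 * T 1 + (of_nat d - 1) * (of_nat d - 2) / 6"
    using d0 by (simp only: mult_eq_0_iff of_nat_eq_0_iff) (simp add: algebra_simps)
  then have S1: "S 1 = - (of_nat d ^ 2 - 1) / 12"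
    unfolding T1 by (rule trans) (simp add: field_simps power2_eq_square)
  have "S 1 = (\<Sum>m\<in>{1..<d}. phi \<zeta> m)"
    by (simp add: S_def phi_def)
  also have "\<dots> = (\<Sum>m\<in>{1..<2 * D + 1}. phi \<zeta> m)" by (simp add: d)
  also have "\<dots> = (\<Sum>i<D. phi \<zeta> (2 * i + 1) + phi \<zeta> (2 * i + 2))"
    by (induction D) (simp_all add: add_ac)
  also have "\<dots> = (\<Sum>i<D. phi \<zeta> (2 * i + 2) - phi \<zeta> (2 * i + 1)) * (-1) + 2 * (\<Sum>i<D. phi \<zeta> (2 * i + 2))"
    by (simp add: sum.distrib sum_subtractf)
  \<comment> \<open>For \<open>k = D\<close> the other partial sum in
    \<open>sum_lessThan_antisym\<close> is empty.\<close>
  also have "(\<Sum>i<D. phi \<zeta> (2 * i + 2) - phi \<zeta> (2 * i + 1)) = 0"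
    using sum_lessThan_antisym[of D "\<lambda>i. phi \<zeta> (2 * i + 2) - phi \<zeta> (2 * i + 1)" D, OF phi_reflect] by simp
  finally show ?thesis unfolding S1 by simp
qed

section \<open>Limits of products and sums of terms at a primitive \<open>d\<close>-th root\<close>

lemma reduced_factor_tendsto: "((\<lambda>w. reduced_factor d w m) \<longlongrightarrow> reduced_factor d \<zeta> m) (at \<zeta>)"
proof (cases "d dvd m")
  case True
  then show ?thesis unfolding reduced_factor_def if_P[OF True] by (intro tendsto_sum tendsto_power tendsto_ident_at)
next
  case False
  then show ?thesis unfolding reduced_factor_def if_not_P[OF False] by (intro tendsto_diff tendsto_const tendsto_power tendsto_ident_at)
qed

lemma reduced_factor_nonzero: "m > 0 \<Longrightarrow> reduced_factor d \<zeta> m \<noteq> 0"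
proof (cases "d dvd m")
  case True
  assume "m > 0"
  with True have "m div d \<noteq> 0"
    by (simp add: dvd_div_eq_0_iff)
  then show ?thesis
    using True by (simp add: reduced_factor_def power_mult zeta_facts)
qed (simp add: reduced_factor_def zeta_facts)

text \<open>Reduced modulo \<open>d\<close>, both numbers lie between 1 and \<open>2 * d\<close>,
  where the only multiples are \<open>d\<close> and \<open>2 * d\<close>, told apart by parity. In
  each period the numerator of \<open>rstep\<close> thus vanishes at residue \<open>D\<close> and
  its denominator at residue \<open>2 * D\<close>.\<close>

lemma dvd_odd_iff: "d dvd 2 * k + 1 \<longleftrightarrow> k mod d = D"
  and dvd_even_iff: "d dvd 2 * k + 2 \<longleftrightarrow> k mod d = 2 * D"
proof -
  obtain x r where k: "k = d * x + r" and r: "r < d"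
    using d by (metis mod_less_divisor mult_div_mod_eq add_gr_0 zero_less_one)
  then have kr: "k mod d = r" by simp
  have "2 * k + c = d * (2 * x) + (2 * r + c)" for c
    by (simp add: k distrib_left)
  then have *: "d dvd 2 * k + c \<longleftrightarrow> d dvd 2 * r + c" for c
    by (simp only: dvd_add_right_iff dvd_triv_left)
  have two: "d dvd m \<longleftrightarrow> m = d \<or> m = 2 * d" if "0 < m" "m \<le> 2 * d" for m
  proof
    assume "d dvd m"
    then obtain j where j: "m = d * j" by (elim dvdE)
    with that have "0 < j" by (intro Nat.gr0I) simp
    moreover have "d * j \<le> d * 2" using that j by simp
    then have "j \<le> 2" unfolding mult_le_cancel1 using d by linarith
    ultimately have "j = 1 \<or> j = 2" by auto
    with j show "m = d \<or> m = 2 * d" by auto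
  qed auto
  show "d dvd 2 * k + 1 \<longleftrightarrow> k mod d = D"
    unfolding * kr using two[of "2 * r + 1"] r d by linarith
  have "d dvd 2 * r + 2 \<longleftrightarrow> 2 * r + 2 = d \<or> 2 * r + 2 = 2 * d"
    by (rule two) (use r in auto)
  moreover have "2 * r + 2 \<noteq> d" using d by presburger
  ultimately show "d dvd 2 * k + 2 \<longleftrightarrow> k mod d = 2 * D"
    unfolding * kr using d by linarith
qed

text \<open>A factor \<open>1 - w ^ d\<close> enters just after residue \<open>D\<close> and is
  cancelled just after residue \<open>2 * D\<close>, so at most one is present at any time.\<close>

lemma prod_rstep_eq:
  assumes "w ^ d \<noteq> 1"
  shows "(\<Prod>i<k. rstep w i) = (\<Prod>i<k. reduced_factor d w (2 * i + 1) / reduced_factor d w (2 * i + 2))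
     * (if k mod d > D then 1 - w ^ d else 1)"
proof (induction k)
  case (Suc k)
  have r: "rstep w k = reduced_factor d w (2 * k + 1) / reduced_factor d w (2 * k + 2)
     * ((if k mod d = D then 1 - w ^ d else 1) / (if k mod d = 2 * D then 1 - w ^ d else 1))"
    unfolding rstep_def by (subst (1 2) one_minus_reduced_factor[of _ _ d]) (simp only: dvd_odd_iff dvd_even_iff times_divide_times_eq)
  have s: "Suc k mod d = (if k mod d = 2 * D then 0 else Suc (k mod d))"
    by (simp add: mod_Suc d)
  have e: "(if k mod d > D then 1 - w ^ d else 1) * ((if k mod d = D then 1 - w ^ d else 1) / (if k mod d = 2 * D then 1 - w ^ d else 1))
     = (if Suc k mod d > D then 1 - w ^ d else 1)"
    \<comment> \<open>For \<open>D = 0\<close> the two residues coincide and the factor cancels at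
      once.\<close>
    unfolding s using assms d by (cases "D = 0") auto
  show ?case unfolding prod.lessThan_Suc Suc.IH r e[symmetric] by (simp only: mult_ac)
qed simp

lemma rprod_limit_tendsto:
  "((\<lambda>w. \<Prod>i<k. reduced_factor d w (2 * i + 1) / reduced_factor d w (2 * i + 2)) \<longlongrightarrow> rprod_limit \<zeta> d k) (at \<zeta>)"
  unfolding rprod_limit_def by (intro tendsto_intros reduced_factor_tendsto reduced_factor_nonzero) simp

lemma eventually_root_neq: "\<forall>\<^sub>F w in at \<zeta>. w ^ d \<noteq> 1"
  using eventually_generic[where z = \<zeta> and K = d] by eventually_elim (use d in auto)

lemma prod_rstep_tendsto:
  "((\<lambda>w. \<Prod>i<k. rstep w i) \<longlongrightarrow> (if k mod d > D then 0 else rprod_limit \<zeta> d k)) (at \<zeta>)"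
proof -
  have "((\<lambda>w. (\<Prod>i<k. reduced_factor d w (2 * i + 1) / reduced_factor d w (2 * i + 2)) * (if k mod d > D then 1 - w ^ d else 1))
      \<longlongrightarrow> (if k mod d > D then 0 else rprod_limit \<zeta> d k)) (at \<zeta>)"
  proof (cases "k mod d > D")
    case True
    have "((\<lambda>w. (\<Prod>i<k. reduced_factor d w (2 * i + 1) / reduced_factor d w (2 * i + 2)) * (1 - w ^ d))
      \<longlongrightarrow> rprod_limit \<zeta> d k * (1 - \<zeta> ^ d)) (at \<zeta>)"
      by (intro tendsto_intros rprod_limit_tendsto)
    with True show ?thesis by (simp add: zeta_facts)
  next
    case False
    with rprod_limit_tendsto show ?thesis by simp
  qed
  then show ?thesis
    by (rule Lim_transform_eventually) (use eventually_root_neq in eventually_elim, simp add: prod_rstep_eq)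
qed

lemma csmooth_tendsto:
  "((\<lambda>w. \<Prod>i<k. (1 + w ^ (2 * i + 1)) / ((1 + w ^ (2 * i + 2)) * w ^ (2 * i + 1)))
    \<longlongrightarrow> (\<Prod>i<k. (1 + \<zeta> ^ (2 * i + 1)) / ((1 + \<zeta> ^ (2 * i + 2)) * \<zeta> ^ (2 * i + 1)))) (at \<zeta>)"
  by (intro tendsto_intros) (use zeta_facts(2,5) in \<open>simp del: power_Suc\<close>)

lemma hsmooth_tendsto:
  "((\<lambda>w. \<Prod>i<k. - w * (1 - w ^ (2 * i + 1)) / (1 + w ^ (2 * i + 2)))
    \<longlongrightarrow> (\<Prod>i<k. - \<zeta> * (1 - \<zeta> ^ (2 * i + 1)) / (1 + \<zeta> ^ (2 * i + 2)))) (at \<zeta>)"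
  by (intro tendsto_intros) (use zeta_facts(2,5) in \<open>simp del: power_Suc\<close>)

lemma prod_cstep_tendsto: "\<exists>l. ((\<lambda>w. \<Prod>i<k. cstep w i) \<longlongrightarrow> l) (at \<zeta>) \<and> (k mod d > D \<longrightarrow> l = 0)"
  using tendsto_mult[OF tendsto_power[OF prod_rstep_tendsto, of k 4] csmooth_tendsto[of k]]
  unfolding prod_cstep_eq[symmetric] by (intro exI conjI) (assumption, simp)

lemma prod_hstep_tendsto: "\<exists>l. ((\<lambda>w. \<Prod>i<k. hstep w i) \<longlongrightarrow> l) (at \<zeta>)"
  using tendsto_mult[OF tendsto_power[OF prod_rstep_tendsto, of k 2] hsmooth_tendsto[of k]]
  unfolding prod_hstep_eq[symmetric] by (rule exI)

lemma zeta_shift: "\<zeta> ^ (2 * (d * i + j) + c) = \<zeta> ^ (2 * j + c)"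
proof -
  have "\<zeta> ^ (2 * (d * i + j) + c) = (\<zeta> ^ d) ^ (2 * i) * \<zeta> ^ (2 * j + c)"
    by (simp add: distrib_left add_ac mult_ac flip: power_mult power_add)
  then show ?thesis by (simp add: zeta_facts)
qed

lemma cstep_tendsto:
  assumes "j < D"
  shows "((\<lambda>w. cstep w (d * i + j)) \<longlongrightarrow> cstep \<zeta> j) (at \<zeta>)"
proof -
  have nz: "(1 - \<zeta> ^ (2 * (d * i + j) + 2)) ^ 4 * (1 + \<zeta> ^ (2 * (d * i + j) + 2)) * \<zeta> ^ (2 * (d * i + j) + 1) \<noteq> 0"
    unfolding zeta_shift using zeta_facts(6-7)[OF assms] zeta_facts(2,5) by (simp del: power_Suc)
  have "((\<lambda>w. cstep w (d * i + j)) \<longlongrightarrow> cstep \<zeta> (d * i + j)) (at \<zeta>)"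
    unfolding cstep_def by (intro tendsto_intros nz)
  moreover have "cstep \<zeta> (d * i + j) = cstep \<zeta> j"
    unfolding cstep_def zeta_shift ..
  ultimately show ?thesis by simp
qed

text \<open>For residues up to \<open>D\<close> the terms tend to a common limit \<open>l\<close>
  times the antisymmetric sequence \<open>t\<close>, whose sum is 0. For larger residues the
  uncancelled factor \<open>1 - w ^ d\<close> makes each term tend to 0.\<close>

lemma block_tendsto_0:
  "((\<lambda>w. \<Sum>r<d. (1 - w ^ (4 * (d * i + r) + 1)) * (\<Prod>j<d * i + r. cstep w j)) \<longlongrightarrow> 0) (at \<zeta>)"
proof -
  obtain l where l: "((\<lambda>w. \<Prod>j<d * i. cstep w j) \<longlongrightarrow> l) (at \<zeta>)"
    using prod_cstep_tendsto by blast
  define t where "t r = (1 - \<zeta> ^ (4 * r + 1)) * (\<Prod>j<r. cstep \<zeta> j)" for r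
  have low: "((\<lambda>w. (1 - w ^ (4 * (d * i + r) + 1)) * (\<Prod>j<d * i + r. cstep w j)) \<longlongrightarrow> l * t r) (at \<zeta>)" if "r \<le> D" for r
  proof -
    have split: "(\<Prod>j<d * i + r. cstep w j) = (\<Prod>j<d * i. cstep w j) * (\<Prod>j<r. cstep w (d * i + j))" for w :: complex
      by (induction r) (simp_all add: mult_ac)
    have "((\<lambda>w. (1 - w ^ (4 * (d * i + r) + 1)) * ((\<Prod>j<d * i. cstep w j) * (\<Prod>j<r. cstep w (d * i + j))))
        \<longlongrightarrow> (1 - \<zeta> ^ (4 * (d * i + r) + 1)) * (l * (\<Prod>j<r. cstep \<zeta> j))) (at \<zeta>)"
      by (intro tendsto_intros l cstep_tendsto) (use that in auto)
    moreover have "\<zeta> ^ (4 * (d * i + r) + 1) = \<zeta> ^ (4 * r + 1)"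
      using zeta_shift[of "2 * i" "2 * r" 1] by (simp add: mult_ac distrib_left)
    ultimately show ?thesis unfolding split t_def by (simp only: mult.left_commute)
  qed
  have high: "((\<lambda>w. (1 - w ^ (4 * (d * i + r) + 1)) * (\<Prod>j<d * i + r. cstep w j)) \<longlongrightarrow> 0) (at \<zeta>)" if "D < r" "r < d" for r
  proof -
    have "D < (d * i + r) mod d" using that by simp
    then have "((\<lambda>w. \<Prod>j<d * i + r. cstep w j) \<longlongrightarrow> 0) (at \<zeta>)"
      using prod_cstep_tendsto[of "d * i + r"] by auto
    then have "((\<lambda>w. (1 - w ^ (4 * (d * i + r) + 1)) * (\<Prod>j<d * i + r. cstep w j)) \<longlongrightarrow> (1 - \<zeta> ^ (4 * (d * i + r) + 1)) * 0) (at \<zeta>)"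
      by (intro tendsto_intros)
    then show ?thesis by simp
  qed
  have "((\<lambda>w. \<Sum>r<d. (1 - w ^ (4 * (d * i + r) + 1)) * (\<Prod>j<d * i + r. cstep w j))
      \<longlongrightarrow> (\<Sum>r<d. if r \<le> D then l * t r else 0)) (at \<zeta>)"
  proof (intro tendsto_sum)
    fix r assume "r \<in> {..<d}"
    then show "((\<lambda>w. (1 - w ^ (4 * (d * i + r) + 1)) * (\<Prod>j<d * i + r. cstep w j)) \<longlongrightarrow> (if r \<le> D then l * t r else 0)) (at \<zeta>)"
      using low[of r] high[of r] by (cases "r \<le> D") (simp_all del: power_Suc add: not_le)
  qed
  moreover have "(\<Sum>r<d. if r \<le> D then l * t r else 0) = l * (\<Sum>r\<le>D. t r)"
    unfolding sum_distrib_left by (rule sum.mono_neutral_cong_right) (use d in auto)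
  moreover have "(\<Sum>r\<le>D. t r) = 0"
    by (rule sum_atMost_antisym) (use prod_cstep_antisym in \<open>simp only: t_def\<close>)
  ultimately show ?thesis by (simp only: mult_zero_right)
qed

lemma blocks_tendsto_0:
  "((\<lambda>w. \<Sum>k<d * c. (1 - w ^ (4 * k + 1)) * (\<Prod>j<k. cstep w j)) \<longlongrightarrow> 0) (at \<zeta>)"
proof -
  have "(\<Sum>k<d * c. f k) = (\<Sum>i<c. \<Sum>r<d. f (d * i + r))" for f :: "nat \<Rightarrow> complex"
  proof -
    have "(\<Sum>k<d * c. f k) = (\<Sum>i<c. \<Sum>k\<in>{i * d..<i * d + d}. f k)"
      by (simp add: sum.nat_group mult.commute)
    also have "\<dots> = (\<Sum>i<c. \<Sum>r<d. f (d * i + r))"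
    proof (rule sum.cong[OF refl])
      fix i
      show "(\<Sum>k\<in>{i * d..<i * d + d}. f k) = (\<Sum>r<d. f (d * i + r))"
        by (rule sum.reindex_bij_witness[of _ "\<lambda>r. d * i + r" "\<lambda>k. k - d * i"]) (auto simp: mult.commute)
    qed
    finally show ?thesis .
  qed
  moreover have "((\<lambda>w. \<Sum>i<c. \<Sum>r<d. (1 - w ^ (4 * (d * i + r) + 1)) * (\<Prod>j<d * i + r. cstep w j)) \<longlongrightarrow> (\<Sum>i<c. 0)) (at \<zeta>)"
    by (rule tendsto_sum, rule block_tendsto_0)
  ultimately show ?thesis by (simp only: sum.neutral_const)
qed

text \<open>Completing the last block adds only terms with residue greater than \<open>D\<close>,
  each of which tends to 0.\<close>

lemma sum_tendsto_0:
  assumes "M mod d = D \<or> M mod d = d - 1"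
  shows "((\<lambda>w. \<Sum>k\<le>M. (1 - w ^ (4 * k + 1)) * (\<Prod>j<k. cstep w j)) \<longlongrightarrow> 0) (at \<zeta>)"
proof -
  define c where "c = M div d + 1"
  define f where "f w k = (1 - w ^ (4 * k + 1)) * (\<Prod>j<k. cstep w j)" for w :: complex and k
  have M: "M = d * (M div d) + M mod d" by simp
  have lt: "M mod d < d" using d by simp
  have sub: "{..M} \<subseteq> {..<d * c}"
  proof
    fix k assume "k \<in> {..M}"
    then have "k \<le> M" by simp
    also have "M < d * c" using M lt unfolding c_def by (metis add_less_cancel_left distrib_left mult.right_neutral)
    finally show "k \<in> {..<d * c}" by simp
  qed
  have rest: "((\<lambda>w. f w k) \<longlongrightarrow> 0) (at \<zeta>)" if "k \<in> {..<d * c} - {..M}" for k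
  proof -
    define j where "j = k - d * (M div d)"
    have "d * c = d * (M div d) + d" by (simp add: c_def)
    then have k: "k = d * (M div d) + j" and "j < d" "M mod d < j"
      using that M lt unfolding j_def lessThan_iff atMost_iff Diff_iff by linarith+
    have "k mod d = j"
      unfolding k using \<open>j < d\<close> by simp
    then have "D < k mod d"
      using \<open>j < d\<close> \<open>M mod d < j\<close> assms by auto
    then have "((\<lambda>w. \<Prod>j<k. cstep w j) \<longlongrightarrow> 0) (at \<zeta>)"
      using prod_cstep_tendsto[of k] by auto
    then have "((\<lambda>w. f w k) \<longlongrightarrow> (1 - \<zeta> ^ (4 * k + 1)) * 0) (at \<zeta>)"
      unfolding f_def by (intro tendsto_intros)
    then show ?thesis by simp
  qed
  have "((\<lambda>w. (\<Sum>k<d * c. f w k) - (\<Sum>k\<in>{..<d * c} - {..M}. f w k)) \<longlongrightarrow> 0 - (\<Sum>k\<in>{..<d * c} - {..M}. 0)) (at \<zeta>)"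
    by (intro tendsto_intros rest) (use blocks_tendsto_0 in \<open>simp add: f_def\<close>)
  moreover have "(\<Sum>k<d * c. f w k) - (\<Sum>k\<in>{..<d * c} - {..M}. f w k) = (\<Sum>k\<le>M. f w k)" for w
    using sum.subset_diff[OF sub, of "f w"] by simp
  ultimately show ?thesis by (simp add: f_def)
qed

end

section \<open>Vanishing to fourth order at primitive roots\<close>

definition defect :: "nat \<Rightarrow> complex \<Rightarrow> complex" where
  "defect n w = 1 - w ^ n"

definition shift :: "nat \<Rightarrow> complex \<Rightarrow> complex" where
  "shift n w = (1 - w ^ n)\<^sup>2 / w ^ n"

definition kappa :: "nat \<Rightarrow> complex" where
  "kappa n = (of_nat n ^ 2 - 1) / 24"

section \<open>First-order behaviour of the deformations at a primitive \<open>n\<close>-th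
  root\<close>

context
  fixes \<zeta> :: complex and n N :: nat
  assumes n: "n = 2 * N + 1" and prim: "\<zeta> \<in> primroots n"
begin

lemmas zn = zeta_d[OF n prim] zeta0[OF n prim] zeta_plus[OF n prim]
lemmas zstep = zeta_step[OF n prim]

lemma defect_tendsto: "(defect n \<longlongrightarrow> 0) (at \<zeta>)"
proof -
  have "((\<lambda>w. 1 - w ^ n) \<longlongrightarrow> 1 - \<zeta> ^ n) (at \<zeta>)" by (intro tendsto_intros)
  then show ?thesis by (simp add: defect_def[abs_def] zn)
qed

lemma shift_tendsto: "(shift n \<longlongrightarrow> 0) (at \<zeta>)"
proof -
  have "((\<lambda>w. (1 - w ^ n)\<^sup>2 / w ^ n) \<longlongrightarrow> (1 - \<zeta> ^ n)\<^sup>2 / \<zeta> ^ n) (at \<zeta>)"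
    by (intro tendsto_intros) (simp add: zn)
  then show ?thesis by (simp add: shift_def[abs_def] zn)
qed

lemma eventually_generic_8n: "\<forall>\<^sub>F w in at \<zeta>. w \<noteq> 0 \<and> (\<forall>m. 0 < m \<and> m \<le> 8 * n \<longrightarrow> w ^ m \<noteq> 1)"
  by (rule eventually_generic)

lemma eventually_nonzero: "\<forall>\<^sub>F w in at \<zeta>. defect n w \<noteq> 0" "\<forall>\<^sub>F w in at \<zeta>. shift n w \<noteq> 0"
proof -
  have "0 < n" "n \<le> 8 * n" using n by auto
  then show "\<forall>\<^sub>F w in at \<zeta>. defect n w \<noteq> 0" "\<forall>\<^sub>F w in at \<zeta>. shift n w \<noteq> 0"
    by (auto intro: eventually_mono[OF eventually_generic_8n] simp: defect_def shift_def)
qed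

lemma phi_tendsto: "((\<lambda>w. phi w m) \<longlongrightarrow> phi \<zeta> m) (at \<zeta>)" if "\<zeta> ^ m \<noteq> 1"
  unfolding phi_def by (intro tendsto_intros) (use that in simp)

lemma phi_step_tendsto:
  assumes "i < N"
  shows "((\<lambda>w. phi w (2 * i + 1)) \<longlongrightarrow> phi \<zeta> (2 * i + 1)) (at \<zeta>)"
    "((\<lambda>w. phi w (2 * i + 2)) \<longlongrightarrow> phi \<zeta> (2 * i + 2)) (at \<zeta>)"
  using zstep[OF assms] by (intro phi_tendsto; simp del: power_Suc)+

lemma cprod_tendsto:
  assumes "k \<le> N"
  shows "((\<lambda>w. \<Prod>i<k. cstep w i) \<longlongrightarrow> (\<Prod>i<k. cstep \<zeta> i)) (at \<zeta>)"
proof (intro tendsto_prod)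
  fix i assume "i \<in> {..<k}"
  then show "((\<lambda>w. cstep w i) \<longlongrightarrow> cstep \<zeta> i) (at \<zeta>)"
    using cstep_tendsto[OF n prim, of i 0] assms by simp
qed

lemma hprod_tendsto:
  assumes "k \<le> N"
  shows "((\<lambda>w. \<Prod>i<k. hstep w i) \<longlongrightarrow> (\<Prod>i<k. hstep \<zeta> i)) (at \<zeta>)"
proof (intro tendsto_prod)
  fix i assume "i \<in> {..<k}"
  then have "i < N" using assms by simp
  then have "(1 - \<zeta> ^ (2 * i + 2))\<^sup>2 * (1 + \<zeta> ^ (2 * i + 2)) \<noteq> 0"
    using zstep zn(3) by (simp del: power_Suc)
  then show "((\<lambda>w. hstep w i) \<longlongrightarrow> hstep \<zeta> i) (at \<zeta>)"
    unfolding hstep_def by (intro tendsto_intros)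
qed

lemma rprod_tendsto: "((\<lambda>w. \<Prod>i<N. rstep w i) \<longlongrightarrow> (\<Prod>i<N. rstep \<zeta> i)) (at \<zeta>)"
proof (intro tendsto_prod)
  fix i assume "i \<in> {..<N}"
  then have "1 - \<zeta> ^ (2 * i + 2) \<noteq> 0"
    using zstep by (simp del: power_Suc)
  then show "((\<lambda>w. rstep w i) \<longlongrightarrow> rstep \<zeta> i) (at \<zeta>)"
    unfolding rstep_def by (intro tendsto_intros)
qed

lemma goprod_tendsto: "((\<lambda>w. \<Prod>i<k. gostep w (w ^ n) i) \<longlongrightarrow> 1) (at \<zeta>)" if "k \<le> N"
proof -
  have "((\<lambda>w. \<Prod>i<k. gostep w (w ^ n) i) \<longlongrightarrow> (\<Prod>i<k. gostep \<zeta> (\<zeta> ^ n) i)) (at \<zeta>)"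
  proof (intro tendsto_prod)
    fix i assume "i \<in> {..<k}"
    then have "i < N" using that by simp
    then have "(\<zeta> ^ (2 * i + 2) - \<zeta> ^ n) * (1 - \<zeta> ^ (2 * i + 1)) \<noteq> 0"
      using zstep zn by (simp del: power_Suc)
    then show "((\<lambda>w. gostep w (w ^ n) i) \<longlongrightarrow> gostep \<zeta> (\<zeta> ^ n) i) (at \<zeta>)"
      unfolding gostep_def by (intro tendsto_intros)
  qed
  moreover have "(\<Prod>i<k. gostep \<zeta> (\<zeta> ^ n) i) = 1"
  proof (intro prod.neutral ballI)
    fix i assume "i \<in> {..<k}"
    then have "1 - \<zeta> ^ (2 * i + 1) \<noteq> 0" "1 - \<zeta> ^ (2 * i + 2) \<noteq> 0" using that zstep by (simp_all del: power_Suc)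
    moreover have "(u - 1) * (1 - v) / ((v - 1) * (1 - u)) = 1" if "1 - u \<noteq> 0" "1 - v \<noteq> 0" for u v :: complex
    proof -
      have "(u - 1) * (1 - v) = (v - 1) * (1 - u)" by (simp add: algebra_simps)
      then show ?thesis using that by simp
    qed
    ultimately show "gostep \<zeta> (\<zeta> ^ n) i = 1" unfolding gostep_def zn by blast
  qed
  ultimately show ?thesis by simp
qed

lemma fo_tendsto: "((\<lambda>w. ((\<Prod>i<k. 1 - shift n w * phi w (2 * i + 1)) - 1) / shift n w) \<longlongrightarrow> (\<Sum>i<k. - phi \<zeta> (2 * i + 1))) (at \<zeta>)"
  if "k \<le> N"
  using tendsto_prod_perturbation[OF shift_tendsto eventually_nonzero(2), of k "\<lambda>w i. - phi w (2 * i + 1)" "\<lambda>i. - phi \<zeta> (2 * i + 1)"]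
    phi_step_tendsto(1) that by (simp add: tendsto_minus del: power_Suc)

text \<open>The even factors come from the prefactor in \<open>watson_fg\<close>; by
  \<open>sum_phi\<close> their first-order coefficient is the constant of the congruence.\<close>

lemma pp_tendsto: "((\<lambda>w. ((\<Prod>i<N. 1 - shift n w * phi w (2 * i + 2)) - 1) / shift n w) \<longlongrightarrow> kappa n) (at \<zeta>)"
proof -
  have "((\<lambda>w. ((\<Prod>i<N. 1 - shift n w * phi w (2 * i + 2)) - 1) / shift n w) \<longlongrightarrow> (\<Sum>i<N. - phi \<zeta> (2 * i + 2))) (at \<zeta>)"
    using tendsto_prod_perturbation[OF shift_tendsto eventually_nonzero(2), of N "\<lambda>w i. - phi w (2 * i + 2)" "\<lambda>i. - phi \<zeta> (2 * i + 2)"]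
      phi_step_tendsto(2) by (simp add: tendsto_minus del: power_Suc)
  moreover have "(\<Sum>i<N. - phi \<zeta> (2 * i + 2)) = kappa n"
    unfolding sum_negf sum_phi[OF n prim] kappa_def by simp
  ultimately show ?thesis by simp
qed

lemma pp_tendsto_1: "((\<lambda>w. \<Prod>i<k. 1 - shift n w * phi w (2 * i + 2)) \<longlongrightarrow> 1) (at \<zeta>)" if "k \<le> N"
proof -
  have "((\<lambda>w. \<Prod>i<k. 1 - shift n w * phi w (2 * i + 2)) \<longlongrightarrow> (\<Prod>i<k. 1 - 0 * phi \<zeta> (2 * i + 2))) (at \<zeta>)"
    by (intro tendsto_intros shift_tendsto phi_step_tendsto) (use that in auto)
  then show ?thesis by simp
qed

lemma f_tendsto: "((\<lambda>w. ((\<Prod>i<k. fstep w (shift n w) i) - 1) / shift n w)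
    \<longlongrightarrow> (\<Sum>i<k. phi \<zeta> (2 * i + 2) - phi \<zeta> (2 * i + 1))) (at \<zeta>)" if "k \<le> N"
proof -
  \<comment> \<open>Chosen so that \<open>1 + shift n w * \<beta> w i\<close> equals
    \<open>fstep\<close> exactly wherever the denominator is nonzero.\<close>
  define \<beta> where "\<beta> w i = (phi w (2 * i + 2) - phi w (2 * i + 1)) / (1 - shift n w * phi w (2 * i + 2))" for w i
  have lim1: "((\<lambda>w. 1 - shift n w * phi w (2 * i + 2)) \<longlongrightarrow> 1) (at \<zeta>)" if "i < N" for i
  proof -
    have "((\<lambda>w. 1 - shift n w * phi w (2 * i + 2)) \<longlongrightarrow> 1 - 0 * phi \<zeta> (2 * i + 2)) (at \<zeta>)"
      by (intro tendsto_intros shift_tendsto phi_step_tendsto that)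
    then show ?thesis by simp
  qed
  have "((\<lambda>w. \<beta> w i) \<longlongrightarrow> phi \<zeta> (2 * i + 2) - phi \<zeta> (2 * i + 1)) (at \<zeta>)" if "i < k" for i
  proof -
    have i: "i < N" using that \<open>k \<le> N\<close> by simp
    have "((\<lambda>w. \<beta> w i) \<longlongrightarrow> (phi \<zeta> (2 * i + 2) - phi \<zeta> (2 * i + 1)) / 1) (at \<zeta>)"
      unfolding \<beta>_def by (intro tendsto_divide tendsto_diff phi_step_tendsto i lim1) simp
    then show ?thesis by simp
  qed
  from tendsto_prod_perturbation[OF shift_tendsto eventually_nonzero(2) this]
  have "((\<lambda>w. ((\<Prod>i<k. 1 + shift n w * \<beta> w i) - 1) / shift n w) \<longlongrightarrow> (\<Sum>i<k. phi \<zeta> (2 * i + 2) - phi \<zeta> (2 * i + 1))) (at \<zeta>)"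
    by simp
  moreover have "\<forall>\<^sub>F w in at \<zeta>. \<forall>i\<in>{..<k}. 1 - shift n w * phi w (2 * i + 2) \<noteq> 0"
    by (intro eventually_ball_finite ballI tendsto_imp_eventually_ne[OF lim1]) (use that in auto)
  then have "\<forall>\<^sub>F w in at \<zeta>. ((\<Prod>i<k. 1 + shift n w * \<beta> w i) - 1) / shift n w = ((\<Prod>i<k. fstep w (shift n w) i) - 1) / shift n w"
  proof eventually_elim
    case (elim w)
    have "1 + shift n w * \<beta> w i = fstep w (shift n w) i" if "i < k" for i
    proof -
      have "1 - shift n w * phi w (2 * i + 2) \<noteq> 0" using elim that by blast
      then show ?thesis unfolding \<beta>_def fstep_def by (simp add: divide_simps) (simp add: algebra_simps)
    qed
    then show ?case by simp
  qed
  ultimately show ?thesis by (rule Lim_transform_eventually)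
qed

lemma g_tendsto: "((\<lambda>w. ((\<Prod>i<k. gstep w (w ^ n) i) - 1) / defect n w) \<longlongrightarrow> (\<Sum>i<k. gslope \<zeta> i)) (at \<zeta>)" if "k \<le> N"
proof -
  \<comment> \<open>Chosen so that \<open>1 + defect n w * \<gamma> w i\<close> is exactly
    \<open>gstep\<close> at \<open>z = w ^ n\<close>; at \<zeta> it becomes
    \<open>gslope\<close>.\<close>
  define \<gamma> where "\<gamma> w i = - (1 - w ^ (2 * i + 1) * w ^ (2 * i + 2)) / ((1 - w ^ (2 * i + 1)) * (1 - w ^ n * w ^ (2 * i + 2)))"
    for w :: complex and i
  have "((\<lambda>w. \<gamma> w i) \<longlongrightarrow> gslope \<zeta> i) (at \<zeta>)" if "i < k" for i
  proof -
    have i: "i < N" using that \<open>k \<le> N\<close> by simp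
    have "((\<lambda>w. \<gamma> w i) \<longlongrightarrow> - (1 - \<zeta> ^ (2 * i + 1) * \<zeta> ^ (2 * i + 2)) / ((1 - \<zeta> ^ (2 * i + 1)) * (1 - \<zeta> ^ n * \<zeta> ^ (2 * i + 2)))) (at \<zeta>)"
      unfolding \<gamma>_def by (intro tendsto_intros) (use zstep[OF i] in \<open>simp add: zn del: power_Suc\<close>)
    then show ?thesis by (simp only: zn(1) gslope_def mult_1_left)
  qed
  from tendsto_prod_perturbation[OF defect_tendsto eventually_nonzero(1) this]
  have "((\<lambda>w. ((\<Prod>i<k. 1 + defect n w * \<gamma> w i) - 1) / defect n w) \<longlongrightarrow> (\<Sum>i<k. gslope \<zeta> i)) (at \<zeta>)"
    by simp
  moreover have "\<forall>\<^sub>F w in at \<zeta>. ((\<Prod>i<k. 1 + defect n w * \<gamma> w i) - 1) / defect n w = ((\<Prod>i<k. gstep w (w ^ n) i) - 1) / defect n w"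
    using eventually_generic_8n
  proof eventually_elim
    case (elim w)
    have "1 + defect n w * \<gamma> w i = gstep w (w ^ n) i" if "i < k" for i
    proof -
      define u v where "u = w ^ (2 * i + 1)" and "v = w ^ (2 * i + 2)"
      have "w ^ (2 * i + 1) \<noteq> 1" "w ^ (n + (2 * i + 2)) \<noteq> 1"
        using elim that \<open>k \<le> N\<close> n by (simp_all del: power_Suc add: power_add[symmetric] del: power_add)
      then have "1 - u \<noteq> 0" "1 - w ^ n * v \<noteq> 0" by (simp_all add: u_def v_def power_add mult_ac)
      then show ?thesis
        unfolding \<gamma>_def gstep_def defect_def u_def[symmetric] v_def[symmetric]
        by (simp add: divide_simps) (simp add: algebra_simps)
    qed
    then show ?case by simp
  qed
  ultimately show ?thesis by (rule Lim_transform_eventually)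
qed

text \<open>An exact identity: the undeformed sum is the mixed difference plus the sums of
  \<open>watson_f\<close> and \<open>watson_g\<close> minus that of \<open>watson_fg\<close>. Every
  difference is divided by \<open>defect * shift\<close>, which is
  \<open>defect ^ 3 / w ^ n\<close>, so that the bracket on the left has a limit.\<close>

lemma defect_identity:
  assumes w: "w \<noteq> 0" "\<And>m. 0 < m \<Longrightarrow> m \<le> 8 * n \<Longrightarrow> w ^ m \<noteq> 1"
    and pp0: "(\<Prod>i<N. 1 - shift n w * phi w (2 * i + 2)) \<noteq> 0"
  shows "1 / w ^ n * ((\<Sum>k\<le>N. (1 - w ^ (4 * k + 1)) * (\<Prod>i<k. cstep w i)
          * (((\<Prod>i<k. fstep w (shift n w) i) - 1) / shift n w) * (((\<Prod>i<k. gstep w (w ^ n) i) - 1) / defect n w))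
      + 1 / w ^ N * (\<Sum>k\<le>N. (\<Prod>i<k. hstep w i) * (((\<Prod>i<k. 1 - shift n w * phi w (2 * i + 1)) - 1) / shift n w))
      + (\<Prod>i<N. rstep w i)\<^sup>2 * (\<Sum>k\<le>N. (\<Prod>i<k. hstep w i) * (\<Prod>i<k. gostep w (w ^ n) i)
          * ((((\<Prod>i<N. 1 - shift n w * phi w (2 * i + 2)) - 1) / shift n w
             - ((\<Prod>i<k. 1 - shift n w * phi w (2 * i + 1)) - 1) / shift n w) / (\<Prod>i<N. 1 - shift n w * phi w (2 * i + 2))))
      - 1 / w ^ N * w ^ n * kappa n * (\<Sum>k\<le>N. \<Prod>i<k. hstep w i))
    = ((\<Sum>k\<le>N. (1 - w ^ (4 * k + 1)) * (\<Prod>i<k. cstep w i))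
       - defect n w / w ^ N * (1 + (defect n w)\<^sup>2 * kappa n) * (\<Sum>k\<le>N. \<Prod>i<k. hstep w i)) / defect n w ^ 3"
proof -
  have n0: "0 < n" using n by simp
  have q1: "1 - w \<noteq> 0" using w(2)[of 1] n0 by simp
  have X0: "defect n w \<noteq> 0" using w(2)[of n] n0 by (simp add: defect_def)
  have y: "shift n w = (1 - w ^ n)\<^sup>2 / w ^ n" "shift n w = (defect n w)\<^sup>2 / w ^ n"
    by (simp_all add: shift_def defect_def)
  have y0: "shift n w \<noteq> 0" using X0 w(1) by (simp add: y(2))
  define a C F G H FO GO where "a k = 1 - w ^ (4 * k + 1)" and "C k = (\<Prod>i<k. cstep w i)"
    and "F k = (\<Prod>i<k. fstep w (shift n w) i)" and "G k = (\<Prod>i<k. gstep w (w ^ n) i)"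
    and "H k = (\<Prod>i<k. hstep w i)" and "FO k = (\<Prod>i<k. 1 - shift n w * phi w (2 * i + 1))"
    and "GO k = (\<Prod>i<k. gostep w (w ^ n) i)" for k
  define R P where "R = (\<Prod>i<N. rstep w i)\<^sup>2" and "P = (\<Prod>i<N. 1 - shift n w * phi w (2 * i + 2))"
  define X where "X = defect n w"
  define T where "T = 1 / w ^ N"
  define s where "s = shift n w"
  have scale: "(\<Sum>k\<le>N. a k * g k) = (1 - w) * (\<Sum>k\<le>N. (1 - w ^ (4 * k + 1)) / (1 - w) * g k)" for g
    unfolding sum_distrib_left by (intro sum.cong refl) (use q1 in \<open>simp add: a_def\<close>)
  have W1: "(\<Sum>k\<le>N. a k * (C k * F k)) = X * T * (\<Sum>k\<le>N. H k * FO k)"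
    unfolding scale C_def F_def H_def FO_def prod.distrib[symmetric] y(1)
    by (subst watson_f[OF n refl w]) (use q1 in \<open>simp_all add: X_def T_def defect_def\<close>)
  have W2: "(\<Sum>k\<le>N. a k * (C k * G k)) = X * R * (\<Sum>k\<le>N. H k * GO k)"
    unfolding scale C_def G_def H_def GO_def prod.distrib[symmetric]
    by (subst watson_g[OF n refl w]) (use q1 in \<open>simp_all add: X_def R_def defect_def\<close>)
  have W3: "(\<Sum>k\<le>N. a k * (C k * F k * G k)) = X * R / P * (\<Sum>k\<le>N. H k * FO k * GO k)"
    unfolding scale C_def F_def G_def H_def FO_def GO_def P_def prod.distrib[symmetric] y(1)
    by (subst watson_fg[OF n refl w]) (use q1 in \<open>simp_all add: X_def R_def defect_def\<close>)
  \<comment> \<open>Expansion of \<open>(F - 1) * (G - 1)\<close> into the doubly deformed, the two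
    singly deformed and the undeformed sum.\<close>
  have e1: "X * s * (\<Sum>k\<le>N. a k * C k * ((F k - 1) / s) * ((G k - 1) / X))
      = (\<Sum>k\<le>N. a k * (C k * F k * G k)) - (\<Sum>k\<le>N. a k * (C k * F k)) - (\<Sum>k\<le>N. a k * (C k * G k)) + (\<Sum>k\<le>N. a k * C k)"
    unfolding sum_distrib_left sum_subtractf[symmetric] sum.distrib[symmetric]
    by (intro sum.cong refl) (use X0 y0 in \<open>simp add: X_def[symmetric] s_def[symmetric] field_simps\<close>)
  have e2: "X * s * (T * (\<Sum>k\<le>N. H k * ((FO k - 1) / s))) = X * T * (\<Sum>k\<le>N. H k * FO k) - X * T * (\<Sum>k\<le>N. H k)"
    unfolding sum_distrib_left sum_subtractf[symmetric] sum.distrib[symmetric]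
    by (intro sum.cong refl) (use y0 in \<open>simp add: s_def[symmetric] field_simps\<close>)
  \<comment> \<open>The evaluations with \<open>b = w ^ n\<close> differ by
    \<open>1 - FO k / P\<close> in each summand, a quantity of first order in
    \<open>s\<close>.\<close>
  have e3: "X * s * (R * (\<Sum>k\<le>N. H k * GO k * (((P - 1) / s - (FO k - 1) / s) / P)))
      = X * R * (\<Sum>k\<le>N. H k * GO k) - X * R / P * (\<Sum>k\<le>N. H k * FO k * GO k)"
    unfolding sum_distrib_left sum_subtractf[symmetric] sum.distrib[symmetric]
    by (intro sum.cong refl) (use y0 pp0[folded P_def] in \<open>simp add: s_def[symmetric] field_simps\<close>)
  \<comment> \<open>This is the correction term of the claimed right-hand side, rewritten with
    \<open>s * w ^ n = X^2\<close>.\<close>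
  have e4: "X * s * (T * w ^ n * kappa n * (\<Sum>k\<le>N. H k)) = X * T * (X\<^sup>2 * kappa n) * (\<Sum>k\<le>N. H k)"
    using w(1) by (simp add: s_def y(2) X_def[symmetric])
  define B1 B2 B3 B4 where "B1 = (\<Sum>k\<le>N. a k * C k * ((F k - 1) / s) * ((G k - 1) / X))"
    and "B2 = T * (\<Sum>k\<le>N. H k * ((FO k - 1) / s))"
    and "B3 = R * (\<Sum>k\<le>N. H k * GO k * (((P - 1) / s - (FO k - 1) / s) / P))"
    and "B4 = T * w ^ n * kappa n * (\<Sum>k\<le>N. H k)"
  have "X * s * (B1 + B2 + B3 - B4) = (\<Sum>k\<le>N. a k * C k) - X * T * (1 + X\<^sup>2 * kappa n) * (\<Sum>k\<le>N. H k)"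
    using e1 e2 e3 e4 unfolding B1_def[symmetric] B2_def[symmetric] B3_def[symmetric] B4_def[symmetric] W1 W2 W3
    by (simp add: distrib_left right_diff_distrib distrib_right del: mult_cancel_left)
  moreover have "X * s = X ^ 3 / w ^ n"
    by (simp add: s_def y(2) X_def power2_eq_square power3_eq_cube)
  ultimately have "1 / w ^ n * (B1 + B2 + B3 - B4)
     = ((\<Sum>k\<le>N. a k * C k) - X * T * (1 + X\<^sup>2 * kappa n) * (\<Sum>k\<le>N. H k)) / X ^ 3"
    using X0 w(1) by (simp add: X_def[symmetric] eq_divide_eq mult.commute)
  then show ?thesis
    unfolding B1_def B2_def B3_def B4_def a_def C_def F_def G_def H_def FO_def GO_def R_def P_def X_def T_def s_def
    by (simp only: times_divide_eq_right mult_1_right)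
qed

lemma defect_limit:
  "((\<lambda>w. ((\<Sum>k\<le>N. (1 - w ^ (4 * k + 1)) * (\<Prod>i<k. cstep w i))
       - defect n w / w ^ N * (1 + (defect n w)\<^sup>2 * kappa n) * (\<Sum>k\<le>N. \<Prod>i<k. hstep w i)) / defect n w ^ 3) \<longlongrightarrow> 0) (at \<zeta>)"
proof -
  define L G A H t where "L k = (\<Sum>i<k. phi \<zeta> (2 * i + 2) - phi \<zeta> (2 * i + 1))" and "G k = (\<Sum>i<k. gslope \<zeta> i)"
    and "A k = (\<Sum>i<k. - phi \<zeta> (2 * i + 1))" and "H k = (\<Prod>i<k. hstep \<zeta> i)"
    and "t k = (1 - \<zeta> ^ (4 * k + 1)) * (\<Prod>i<k. cstep \<zeta> i)" for k
  have "((\<lambda>w. 1 / w ^ n * ((\<Sum>k\<le>N. (1 - w ^ (4 * k + 1)) * (\<Prod>i<k. cstep w i)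
          * (((\<Prod>i<k. fstep w (shift n w) i) - 1) / shift n w) * (((\<Prod>i<k. gstep w (w ^ n) i) - 1) / defect n w))
      + 1 / w ^ N * (\<Sum>k\<le>N. (\<Prod>i<k. hstep w i) * (((\<Prod>i<k. 1 - shift n w * phi w (2 * i + 1)) - 1) / shift n w))
      + (\<Prod>i<N. rstep w i)\<^sup>2 * (\<Sum>k\<le>N. (\<Prod>i<k. hstep w i) * (\<Prod>i<k. gostep w (w ^ n) i)
          * ((((\<Prod>i<N. 1 - shift n w * phi w (2 * i + 2)) - 1) / shift n w
             - ((\<Prod>i<k. 1 - shift n w * phi w (2 * i + 1)) - 1) / shift n w) / (\<Prod>i<N. 1 - shift n w * phi w (2 * i + 2))))
      - 1 / w ^ N * w ^ n * kappa n * (\<Sum>k\<le>N. \<Prod>i<k. hstep w i)))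
    \<longlongrightarrow> 1 / \<zeta> ^ n * ((\<Sum>k\<le>N. (1 - \<zeta> ^ (4 * k + 1)) * (\<Prod>i<k. cstep \<zeta> i) * L k * G k)
      + 1 / \<zeta> ^ N * (\<Sum>k\<le>N. H k * A k)
      + (\<Prod>i<N. rstep \<zeta> i)\<^sup>2 * (\<Sum>k\<le>N. H k * 1 * ((kappa n - A k) / 1))
      - 1 / \<zeta> ^ N * \<zeta> ^ n * kappa n * (\<Sum>k\<le>N. H k))) (at \<zeta>)"
    unfolding L_def G_def A_def H_def
    by (intro tendsto_mult tendsto_divide tendsto_add tendsto_diff tendsto_sum tendsto_power tendsto_const tendsto_ident_at
          cprod_tendsto hprod_tendsto rprod_tendsto goprod_tendsto fo_tendsto pp_tendsto pp_tendsto_1 f_tendsto g_tendsto)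
       (use zn in simp_all)
  \<comment> \<open>The coefficients \<open>L\<close> and \<open>G\<close> are symmetric under the
    reflection and the undeformed terms antisymmetric, so the mixed difference is of smaller
    order.\<close>
  moreover have "(\<Sum>k\<le>N. (1 - \<zeta> ^ (4 * k + 1)) * (\<Prod>i<k. cstep \<zeta> i) * L k * G k) = 0"
  proof (rule sum_atMost_antisym)
    fix k assume k: "k \<le> N"
    have "L (N - k) = L k"
      unfolding L_def by (rule sum_lessThan_antisym) (use phi_reflect[OF n prim] k in auto)
    moreover have "G (N - k) = G k"
      unfolding G_def by (rule sum_lessThan_antisym) (use gslope_reflect[OF n prim] k in auto)
    ultimately show "(1 - \<zeta> ^ (4 * (N - k) + 1)) * (\<Prod>i<N - k. cstep \<zeta> i) * L (N - k) * G (N - k)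
       = - ((1 - \<zeta> ^ (4 * k + 1)) * (\<Prod>i<k. cstep \<zeta> i) * L k * G k)"
      unfolding prod_cstep_antisym[OF n prim k] by simp
  qed
  \<comment> \<open>The odd coefficients \<open>A k\<close> cancel between \<open>watson_f\<close>
    and the pair of evaluations at \<open>b = w ^ n\<close>; the remaining \<open>kappa n\<close> is
    cancelled by the correction term.\<close>
  moreover have "1 / \<zeta> ^ N * (\<Sum>k\<le>N. H k * A k) + 1 / \<zeta> ^ N * (\<Sum>k\<le>N. H k * 1 * ((kappa n - A k) / 1))
      - 1 / \<zeta> ^ N * \<zeta> ^ n * kappa n * (\<Sum>k\<le>N. H k) = 0"
    by (simp add: zn right_diff_distrib sum_subtractf sum_distrib_left mult_ac flip: add_divide_distrib diff_divide_distrib)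
      (simp add: sum_divide_distrib)
  ultimately have "((\<lambda>w. 1 / w ^ n * ((\<Sum>k\<le>N. (1 - w ^ (4 * k + 1)) * (\<Prod>i<k. cstep w i)
          * (((\<Prod>i<k. fstep w (shift n w) i) - 1) / shift n w) * (((\<Prod>i<k. gstep w (w ^ n) i) - 1) / defect n w))
      + 1 / w ^ N * (\<Sum>k\<le>N. (\<Prod>i<k. hstep w i) * (((\<Prod>i<k. 1 - shift n w * phi w (2 * i + 1)) - 1) / shift n w))
      + (\<Prod>i<N. rstep w i)\<^sup>2 * (\<Sum>k\<le>N. (\<Prod>i<k. hstep w i) * (\<Prod>i<k. gostep w (w ^ n) i)
          * ((((\<Prod>i<N. 1 - shift n w * phi w (2 * i + 2)) - 1) / shift n w
             - ((\<Prod>i<k. 1 - shift n w * phi w (2 * i + 1)) - 1) / shift n w) / (\<Prod>i<N. 1 - shift n w * phi w (2 * i + 2))))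
      - 1 / w ^ N * w ^ n * kappa n * (\<Sum>k\<le>N. \<Prod>i<k. hstep w i))) \<longlongrightarrow> 0) (at \<zeta>)"
    unfolding prod_rstep_sq[OF n prim] by (simp only: add_0_left mult_zero_right)
  moreover have "\<forall>\<^sub>F w in at \<zeta>. (\<Prod>i<N. 1 - shift n w * phi w (2 * i + 2)) \<noteq> 0"
    by (rule tendsto_imp_eventually_ne[OF pp_tendsto_1]) simp_all
  then have "\<forall>\<^sub>F w in at \<zeta>. 1 / w ^ n * ((\<Sum>k\<le>N. (1 - w ^ (4 * k + 1)) * (\<Prod>i<k. cstep w i)
          * (((\<Prod>i<k. fstep w (shift n w) i) - 1) / shift n w) * (((\<Prod>i<k. gstep w (w ^ n) i) - 1) / defect n w))
      + 1 / w ^ N * (\<Sum>k\<le>N. (\<Prod>i<k. hstep w i) * (((\<Prod>i<k. 1 - shift n w * phi w (2 * i + 1)) - 1) / shift n w))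
      + (\<Prod>i<N. rstep w i)\<^sup>2 * (\<Sum>k\<le>N. (\<Prod>i<k. hstep w i) * (\<Prod>i<k. gostep w (w ^ n) i)
          * ((((\<Prod>i<N. 1 - shift n w * phi w (2 * i + 2)) - 1) / shift n w
             - ((\<Prod>i<k. 1 - shift n w * phi w (2 * i + 1)) - 1) / shift n w) / (\<Prod>i<N. 1 - shift n w * phi w (2 * i + 2))))
      - 1 / w ^ N * w ^ n * kappa n * (\<Sum>k\<le>N. \<Prod>i<k. hstep w i))
    = ((\<Sum>k\<le>N. (1 - w ^ (4 * k + 1)) * (\<Prod>i<k. cstep w i))
       - defect n w / w ^ N * (1 + (defect n w)\<^sup>2 * kappa n) * (\<Sum>k\<le>N. \<Prod>i<k. hstep w i)) / defect n w ^ 3"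
    using eventually_generic_8n by eventually_elim (rule defect_identity; blast)
  ultimately show ?thesis by (rule Lim_transform_eventually)
qed

text \<open>Between residue \<open>N\<close> and the end of the period the product of
  \<open>rstep\<close> contains \<open>1 - w ^ n\<close> once. Its fourth power in
  \<open>cstep\<close> leaves one such factor after division by the cube.\<close>

lemma tail_limit:
  assumes "N < k" "k < n"
  shows "((\<lambda>w. (1 - w ^ (4 * k + 1)) * (\<Prod>i<k. cstep w i) / defect n w ^ 3) \<longlongrightarrow> 0) (at \<zeta>)"
proof -
  have "((\<lambda>w. (1 - w ^ (4 * k + 1)) * ((\<Prod>i<k. reduced_factor n w (2 * i + 1) / reduced_factor n w (2 * i + 2)) ^ 4
      * (\<Prod>i<k. (1 + w ^ (2 * i + 1)) / ((1 + w ^ (2 * i + 2)) * w ^ (2 * i + 1))) * defect n w))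
    \<longlongrightarrow> (1 - \<zeta> ^ (4 * k + 1)) * (rprod_limit \<zeta> n k ^ 4
      * (\<Prod>i<k. (1 + \<zeta> ^ (2 * i + 1)) / ((1 + \<zeta> ^ (2 * i + 2)) * \<zeta> ^ (2 * i + 1))) * 0)) (at \<zeta>)"
    by (intro tendsto_mult tendsto_power tendsto_diff tendsto_const tendsto_ident_at defect_tendsto
        rprod_limit_tendsto[OF n prim] csmooth_tendsto[OF n prim])
  then have "((\<lambda>w. (1 - w ^ (4 * k + 1)) * ((\<Prod>i<k. reduced_factor n w (2 * i + 1) / reduced_factor n w (2 * i + 2)) ^ 4
      * (\<Prod>i<k. (1 + w ^ (2 * i + 1)) / ((1 + w ^ (2 * i + 2)) * w ^ (2 * i + 1))) * defect n w)) \<longlongrightarrow> 0) (at \<zeta>)"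
    by (simp only: mult_zero_right)
  moreover have "\<forall>\<^sub>F w in at \<zeta>. (1 - w ^ (4 * k + 1)) * ((\<Prod>i<k. reduced_factor n w (2 * i + 1) / reduced_factor n w (2 * i + 2)) ^ 4
      * (\<Prod>i<k. (1 + w ^ (2 * i + 1)) / ((1 + w ^ (2 * i + 2)) * w ^ (2 * i + 1))) * defect n w)
     = (1 - w ^ (4 * k + 1)) * (\<Prod>i<k. cstep w i) / defect n w ^ 3"
    using eventually_nonzero(1)
  proof eventually_elim
    case (elim w)
    have "(\<Prod>i<k. rstep w i) = (\<Prod>i<k. reduced_factor n w (2 * i + 1) / reduced_factor n w (2 * i + 2)) * defect n w"
      using prod_rstep_eq[OF n prim, of w k] elim assms by (simp add: defect_def del: power_Suc)
    then show ?case
      unfolding prod_cstep_eq using elim by (simp add: power_mult_distrib eval_nat_numeral)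
  qed
  ultimately show ?thesis by (rule Lim_transform_eventually)
qed

lemma full_limit:
  assumes "M = N \<or> M = n - 1"
  shows "((\<lambda>w. ((\<Sum>k\<le>M. (1 - w ^ (4 * k + 1)) * (\<Prod>i<k. cstep w i))
       - defect n w / w ^ N * (1 + (defect n w)\<^sup>2 * kappa n) * (\<Sum>k\<le>N. \<Prod>i<k. hstep w i)) / defect n w ^ 3) \<longlongrightarrow> 0) (at \<zeta>)"
proof -
  have sub: "{..N} \<subseteq> {..M}" using assms n by auto
  have "((\<lambda>w. \<Sum>k\<in>{..M} - {..N}. (1 - w ^ (4 * k + 1)) * (\<Prod>i<k. cstep w i) / defect n w ^ 3) \<longlongrightarrow> (\<Sum>k\<in>{..M} - {..N}. 0)) (at \<zeta>)"
    by (intro tendsto_sum tail_limit) (use assms n in auto)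
  from tendsto_add[OF this defect_limit] show ?thesis
    by (simp add: sum.subset_diff[OF sub] add_divide_distrib diff_divide_distrib sum_divide_distrib add_diff_eq)
qed

end

section \<open>The congruence\<close>

text \<open>The difference quotient at a zero of \<open>1 - w ^ n\<close>; it converts division by
  \<open>defect n w\<close> into division by \<open>w - z\<close>.\<close>

lemma defect_quotient_tendsto:
  assumes "z ^ n = 1"
  shows "((\<lambda>w. defect n w / (w - z)) \<longlongrightarrow> - (of_nat n * z ^ (n - 1))) (at z)"
proof -
  have "((\<lambda>w. 1 - w ^ n) has_field_derivative - (of_nat n * z ^ (n - 1))) (at z)"
    by (auto intro!: derivative_eq_intros)
  then show ?thesis
    using assms by (simp add: has_field_derivative_iff defect_def)
qed

text \<open>The odd numbers up to \<open>2 * k - 1\<close> sum to \<open>k^2\<close>, which accounts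
  for the power of \<open>w\<close>; the base \<open>w^4\<close> factors split as 1 - u^2 = (1 -
  u)(1 + u) and 1 - v^2 = (1 - v)(1 + v), raising the exponents of \<open>1 - u\<close> and
  \<open>1 - v\<close> to four.\<close>

lemma cprod_conv_qpoch:
  fixes w :: complex
  assumes "w \<noteq> 0"
  shows "(\<Prod>i<k. cstep w i) = qpoch w (w ^ 2) k ^ 3 * qpoch (w ^ 2) (w ^ 4) k
           / (qpoch (w ^ 2) (w ^ 2) k ^ 3 * qpoch (w ^ 4) (w ^ 4) k) * w powi (- (int k ^ 2))"
proof (induction k)
  case (Suc k)
  define u v where "u = w ^ (2 * k + 1)" and "v = w ^ (2 * k + 2)"
  have pw: "w * (w ^ 2) ^ k = u" "w ^ 2 * (w ^ 2) ^ k = v" "w ^ 2 * (w ^ 4) ^ k = u\<^sup>2" "w ^ 4 * (w ^ 4) ^ k = v\<^sup>2"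
    unfolding u_def v_def by (simp_all only: power_mult[symmetric] power_add[symmetric] power_Suc[symmetric])
      (rule arg_cong[where f = "power w"], simp)+
  have "- (int (Suc k) ^ 2) = - (int k ^ 2) + - int (2 * k + 1)"
    by (simp add: power2_eq_square algebra_simps)
  then have "w powi (- (int (Suc k) ^ 2)) = w powi (- (int k ^ 2)) / u"
    using assms by (simp only: power_int_add power_int_minus power_int_of_nat u_def divide_inverse simp_thms)
  moreover have "1 - u\<^sup>2 = (1 - u) * (1 + u)" "1 - v\<^sup>2 = (1 - v) * (1 + v)"
    by (simp_all add: power2_eq_square algebra_simps)
  ultimately show ?case
    unfolding prod.lessThan_Suc Suc.IH qpoch_Suc pw cstep_def[of w k] u_def[symmetric] v_def[symmetric]
    by (simp add: power_mult_distrib power4_eq_xxxx power3_eq_cube) (simp add: mult_ac)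
qed simp

lemma hprod_conv_qpoch:
  fixes w :: complex
  shows "(\<Prod>i<k. hstep w i) = qpoch w (w ^ 2) k ^ 3
            / (qpoch (w ^ 2) (w ^ 2) k * qpoch (w ^ 4) (w ^ 4) k) * (- w) ^ k"
proof (induction k)
  case (Suc k)
  define u v where "u = w ^ (2 * k + 1)" and "v = w ^ (2 * k + 2)"
  have pw: "w * (w ^ 2) ^ k = u" "w ^ 2 * (w ^ 2) ^ k = v" "w ^ 4 * (w ^ 4) ^ k = v\<^sup>2"
    unfolding u_def v_def by (simp_all only: power_mult[symmetric] power_add[symmetric] power_Suc[symmetric])
      (rule arg_cong[where f = "power w"], simp)+
  have "1 - v\<^sup>2 = (1 - v) * (1 + v)"
    by (simp_all add: power2_eq_square algebra_simps)
  then show ?case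
    unfolding prod.lessThan_Suc Suc.IH qpoch_Suc pw hstep_def[of w k] u_def[symmetric] v_def[symmetric]
    by (simp add: power_mult_distrib power2_eq_square power3_eq_cube) (simp add: mult_ac)
qed simp

lemma evals_qint: "w \<noteq> 1 \<Longrightarrow> evals w (qint m) ((1 - w ^ m) / (1 - w))"
  unfolding qint_def by (intro evals_divide evals_diff evals_1 evals_power evals_qvar) simp

text \<open>Every term has one factor \<open>1 / (1 - w)\<close> from its q-integer, which is pulled
  out. In the correction, \<open>[n]^2 * (1 - q)^2\<close> collapses to the square of
  \<open>defect n w\<close>.\<close>

lemma evals_difference:
  assumes n: "n = 2 * N + 1" and M: "M < n"
    and w: "w \<noteq> 0" "\<And>m. 0 < m \<Longrightarrow> m \<le> 8 * n \<Longrightarrow> w ^ m \<noteq> 1"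
  shows "evals w ((\<Sum>k=0..M. qint (4 * k + 1)
        * (qpoch qvar (qvar ^ 2) k ^ 3 * qpoch (qvar ^ 2) (qvar ^ 4) k
           / (qpoch (qvar ^ 2) (qvar ^ 2) k ^ 3 * qpoch (qvar ^ 4) (qvar ^ 4) k))
        * qvar powi (- (int k ^ 2)))
    - (qint n * qvar powi ((1 - int n) div 2)
        * (1 + qint n ^ 2 * ((of_nat n ^ 2 - 1) * (1 - qvar) ^ 2 / 24))
        * (\<Sum>k=0..(n - 1) div 2.
            qpoch qvar (qvar ^ 2) k ^ 3
            / (qpoch (qvar ^ 2) (qvar ^ 2) k * qpoch (qvar ^ 4) (qvar ^ 4) k)
            * (- qvar) ^ k)))
    (((\<Sum>k\<le>M. (1 - w ^ (4 * k + 1)) * (\<Prod>i<k. cstep w i))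
       - defect n w / w ^ N * (1 + (defect n w)\<^sup>2 * kappa n) * (\<Sum>k\<le>N. \<Prod>i<k. hstep w i)) / (1 - w))"
proof -
  have w1: "w \<noteq> 1" using w(2)[of 1] n by simp
  have nz: "qpoch (w ^ 2) (w ^ 2) k \<noteq> 0" "qpoch (w ^ 4) (w ^ 4) k \<noteq> 0" if "k < n" for k
  proof -
    have "w ^ 2 * (w ^ 2) ^ i = w ^ (2 * Suc i)" "w ^ 4 * (w ^ 4) ^ i = w ^ (4 * Suc i)" for i
      by (simp_all only: power_mult power_Suc)
    moreover have "w ^ (2 * Suc i) \<noteq> 1" "w ^ (4 * Suc i) \<noteq> 1" if "i < k" for i
      by (rule w(2); use that \<open>k < n\<close> in simp)+
    ultimately show "qpoch (w ^ 2) (w ^ 2) k \<noteq> 0" "qpoch (w ^ 4) (w ^ 4) k \<noteq> 0"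
      by (auto simp: qpoch_eq_0_iff simp del: power_Suc)
  qed
  have half: "(n - 1) div 2 = N" "(1 - int n) div 2 = - int N" using n by auto
  have main: "evals w ((\<Sum>k=0..M. qint (4 * k + 1)
        * (qpoch qvar (qvar ^ 2) k ^ 3 * qpoch (qvar ^ 2) (qvar ^ 4) k
           / (qpoch (qvar ^ 2) (qvar ^ 2) k ^ 3 * qpoch (qvar ^ 4) (qvar ^ 4) k))
        * qvar powi (- (int k ^ 2)))
    - (qint n * qvar powi ((1 - int n) div 2)
        * (1 + qint n ^ 2 * ((of_nat n ^ 2 - 1) * (1 - qvar) ^ 2 / 24))
        * (\<Sum>k=0..(n - 1) div 2.
            qpoch qvar (qvar ^ 2) k ^ 3
            / (qpoch (qvar ^ 2) (qvar ^ 2) k * qpoch (qvar ^ 4) (qvar ^ 4) k)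
            * (- qvar) ^ k)))
    ((\<Sum>k=0..M. (1 - w ^ (4 * k + 1)) / (1 - w)
        * (qpoch w (w ^ 2) k ^ 3 * qpoch (w ^ 2) (w ^ 4) k
           / (qpoch (w ^ 2) (w ^ 2) k ^ 3 * qpoch (w ^ 4) (w ^ 4) k))
        * w powi (- (int k ^ 2)))
    - ((1 - w ^ n) / (1 - w) * w powi ((1 - int n) div 2)
        * (1 + ((1 - w ^ n) / (1 - w)) ^ 2 * ((of_nat n ^ 2 - 1) * (1 - w) ^ 2 / 24))
        * (\<Sum>k=0..(n - 1) div 2.
            qpoch w (w ^ 2) k ^ 3
            / (qpoch (w ^ 2) (w ^ 2) k * qpoch (w ^ 4) (w ^ 4) k)
            * (- w) ^ k)))"
    by (intro evals_diff evals_sum evals_mult evals_divide evals_power evals_powi evals_qpoch evals_qvar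
        evals_qint evals_add evals_1 evals_of_nat evals_numeral evals_minus)
      (use w1 w(1) nz M half n in simp_all)
  have e1: "(\<Sum>k=0..M. (1 - w ^ (4 * k + 1)) / (1 - w)
        * (qpoch w (w ^ 2) k ^ 3 * qpoch (w ^ 2) (w ^ 4) k
           / (qpoch (w ^ 2) (w ^ 2) k ^ 3 * qpoch (w ^ 4) (w ^ 4) k))
        * w powi (- (int k ^ 2))) = (\<Sum>k\<le>M. (1 - w ^ (4 * k + 1)) * (\<Prod>i<k. cstep w i)) / (1 - w)"
    unfolding sum_divide_distrib atMost_atLeast0 cprod_conv_qpoch[OF w(1)] by (simp add: mult_ac)
  have e2: "(\<Sum>k=0..(n - 1) div 2. qpoch w (w ^ 2) k ^ 3
            / (qpoch (w ^ 2) (w ^ 2) k * qpoch (w ^ 4) (w ^ 4) k) * (- w) ^ k) = (\<Sum>k\<le>N. \<Prod>i<k. hstep w i)"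
    unfolding half(1) hprod_conv_qpoch atMost_atLeast0 ..
  have e3: "((1 - w ^ n) / (1 - w)) ^ 2 * ((of_nat n ^ 2 - 1) * (1 - w) ^ 2 / 24) = (defect n w)\<^sup>2 * kappa n"
    using w1 by (simp add: defect_def kappa_def power_divide)
  have e4: "w powi ((1 - int n) div 2) = 1 / w ^ N"
    unfolding half(2) by (simp add: power_int_minus divide_inverse)
  have e5: "x / (1 - w) - (1 - w ^ n) / (1 - w) * y * r * t = (x - defect n w * y * r * t) / (1 - w)" for x y r t
    by (simp add: defect_def flip: diff_divide_distrib)
  have e6: "defect n w * (1 / w ^ N) = defect n w / w ^ N"
    by simp
  show ?thesis
    using main unfolding e1 e2 e3 e4 e5 e6 .
qed

text \<open>If \<open>z\<close> has order \<open>d\<close> and \<open>n = d * (2 * j + 1)\<close>,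
  then \<open>N = d * j + D\<close>, so \<open>N\<close> and \<open>n - 1\<close> have the residues
  \<open>D\<close> and \<open>d - 1\<close> that \<open>sum_tendsto_0\<close> asks for. On the right
  the products of \<open>hstep\<close> stay bounded while \<open>defect\<close> tends to 0.\<close>

lemma proper_root_limit:
  assumes n: "n = 2 * N + 1" and M: "M = N \<or> M = n - 1" and z: "z ^ n = 1" "z \<noteq> 1"
  shows "((\<lambda>w. ((\<Sum>k\<le>M. (1 - w ^ (4 * k + 1)) * (\<Prod>i<k. cstep w i))
       - defect n w / w ^ N * (1 + (defect n w)\<^sup>2 * kappa n) * (\<Sum>k\<le>N. \<Prod>i<k. hstep w i)) / (1 - w)) \<longlongrightarrow> 0) (at z)"
proof -
  obtain d where dn: "d dvd n" and prim: "z \<in> primroots d"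
    using root_of_unity_primroots[of n] z n by fastforce
  have "odd d" using dn n by (metis dvd_trans even_plus_one_iff dvd_triv_left even_mult_iff)
  then obtain D where d: "d = 2 * D + 1" by (elim oddE)
  obtain m where m: "n = d * m" using dn by (elim dvdE)
  have "odd m" using m n by (metis even_mult_iff even_plus_one_iff dvd_triv_left)
  then obtain j where j: "m = 2 * j + 1" by (elim oddE)
  have N: "N = d * j + D" using n m j d by (simp add: algebra_simps)
  have "M mod d = D \<or> M mod d = d - 1"
    using M
  proof
    assume "M = N"
    moreover have "D < d" using d by simp
    ultimately show ?thesis using N by simp
  next
    assume "M = n - 1"
    moreover have "n - 1 = d * (m - 1) + (d - 1)" using m j d by (simp add: algebra_simps)
    moreover have "d - 1 < d" using d by simp
    ultimately show ?thesis by (simp only: mod_mult_self4 mod_less simp_thms)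
  qed
  then have lhs: "((\<lambda>w. \<Sum>k\<le>M. (1 - w ^ (4 * k + 1)) * (\<Prod>i<k. cstep w i)) \<longlongrightarrow> 0) (at z)"
    by (rule sum_tendsto_0[OF d prim])
  have "\<exists>l. \<forall>k. ((\<lambda>w. \<Prod>i<k. hstep w i) \<longlongrightarrow> l k) (at z)"
    using prod_hstep_tendsto[OF d prim] by metis
  then obtain l where l: "((\<lambda>w. \<Prod>i<k. hstep w i) \<longlongrightarrow> l k) (at z)" for k by blast
  have "((\<lambda>w. 1 - w ^ n) \<longlongrightarrow> 1 - z ^ n) (at z)" by (intro tendsto_intros)
  then have def0: "(defect n \<longlongrightarrow> 0) (at z)"
    by (simp add: defect_def[abs_def] z)
  have "((\<lambda>w. ((\<Sum>k\<le>M. (1 - w ^ (4 * k + 1)) * (\<Prod>i<k. cstep w i))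
       - defect n w / w ^ N * (1 + (defect n w)\<^sup>2 * kappa n) * (\<Sum>k\<le>N. \<Prod>i<k. hstep w i)) / (1 - w))
     \<longlongrightarrow> (0 - 0 / z ^ N * (1 + 0\<^sup>2 * kappa n) * (\<Sum>k\<le>N. l k)) / (1 - z)) (at z)"
    by (intro tendsto_mult tendsto_divide tendsto_add tendsto_diff tendsto_sum tendsto_power tendsto_const
        tendsto_ident_at lhs def0 l) (use z zeta0[OF d prim] in auto)
  then show ?thesis by simp
qed

theorem corollary2p5:
  fixes n M :: nat
  assumes "n > 0" and "odd n"
    and "M = (n - 1) div 2 \<or> M = n - 1"
  shows "ratfun_cong
    (\<Sum>k=0..M. qint (4 * k + 1)
        * (qpoch qvar (qvar ^ 2) k ^ 3 * qpoch (qvar ^ 2) (qvar ^ 4) k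
           / (qpoch (qvar ^ 2) (qvar ^ 2) k ^ 3 * qpoch (qvar ^ 4) (qvar ^ 4) k))
        * qvar powi (- (int k ^ 2)))
    (qint n * qvar powi ((1 - int n) div 2)
        * (1 + qint n ^ 2 * ((of_nat n ^ 2 - 1) * (1 - qvar) ^ 2 / 24))
        * (\<Sum>k=0..(n - 1) div 2.
            qpoch qvar (qvar ^ 2) k ^ 3
            / (qpoch (qvar ^ 2) (qvar ^ 2) k * qpoch (qvar ^ 4) (qvar ^ 4) k)
            * (- qvar) ^ k))
    (qint_poly n * cyclotomic n ^ 3)"
    (is "ratfun_cong ?A ?B _")
proof (cases "n = 1")
  \<comment> \<open>For \<open>n = 1\<close> only the terms \<open>k = 0\<close> remain and both
    sides are equal.\<close>
  case True
  with assms have "M = 0" by auto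
  with True have "?A - ?B = 0"
    by simp
  then show ?thesis
    unfolding ratfun_cong_def by simp
next
  case False
  define N where "N = (n - 1) div 2"
  have n: "n = 2 * N + 1" using assms by (auto simp: N_def elim!: oddE)
  have M: "M = N \<or> M = n - 1" using assms by (simp add: N_def)
  have Mn: "M < n" using M n by auto
  define E where "E w = ((\<Sum>k\<le>M. (1 - w ^ (4 * k + 1)) * (\<Prod>i<k. cstep w i))
       - defect n w / w ^ N * (1 + (defect n w)\<^sup>2 * kappa n) * (\<Sum>k\<le>N. \<Prod>i<k. hstep w i)) / (1 - w)" for w
  \<comment> \<open>\<open>E\<close> gives the values of the difference near every \<open>z\<close>,
    though perhaps not at \<open>z\<close> itself.\<close>
  have ev: "\<forall>\<^sub>F w in at z. evals w (?A - ?B) (E w)" for z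
    using eventually_generic[where z = z and K = "8 * n"]
    by eventually_elim (unfold E_def, rule evals_difference[OF n Mn], blast+)
  show ?thesis
    unfolding ratfun_cong_def
  proof (rule modulus_dvdI)
    show "n > 1" using False assms by simp
  next
    fix z :: complex
    assume z: "z ^ n = 1" "z \<noteq> 1"
    have "((\<lambda>w. E w / (w - z) ^ 0) \<longlongrightarrow> 0) (at z)"
      unfolding E_def using proper_root_limit[OF n M z] by simp
    from numerator_dvdI[OF ev this]
    show "[:- z, 1:] dvd map_poly of_rat (fst (quot_of_fract (?A - ?B)))" by simp
  next
    fix z assume prim: "z \<in> primroots n"
    then have z: "z ^ n = 1" "z \<noteq> 1"
      using False assms by (auto simp: primroots_def)
    \<comment> \<open>The cube of \<open>defect\<close> in \<open>full_limit\<close> is traded for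
      the cube of \<open>w - z\<close>; a zero limit after dividing by the cube means order at least
      four.\<close>
    have "((\<lambda>w. ((\<Sum>k\<le>M. (1 - w ^ (4 * k + 1)) * (\<Prod>i<k. cstep w i))
       - defect n w / w ^ N * (1 + (defect n w)\<^sup>2 * kappa n) * (\<Sum>k\<le>N. \<Prod>i<k. hstep w i)) / defect n w ^ 3
        * (defect n w / (w - z)) ^ 3 / (1 - w)) \<longlongrightarrow> 0 * (- (of_nat n * z ^ (n - 1))) ^ 3 / (1 - z)) (at z)"
      by (intro tendsto_mult tendsto_divide tendsto_power tendsto_diff tendsto_const tendsto_ident_at
          full_limit[OF n prim M] defect_quotient_tendsto) (use z in auto)
    then have "((\<lambda>w. ((\<Sum>k\<le>M. (1 - w ^ (4 * k + 1)) * (\<Prod>i<k. cstep w i))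
       - defect n w / w ^ N * (1 + (defect n w)\<^sup>2 * kappa n) * (\<Sum>k\<le>N. \<Prod>i<k. hstep w i)) / defect n w ^ 3
        * (defect n w / (w - z)) ^ 3 / (1 - w)) \<longlongrightarrow> 0) (at z)" by simp
    then have "((\<lambda>w. E w / (w - z) ^ 3) \<longlongrightarrow> 0) (at z)"
      by (rule Lim_transform_eventually)
        (use eventually_nonzero(1)[OF n prim] in eventually_elim, simp add: E_def power_divide)
    then have *: "[:- z, 1:] ^ Suc 3 dvd map_poly of_rat (fst (quot_of_fract (?A - ?B)))"
      by (rule numerator_dvdI[OF ev])
    have e: "[:- z, 1:] ^ 4 = [:- z, 1:] ^ Suc 3" by simp
    show "[:- z, 1:] ^ 4 dvd map_poly of_rat (fst (quot_of_fract (?A - ?B)))"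
      unfolding e by (rule *)
  qed
qed

end
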